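(* Let $\Pi$ be the plane $\{z=0\}$ in $\mathbb{R}^3$, let $C\subset\Pi$ be a simple closed curve bounding the bounded domain $\Omega\subset\Pi$, and let $\Sigma=C\times\mathbb{R}$ and $K=\Omega\times\mathbb{R}$. Let $S$ be a complete embedded minimal capillary surface situated outside of $\Sigma$, meeting $\Sigma$ at a constant angle $\gamma$ along $\partial S$, whose end is regular at infinity and parallel to $\Sigma$. Assume that $\partial S$ is a graph over $C$. (1) If the end of $S$ is planar, then $S$ is contained in a plane parallel to $\Pi$. (2) If the end of $S$ is catenoidal, then $\gamma\neq\pi/2$. (3) Assume moreover that $C$ is a circle, so that $\Sigma$ is a circular right cylinder with axis $L$. If the end of $S$ is catenoidal, then $S$ is part of a catenoid whose axis of rotation is $L$.
   Context: Coordinates $(x,y,z)$ on $\mathbb{R}^3$, with the $z$-axis vertical. A complete minimal capillary surface situated outside of $\Sigma$ is a minimal immersion $\phi:S\to\mathbb{R}^3\setminus\mathrm{int}(K)$ of a punctured surface $S$ with a single boundary component $\partial S$, such that $\phi(\partial S)\subset\Sigma$ is homotopic in $\Sigma$ to $C$ and $\phi(S)$ meets $\Sigma$ at a constant angle along $\phi(\partial S)$; when embedded, $S$ is identified with its image. The end of $S$ is the image of a small punctured-disc neighborhood of the puncture. The end is regular at infinity if, outside a bounded domain of some plane $\Pi_0$ and in orthonormal coordinates $(x,y)$ on $\Pi_0$ with height $u$ measured along the normal of $\Pi_0$, it is the graph of a function $u(x,y)=\alpha\log\sqrt{x^2+y^2}+\beta+\frac{\gamma_1x+\gamma_2y}{x^2+y^2}+O\!\left(\frac{1}{x^2+y^2}\right)$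 for constants $\alpha,\beta,\gamma_1,\gamma_2$. The end is planar if $\alpha=0$ and catenoidal if $\alpha\neq0$. The end is parallel to $\Sigma$ if $\Pi_0$ is parallel to $\Pi$. A curve in $\Sigma$ is a graph over $C$ if its vertical projection to $\Pi$ is a bijection onto $C$ (with nonvanishing derivative of the projection along the curve). *)

theory Defs
  imports "HOL-Analysis.Analysis"
begin

type_synonym R3 = "real \<times> real \<times> real"

definition xc :: "R3 \<Rightarrow> real" where "xc p = fst p"
definition yc :: "R3 \<Rightarrow> real" where "yc p = fst (snd p)"
definition zc :: "R3 \<Rightarrow> real" where "zc p = snd (snd p)"

definition hproj :: "R3 \<Rightarrow> real \<times> real" where "hproj p = (xc p, yc p)"

definition cross3 :: "R3 \<Rightarrow> R3 \<Rightarrow> R3" where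
  "cross3 a b = (yc a * zc b - zc a * yc b, zc a * xc b - xc a * zc b, xc a * yc b - yc a * xc b)"

definition pd1 :: "(real \<times> real \<Rightarrow> 'b::real_normed_vector) \<Rightarrow> real \<times> real \<Rightarrow> 'b" where
  "pd1 f z = frechet_derivative f (at z) (1, 0)"
definition pd2 :: "(real \<times> real \<Rightarrow> 'b::real_normed_vector) \<Rightarrow> real \<times> real \<Rightarrow> 'b" where
  "pd2 f z = frechet_derivative f (at z) (0, 1)"

definition C2_on :: "(real \<times> real) set \<Rightarrow> (real \<times> real \<Rightarrow> R3) \<Rightarrow> bool" where
  "C2_on W f \<longleftrightarrow>
     (\<forall>z\<in>W. f differentiable (at z) \<and> pd1 f differentiable (at z) \<and> pd2 f differentiable (at z))
   \<and> continuous_on W (pd1 f) \<and> continuous_on W (pd2 f)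
   \<and> continuous_on W (pd1 (pd1 f)) \<and> continuous_on W (pd2 (pd1 f))
   \<and> continuous_on W (pd1 (pd2 f)) \<and> continuous_on W (pd2 (pd2 f))"

definition halfplane :: "(real \<times> real) set" where
  "halfplane = {z. snd z \<ge> 0}"

definition surface_chart ::
  "R3 set \<Rightarrow> (real \<times> real \<Rightarrow> R3) \<Rightarrow> (real \<times> real) set \<Rightarrow> (real \<times> real) set \<Rightarrow> bool" where
  "surface_chart S f W V \<longleftrightarrow>
     open W \<and> V \<subseteq> W \<and> openin (top_of_set halfplane) V \<and> C2_on W f
   \<and> (\<forall>z\<in>W. cross3 (pd1 f z) (pd2 f z) \<noteq> 0)
   \<and> f ` V \<subseteq> S \<and> openin (top_of_set S) (f ` V)
   \<and> (\<exists>g. homeomorphism V (f ` V) f g)"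

definition embedded_surface :: "R3 set \<Rightarrow> bool" where
  "embedded_surface S \<longleftrightarrow> S \<noteq> {} \<and> (\<forall>p\<in>S. \<exists>f W V. surface_chart S f W V \<and> p \<in> f ` V)"

definition mean_curv_num :: "(real \<times> real \<Rightarrow> R3) \<Rightarrow> real \<times> real \<Rightarrow> real" where
  "mean_curv_num f z =
    (let a = pd1 f z; b = pd2 f z; n = cross3 a b;
         E = a \<bullet> a; F = a \<bullet> b; G = b \<bullet> b;
         L = pd1 (pd1 f) z \<bullet> n; M = pd2 (pd1 f) z \<bullet> n; N = pd2 (pd2 f) z \<bullet> n
     in E * N - 2 * F * M + G * L)"

definition minimal_surface :: "R3 set \<Rightarrow> bool" where
  "minimal_surface S \<longleftrightarrow> embedded_surface S \<and>
     (\<forall>f W V. surface_chart S f W V \<longrightarrow> (\<forall>z\<in>V. mean_curv_num f z = 0))"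

definition surf_boundary :: "R3 set \<Rightarrow> R3 set" where
  "surf_boundary S = {p. \<exists>f W V s. surface_chart S f W V \<and> (s, 0) \<in> V \<and> p = f (s, 0)}"

definition regular_jordan :: "(real \<Rightarrow> real \<times> real) \<Rightarrow> bool" where
  "regular_jordan g \<longleftrightarrow> (\<forall>t. g (t + 1) = g t) \<and> inj_on g {0..<1}
     \<and> g C1_differentiable_on UNIV \<and> (\<forall>t. vector_derivative g (at t) \<noteq> 0)"

definition curveC :: "(real \<Rightarrow> real \<times> real) \<Rightarrow> (real \<times> real) set" where
  "curveC g = g ` {0..1}"

definition Sigma_cyl :: "(real \<Rightarrow> real \<times> real) \<Rightarrow> R3 set" where
  "Sigma_cyl g = {p. hproj p \<in> curveC g}"
definition K_int :: "(real \<Rightarrow> real \<times> real) \<Rightarrow> R3 set" where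
  "K_int g = {p. hproj p \<in> inside (curveC g)}"

definition sigma_normal :: "(real \<Rightarrow> real \<times> real) \<Rightarrow> real \<Rightarrow> R3" where
  "sigma_normal g t = (let v = vector_derivative g (at t) in (snd v / norm v, - fst v / norm v, 0))"

definition capillary_surface :: "R3 set \<Rightarrow> (real \<Rightarrow> real \<times> real) \<Rightarrow> real \<Rightarrow> bool" where
  "capillary_surface S g gam \<longleftrightarrow>
     minimal_surface S \<and> closed S \<and> connected S
   \<and> S \<inter> K_int g = {}
   \<and> surf_boundary S \<noteq> {} \<and> compact (surf_boundary S) \<and> connected (surf_boundary S)
   \<and> surf_boundary S \<subseteq> Sigma_cyl g
   \<and> (\<exists>q. simple_path q \<and> pathfinish q = pathstart q \<and> path_image q = surf_boundary S
        \<and> (homotopic_loops (Sigma_cyl g) q (\<lambda>t. (fst (g t), snd (g t), 0))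
           \<or> homotopic_loops (Sigma_cyl g) q (reversepath (\<lambda>t. (fst (g t), snd (g t), 0)))))
   \<and> 0 \<le> gam \<and> gam \<le> pi
   \<and> (\<exists>\<nu>. continuous_on (surf_boundary S) \<nu> \<and>
        (\<forall>p\<in>surf_boundary S. norm (\<nu> p) = 1
          \<and> (\<forall>f W V z. surface_chart S f W V \<and> z \<in> V \<and> f z = p \<longrightarrow>
                 \<nu> p \<bullet> pd1 f z = 0 \<and> \<nu> p \<bullet> pd2 f z = 0)
          \<and> (\<forall>t. g t = hproj p \<longrightarrow> \<nu> p \<bullet> sigma_normal g t = cos gam)))"

text \<open>The end of S is regular at infinity and parallel to Sigma (i.e. Pi_0 is horizontal),
  with logarithmic growth coefficient alpha. Orthonormal coordinates on Pi_0 = {z = c0} are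
  given by an origin (a,b) and a rotation angle th; sg = +-1 orients the height.\<close>
definition regular_parallel_end :: "R3 set \<Rightarrow> real \<Rightarrow> bool" where
  "regular_parallel_end S \<alpha> \<longleftrightarrow>
    (\<exists>a b th sg c0 \<beta> \<gamma>1 \<gamma>2 D u M R.
       bounded D \<and> (sg = 1 \<or> sg = -1) \<and> R > 0 \<and>
       (let G = (\<lambda>(x, y). (a + x * cos th - y * sin th, b + x * sin th + y * cos th,
                           c0 + sg * u (x, y))) ` (UNIV - D)
        in G \<subseteq> S \<and> bounded (S - G)) \<and>
       (\<forall>x y. x\<^sup>2 + y\<^sup>2 \<ge> R\<^sup>2 \<longrightarrow> (x, y) \<notin> D \<and>
          \<bar>u (x, y) - (\<alpha> * ln (sqrt (x\<^sup>2 + y\<^sup>2)) + \<beta> + (\<gamma>1 * x + \<gamma>2 * y) / (x\<^sup>2 + y\<^sup>2))\<bar>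
            \<le> M / (x\<^sup>2 + y\<^sup>2)))"

definition boundary_graph_over :: "R3 set \<Rightarrow> (real \<Rightarrow> real \<times> real) \<Rightarrow> bool" where
  "boundary_graph_over S g \<longleftrightarrow>
     bij_betw hproj (surf_boundary S) (curveC g)
   \<and> (\<forall>f W V s. surface_chart S f W V \<and> (s, 0) \<in> V \<longrightarrow> hproj (pd1 f (s, 0)) \<noteq> 0)"

end

theory Submission
  imports Defs "HOL-Real_Asymp.Real_Asymp"
begin

text \<open>
  Everything follows from the maximum principle. If an ambient function restricted to a minimal
  surface has a local maximum at an interior point, the trace of its Hessian over the tangent plane
  is nonpositive; at a boundary point, its derivative along the inward conormal is nonpositive. This
  is applied to \<open>\<plusminus>(r\<^sup>2 - b\<^sup>2 cosh\<^sup>2 ((\<plusminus>z - h) / c))\<close>, whose zero set is a catenoid for \<open>b = c\<close> and has mean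
  curvature of a strict sign for \<open>b < c\<close> and for \<open>b > c\<close>, so that \<open>S\<close> can touch it only along \<open>\<partial>S\<close>.

  As \<open>\<partial>S\<close> is a graph over \<open>C\<close>, the vertical component of the inward conormal is
  \<open>\<plusminus>cos \<gamma>\<close> times the horizontal length of the unit tangent of \<open>\<partial>S\<close>, with a constant sign. For a
  planar end and \<open>\<gamma> \<noteq> \<pi>/2\<close>, a barrier with very small \<open>c\<close> around a point enclosed by \<open>C\<close> would be
  touched along \<open>\<partial>S\<close> with the wrong slope. For \<open>\<gamma> = \<pi>/2\<close> the height satisfies a Neumann condition,
  and the strong maximum principle with Hopf's lemma shows that it is constant if it attains a
  maximum or a minimum. If \<open>C\<close> is a circle, barriers with \<open>b\<close> and \<open>c\<close> on either side of the catenoid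
  meeting the cylinder at the angle \<open>\<gamma>\<close> first identify the logarithmic growth of \<open>S\<close> and then squeeze
  \<open>S\<close> onto that catenoid.
\<close>

section \<open>Second-order conditions in the plane\<close>

text \<open>Why \<open>b\<close> and \<open>c\<close> are kept apart: the surface
  \<open>r = b cosh (z / c)\<close> grows like \<open>c ln r\<close>, so \<open>c\<close> alone
  decides whether a comparison function attains its extremum on the noncompact \<open>S\<close>,
  while its slope at radius \<open>r\<close> is \<open>c / sqrt (r^2 - b^2)\<close>. An exact
  catenoid touching \<open>S\<close> in its interior would call for a tangency principle for two
  solutions of a nonlinear equation; for \<open>b\<close> different from \<open>c\<close> the plain
  second derivative test already gives a contradiction, and the exact catenoid is reached as a
  limit. Horizontal planes leave no such room: at a right angle they satisfy both the equation and
  the boundary condition with equality. There Hopf's lemma is used, for the height, which solves a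
  linear elliptic equation in every chart. The squared form of the barrier is smooth across the
  waist \<open>r = b\<close>, where the graph \<open>c arcosh (r / b)\<close> is not, and its
  Hessian is diagonal. Charts come without smooth transition maps; one-sided tangent directions of
  the set \<open>S\<close> replace them.\<close>

lemma second_derivative_test:
  fixes k k' :: "real \<Rightarrow> real"
  assumes e: "e > 0"
    and k: "\<And>t. \<bar>t\<bar> < e \<Longrightarrow> (k has_real_derivative k' t) (at t)"
    and k': "(k' has_real_derivative c) (at 0)"
    and max: "\<And>t. \<bar>t\<bar> < e \<Longrightarrow> k t \<le> k 0"
  shows "k' 0 = 0" and "c \<le> 0"
proof -
  show 0: "k' 0 = 0"
    using DERIV_local_max[of k "k' 0" 0 e] k[of 0] max e by auto
  show "c \<le> 0"
  proof (rule ccontr)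
    assume "\<not> c \<le> 0"
    then obtain d where d: "d > 0" "\<And>h. h > 0 \<Longrightarrow> h < d \<Longrightarrow> k' 0 < k' (0 + h)"
      using DERIV_pos_inc_right[OF k'] by auto
    define t where "t = min d e / 2"
    have t: "0 < t" "t < d" "t < e" using d e by (auto simp: t_def)
    have "\<exists>x. 0 < x \<and> x < t \<and> k t - k 0 = (t - 0) * k' x"
      using t by (intro MVT2) (auto intro!: k)
    then obtain x where x: "0 < x" "x < t" "k t - k 0 = t * k' x" by auto
    have "k' x > 0" using d(2)[of x] x t 0 by auto
    then have "k t > k 0" using x t by (smt (verit) mult_pos_pos)
    with max[of t] t show False by auto
  qed
qed

lemma second_derivative_test_plane:
  fixes \<Phi> P Q :: "real \<times> real \<Rightarrow> real"
  assumes U: "open U" "z \<in> U"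
    and D: "\<And>w. w \<in> U \<Longrightarrow> (\<Phi> has_derivative (\<lambda>h. fst h * P w + snd h * Q w)) (at w)"
    and P: "(P has_derivative (\<lambda>h. fst h * P1 + snd h * P2)) (at z)"
    and Q: "(Q has_derivative (\<lambda>h. fst h * Q1 + snd h * Q2)) (at z)"
    and max: "\<And>w. w \<in> U \<Longrightarrow> \<Phi> w \<le> \<Phi> z"
  shows "P z = 0" and "Q z = 0"
    and "d1\<^sup>2 * P1 + d1 * d2 * (P2 + Q1) + d2\<^sup>2 * Q2 \<le> 0"
proof -
  have *: "d1 * P z + d2 * Q z = 0 \<and> d1\<^sup>2 * P1 + d1 * d2 * (P2 + Q1) + d2\<^sup>2 * Q2 \<le> 0" for d1 d2
  proof -
    define l where "l t = z + t *\<^sub>R (d1, d2)" for t :: real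
    have l: "(l has_derivative (\<lambda>t. t *\<^sub>R (d1, d2))) (at t)" for t
      unfolding l_def by (auto intro!: derivative_eq_intros)
    have "open (l -` U)"
      by (rule open_vimage[OF U(1)]) (auto simp: l_def intro!: continuous_intros)
    moreover have "0 \<in> l -` U" using U by (auto simp: l_def zero_prod_def[symmetric])
    ultimately obtain e where e: "e > 0" "ball 0 e \<subseteq> l -` U"
      by (meson openE)
    have lU: "l t \<in> U" if "\<bar>t\<bar> < e" for t
      using e(2) that by (auto simp: subset_iff dist_real_def)
    have l0: "l 0 = z" by (simp add: l_def zero_prod_def[symmetric])
    let ?k = "\<lambda>t. \<Phi> (l t)" and ?k' = "\<lambda>t. d1 * P (l t) + d2 * Q (l t)"
    have k: "(?k has_real_derivative ?k' t) (at t)" if "\<bar>t\<bar> < e" for t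
    proof -
      have "(?k has_derivative (\<lambda>h. fst (h *\<^sub>R (d1, d2)) * P (l t) + snd (h *\<^sub>R (d1, d2)) * Q (l t))) (at t)"
        by (rule has_derivative_compose[OF l D[OF lU[OF that]]])
      then show ?thesis unfolding has_field_derivative_def
        by (rule has_derivative_eq_rhs) (auto simp: fun_eq_iff algebra_simps)
    qed
    have k': "(?k' has_real_derivative (d1\<^sup>2 * P1 + d1 * d2 * (P2 + Q1) + d2\<^sup>2 * Q2)) (at 0)"
    proof -
      have 1: "((\<lambda>t. P (l t)) has_derivative (\<lambda>h. fst (h *\<^sub>R (d1, d2)) * P1 + snd (h *\<^sub>R (d1, d2)) * P2)) (at 0)"
        by (rule has_derivative_compose[OF l]) (use P l0 in simp)
      have 2: "((\<lambda>t. Q (l t)) has_derivative (\<lambda>h. fst (h *\<^sub>R (d1, d2)) * Q1 + snd (h *\<^sub>R (d1, d2)) * Q2)) (at 0)"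
        by (rule has_derivative_compose[OF l]) (use Q l0 in simp)
      show ?thesis unfolding has_field_derivative_def
        by (rule has_derivative_eq_rhs[OF has_derivative_add[OF has_derivative_mult_right[OF 1] has_derivative_mult_right[OF 2]]])
          (auto simp: fun_eq_iff algebra_simps power2_eq_square)
    qed
    have m: "?k t \<le> ?k 0" if "\<bar>t\<bar> < e" for t using max[OF lU[OF that]] l0 by simp
    show ?thesis using second_derivative_test[OF e(1) k k' m] l0 by auto
  qed
  show "P z = 0" using *[of 1 0] by simp
  show "Q z = 0" using *[of 0 1] by simp
  show "d1\<^sup>2 * P1 + d1 * d2 * (P2 + Q1) + d2\<^sup>2 * Q2 \<le> 0" using * by blast
qed

text \<open>The trace of a nonnegative form against a nonpositive one. Multiplied by
  \<open>A\<close>, it is the nonpositive form at \<open>(A, B)\<close> plus the determinant times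
  that form at \<open>(0, 1)\<close>.\<close>

lemma elliptic_le_0:
  fixes A B C P1 R Q2 :: real
  assumes "\<And>d1 d2. d1\<^sup>2 * P1 + d1 * d2 * R + d2\<^sup>2 * Q2 \<le> 0" "A > 0" "A * C - B\<^sup>2 \<ge> 0"
  shows "A * P1 + B * R + C * Q2 \<le> 0"
proof -
  have "A * (A * P1 + B * R + C * Q2) = (A\<^sup>2 * P1 + A * B * R + B\<^sup>2 * Q2) + (A * C - B\<^sup>2) * Q2"
    by (simp add: algebra_simps power2_eq_square)
  also have "\<dots> \<le> 0"
    using assms(1)[of A B] mult_nonneg_nonpos[OF assms(3), of Q2] assms(1)[of 0 1] by simp
  finally show ?thesis using assms(2) by (simp add: mult_le_0_iff)
qed

lemma second_difference_mean_value:
  fixes u P P2 :: "real \<Rightarrow> real \<Rightarrow> real"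
  assumes h: "h > 0"
    and u: "\<And>x y. x \<in> {a..a+h} \<Longrightarrow> y \<in> {b..b+h} \<Longrightarrow> ((\<lambda>x. u x y) has_real_derivative P x y) (at x)"
    and P: "\<And>x y. x \<in> {a..a+h} \<Longrightarrow> y \<in> {b..b+h} \<Longrightarrow> ((\<lambda>y. P x y) has_real_derivative P2 x y) (at y)"
  shows "\<exists>x\<in>{a..a+h}. \<exists>y\<in>{b..b+h}. u (a+h) (b+h) - u (a+h) b - u a (b+h) + u a b = h\<^sup>2 * P2 x y"
proof -
  have "\<exists>x>a. x < a + h \<and> (u (a+h) (b+h) - u (a+h) b) - (u a (b+h) - u a b)
          = (a + h - a) * (P x (b+h) - P x b)"
    by (rule MVT2[of a "a+h" "\<lambda>x. u x (b+h) - u x b"]) (use h u in \<open>auto intro!: DERIV_diff\<close>)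
  then obtain x where x: "a < x" "x < a + h"
    "(u (a+h) (b+h) - u (a+h) b) - (u a (b+h) - u a b) = h * (P x (b+h) - P x b)" by auto
  have "\<exists>y>b. y < b + h \<and> P x (b+h) - P x b = (b + h - b) * P2 x y"
    by (rule MVT2) (use h P x in auto)
  then obtain y where "b < y" "y < b + h" "P x (b+h) - P x b = h * P2 x y" by auto
  with x show ?thesis
    by (intro bexI[of _ x] bexI[of _ y]) (auto simp: power2_eq_square)
qed

text \<open>Applying the mean value theorem in the two possible orders writes one second difference
  over a small square as \<open>h^2\<close> times \<open>P2\<close> at one point and
  \<open>h^2\<close> times \<open>Q1\<close> at another; continuity at \<open>z\<close> then
  identifies the two.\<close>

lemma mixed_partials_eq:
  fixes u P Q P2 Q1 :: "real \<times> real \<Rightarrow> real"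
  assumes W: "open W" "z \<in> W"
    and u: "\<And>w. w \<in> W \<Longrightarrow> (u has_derivative (\<lambda>h. fst h * P w + snd h * Q w)) (at w)"
    and P: "\<And>w. w \<in> W \<Longrightarrow> (P has_derivative (\<lambda>h. fst h * P1 w + snd h * P2 w)) (at w)"
    and Q: "\<And>w. w \<in> W \<Longrightarrow> (Q has_derivative (\<lambda>h. fst h * Q1 w + snd h * Q2 w)) (at w)"
    and cont: "continuous_on W P2" "continuous_on W Q1"
  shows "P2 z = Q1 z"
proof -
  obtain a b where z: "z = (a, b)" by fastforce
  have d1: "((\<lambda>x. F (x, y)) has_real_derivative A) (at x)"
    if "(F has_derivative (\<lambda>h. fst h * A + snd h * B)) (at (x, y))" for F :: "real \<times> real \<Rightarrow> real" and A B x y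
  proof -
    have "((\<lambda>x. (x, y)) has_derivative (\<lambda>h. (h, 0))) (at x)"
      by (auto intro!: derivative_eq_intros)
    from has_derivative_compose[OF this that] show ?thesis
      by (auto simp: has_field_derivative_def mult.commute elim!: has_derivative_eq_rhs)
  qed
  have d2: "((\<lambda>y. F (x, y)) has_real_derivative B) (at y)"
    if "(F has_derivative (\<lambda>h. fst h * A + snd h * B)) (at (x, y))" for F :: "real \<times> real \<Rightarrow> real" and A B x y
  proof -
    have "((\<lambda>y. (x, y)) has_derivative (\<lambda>h. (0, h))) (at y)"
      by (auto intro!: derivative_eq_intros)
    from has_derivative_compose[OF this that] show ?thesis
      by (auto simp: has_field_derivative_def mult.commute elim!: has_derivative_eq_rhs)
  qed
  have "\<bar>P2 z - Q1 z\<bar> \<le> e" if e: "e > 0" for e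
  proof -
    have "\<forall>\<^sub>F w in nhds z. w \<in> W" using W by (rule eventually_nhds_in_open)
    moreover have "\<forall>\<^sub>F w in nhds z. dist (P2 w) (P2 z) < e / 2"
      using cont(1) W e tendstoD[of P2 "P2 z" "nhds z" "e / 2"]
      by (simp add: continuous_on_eq_continuous_at isCont_def tendsto_at_iff_tendsto_nhds)
    moreover have "\<forall>\<^sub>F w in nhds z. dist (Q1 w) (Q1 z) < e / 2"
      using cont(2) W e tendstoD[of Q1 "Q1 z" "nhds z" "e / 2"]
      by (simp add: continuous_on_eq_continuous_at isCont_def tendsto_at_iff_tendsto_nhds)
    ultimately have "\<forall>\<^sub>F w in nhds z. w \<in> W \<and> dist (P2 w) (P2 z) < e / 2 \<and> dist (Q1 w) (Q1 z) < e / 2"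
      by eventually_elim auto
    then obtain d where d: "d > 0"
      "\<And>w. dist w z < d \<Longrightarrow> w \<in> W \<and> dist (P2 w) (P2 z) < e / 2 \<and> dist (Q1 w) (Q1 z) < e / 2"
      unfolding eventually_nhds_metric by auto
    define h where "h = d / 4"
    have h: "h > 0" using d by (simp add: h_def)
    have near: "dist (x, y) z < d" if "x \<in> {a..a+h}" "y \<in> {b..b+h}" for x y
    proof -
      have "dist (x, y) z \<le> \<bar>x - a\<bar> + \<bar>y - b\<bar>"
        unfolding z dist_Pair_Pair dist_real_def by (rule sqrt_sum_squares_le_sum) auto
      also have "\<dots> \<le> h + h" using that by auto
      also have "\<dots> < d" using d by (simp add: h_def)
      finally show ?thesis .
    qed
    let ?D = "u (a+h, b+h) - u (a+h, b) - u (a, b+h) + u (a, b)"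
    have "\<exists>x\<in>{a..a+h}. \<exists>y\<in>{b..b+h}. ?D = h\<^sup>2 * P2 (x, y)"
      by (rule second_difference_mean_value[where u="\<lambda>x y. u (x, y)" and P="\<lambda>x y. P (x, y)" and ?P2.0="\<lambda>x y. P2 (x, y)", OF h])
        (auto intro: d1[OF u] d2[OF P] simp: d(2)[OF near])
    then obtain x y where xy: "x \<in> {a..a+h}" "y \<in> {b..b+h}" "?D = h\<^sup>2 * P2 (x, y)" by blast
    have "\<exists>y\<in>{b..b+h}. \<exists>x\<in>{a..a+h}. u (a+h, b+h) - u (a, b+h) - u (a+h, b) + u (a, b) = h\<^sup>2 * Q1 (x, y)"
      by (rule second_difference_mean_value[where u="\<lambda>y x. u (x, y)" and P="\<lambda>y x. Q (x, y)" and ?P2.0="\<lambda>y x. Q1 (x, y)", OF h])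
        (auto intro: d2[OF u] d1[OF Q] simp: d(2)[OF near])
    then obtain x' y' where xy': "x' \<in> {a..a+h}" "y' \<in> {b..b+h}"
      "u (a+h, b+h) - u (a, b+h) - u (a+h, b) + u (a, b) = h\<^sup>2 * Q1 (x', y')" by blast
    have "h\<^sup>2 * P2 (x, y) = h\<^sup>2 * Q1 (x', y')" using xy(3) xy'(3) by linarith
    then have "P2 (x, y) = Q1 (x', y')" using h by simp
    with d(2)[OF near[OF xy(1,2)]] d(2)[OF near[OF xy'(1,2)]] show ?thesis
      unfolding dist_real_def by linarith
  qed
  then show ?thesis
    by (metis abs_le_zero_iff dense_ge eq_iff_diff_eq_0)
qed

section \<open>Partial derivatives of charts and their symmetry\<close>

lemma pd_has_derivative:
  assumes "f differentiable (at z)"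
  shows "(f has_derivative (\<lambda>h. fst h *\<^sub>R pd1 f z + snd h *\<^sub>R pd2 f z)) (at z)"
proof -
  have D: "(f has_derivative frechet_derivative f (at z)) (at z)"
    using assms by (simp add: frechet_derivative_works)
  interpret linear "frechet_derivative f (at z)" by (rule has_derivative_linear[OF D])
  have "frechet_derivative f (at z) h = fst h *\<^sub>R pd1 f z + snd h *\<^sub>R pd2 f z" for h
  proof -
    have "h = fst h *\<^sub>R (1, 0) + snd h *\<^sub>R (0, 1)" by (simp add: prod_eq_iff)
    then show ?thesis unfolding pd1_def pd2_def by (metis add scale)
  qed
  with D show ?thesis by (metis (no_types, lifting) has_derivative_eq_rhs ext)
qed

text \<open>Needed because \<open>mean_curv_num\<close> doubles \<open>pd2 (pd1 f)\<close>, whereas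
  differentiating a function along the chart twice produces both mixed derivatives.\<close>

lemma C2_on_pd_symmetric:
  assumes C2: "C2_on W f" and W: "open W" "z \<in> W"
  shows "pd2 (pd1 f) z = pd1 (pd2 f) z"
proof -
  have "pd2 (pd1 f) z \<bullet> e = pd1 (pd2 f) z \<bullet> e" for e
  proof (rule mixed_partials_eq[OF W, where u="\<lambda>w. f w \<bullet> e" and P="\<lambda>w. pd1 f w \<bullet> e" and Q="\<lambda>w. pd2 f w \<bullet> e"
      and ?P1.0="\<lambda>w. pd1 (pd1 f) w \<bullet> e" and ?P2.0="\<lambda>w. pd2 (pd1 f) w \<bullet> e"
      and ?Q1.0="\<lambda>w. pd1 (pd2 f) w \<bullet> e" and ?Q2.0="\<lambda>w. pd2 (pd2 f) w \<bullet> e"])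
    have *: "((\<lambda>w. F w \<bullet> e) has_derivative (\<lambda>h. fst h * (pd1 F w \<bullet> e) + snd h * (pd2 F w \<bullet> e))) (at w)"
      if "F differentiable (at w)" for F :: "real \<times> real \<Rightarrow> R3" and w
      using has_derivative_inner_left[OF pd_has_derivative[OF that], of e]
      by (rule has_derivative_eq_rhs) (simp add: inner_add_left)
    show "((\<lambda>w. f w \<bullet> e) has_derivative (\<lambda>h. fst h * (pd1 f w \<bullet> e) + snd h * (pd2 f w \<bullet> e))) (at w)"
      "((\<lambda>w. pd1 f w \<bullet> e) has_derivative (\<lambda>h. fst h * (pd1 (pd1 f) w \<bullet> e) + snd h * (pd2 (pd1 f) w \<bullet> e))) (at w)"
      "((\<lambda>w. pd2 f w \<bullet> e) has_derivative (\<lambda>h. fst h * (pd1 (pd2 f) w \<bullet> e) + snd h * (pd2 (pd2 f) w \<bullet> e))) (at w)"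
      if "w \<in> W" for w
      using * C2 that unfolding C2_on_def by blast+
    show "continuous_on W (\<lambda>w. pd2 (pd1 f) w \<bullet> e)" "continuous_on W (\<lambda>w. pd1 (pd2 f) w \<bullet> e)"
      using C2 unfolding C2_on_def by (auto intro!: continuous_intros)
  qed
  then show ?thesis by (metis vector_eq_rdot)
qed

section \<open>The maximum principle at interior points\<close>

lemma R3_coords [simp]: "xc (a, b, c) = a" "yc (a, b, c) = b" "zc (a, b, c) = c" "hproj (a, b, c) = (a, b)"
  by (simp_all add: xc_def yc_def zc_def hproj_def)

lemma inner_R3: "a \<bullet> b = xc a * xc b + yc a * yc b + zc a * zc b" for a b :: R3
  by (cases a; cases b) (simp add: inner_prod_def)

lemma lagrange_identity:
  "cross3 a b \<bullet> cross3 a b = (a \<bullet> a) * (b \<bullet> b) - (a \<bullet> b)\<^sup>2"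
  by (cases a; cases b) (simp add: inner_prod_def cross3_def algebra_simps power2_eq_square)

lemma gram_pos:
  assumes "cross3 a b \<noteq> 0"
  shows "a \<bullet> a > 0" "b \<bullet> b > 0" "(a \<bullet> a) * (b \<bullet> b) - (a \<bullet> b)\<^sup>2 > 0"
proof -
  have "a \<noteq> 0" "b \<noteq> 0" using assms by (auto simp: cross3_def xc_def yc_def zc_def zero_prod_def)
  then show "a \<bullet> a > 0" "b \<bullet> b > 0" by auto
  show "(a \<bullet> a) * (b \<bullet> b) - (a \<bullet> b)\<^sup>2 > 0"
    using assms unfolding lagrange_identity[symmetric] by auto
qed

text \<open>Expansion of \<open>q\<close> in the frame \<open>a\<close>, \<open>b\<close>,
  \<open>cross3 a b\<close>, with the Gram determinant multiplied out so that no division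
  occurs.\<close>

lemma cross3_frame_expansion:
  "(cross3 a b \<bullet> cross3 a b) *\<^sub>R q =
     (q \<bullet> cross3 a b) *\<^sub>R cross3 a b
     + ((b \<bullet> b) * (q \<bullet> a) - (a \<bullet> b) * (q \<bullet> b)) *\<^sub>R a
     + ((a \<bullet> a) * (q \<bullet> b) - (a \<bullet> b) * (q \<bullet> a)) *\<^sub>R b"
  by (cases a; cases b; cases q) (simp add: inner_prod_def cross3_def algebra_simps)

text \<open>Defined through charts like \<open>surf_boundary\<close>; that the two sets are disjoint
  is not built in and is shown in \<open>boundary_not_interior\<close>.\<close>

definition surf_interior :: "R3 set \<Rightarrow> R3 set" where
  "surf_interior S = {p. \<exists>f W V z. surface_chart S f W V \<and> z \<in> V \<and> snd z > 0 \<and> p = f z}"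

lemma surface_interior_or_boundary:
  assumes "embedded_surface S" "p \<in> S"
  shows "p \<in> surf_interior S \<or> p \<in> surf_boundary S"
proof -
  obtain f W V z where c: "surface_chart S f W V" "z \<in> V" "p = f z"
    using assms unfolding embedded_surface_def by blast
  have "snd z \<ge> 0"
    using c(1,2) openin_imp_subset unfolding surface_chart_def halfplane_def by blast
  then consider "snd z > 0" | s where "z = (s, 0)" by (cases "snd z = 0") (auto simp: prod_eq_iff)
  then show ?thesis using c unfolding surf_interior_def surf_boundary_def by cases blast+
qed

lemma chart_interior_open:
  assumes "surface_chart S f W V" shows "open (V \<inter> {z. snd z > 0})"
proof -
  obtain U where U: "open U" "V = halfplane \<inter> U"
    using assms unfolding surface_chart_def openin_open by blast
  have "V \<inter> {z. snd z > 0} = U \<inter> {z. snd z > 0}" using U by (auto simp: halfplane_def)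
  moreover have "open {z::real\<times>real. snd z > 0}" by (intro open_Collect_less continuous_intros)
  ultimately show ?thesis using U by auto
qed

lemma chart_differentiable:
  assumes "surface_chart S f W V" "z \<in> W"
  shows "(f has_derivative (\<lambda>h. fst h *\<^sub>R pd1 f z + snd h *\<^sub>R pd2 f z)) (at z)"
    "(pd1 f has_derivative (\<lambda>h. fst h *\<^sub>R pd1 (pd1 f) z + snd h *\<^sub>R pd2 (pd1 f) z)) (at z)"
    "(pd2 f has_derivative (\<lambda>h. fst h *\<^sub>R pd1 (pd2 f) z + snd h *\<^sub>R pd2 (pd2 f) z)) (at z)"
  using assms unfolding surface_chart_def C2_on_def by (auto intro!: pd_has_derivative)

lemma chart_continuous_on:
  assumes "surface_chart S f W V" shows "continuous_on W f"
  using assms chart_differentiable(1)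
  by (meson continuous_at_imp_continuous_on has_derivative_continuous)

text \<open>Up to tangential terms, this is the Laplace--Beltrami operator of the chart applied to the immersion,
  multiplied by \<open>E G - F\<^sup>2\<close>.\<close>
definition tension :: "(real \<times> real \<Rightarrow> R3) \<Rightarrow> real \<times> real \<Rightarrow> R3" where
  "tension f z = (pd2 f z \<bullet> pd2 f z) *\<^sub>R pd1 (pd1 f) z - (2 * (pd1 f z \<bullet> pd2 f z)) *\<^sub>R pd2 (pd1 f) z
     + (pd1 f z \<bullet> pd1 f z) *\<^sub>R pd2 (pd2 f) z"

lemma tension_inner_normal: "tension f z \<bullet> cross3 (pd1 f z) (pd2 f z) = mean_curv_num f z"
  unfolding tension_def mean_curv_num_def Let_def
  by (simp add: inner_add_left inner_diff_left algebra_simps)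

text \<open>Minimality removes the normal component of \<open>tension f z\<close>, so the frame
  expansion leaves only multiples of the two partial derivatives.\<close>

lemma tension_tangential:
  assumes "minimal_surface S" "surface_chart S f W V" "z \<in> V"
    and "v \<bullet> pd1 f z = 0" "v \<bullet> pd2 f z = 0"
  shows "v \<bullet> tension f z = 0"
proof -
  let ?n = "cross3 (pd1 f z) (pd2 f z)"
  have z: "z \<in> W" using assms unfolding surface_chart_def by blast
  have n: "?n \<bullet> ?n \<noteq> 0" using assms(2) z unfolding surface_chart_def by auto
  have "tension f z \<bullet> ?n = 0"
    using assms unfolding tension_inner_normal minimal_surface_def by blast
  then have "(?n \<bullet> ?n) * (v \<bullet> tension f z) = 0"
    using arg_cong[OF cross3_frame_expansion[of "pd1 f z" "pd2 f z" "tension f z"], of "\<lambda>x. v \<bullet> x"] assms(4,5)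
    by (simp add: inner_add_right)
  with n show ?thesis by simp
qed

definition local_max_on :: "('a::topological_space \<Rightarrow> real) \<Rightarrow> 'a set \<Rightarrow> 'a \<Rightarrow> bool" where
  "local_max_on \<phi> S p \<longleftrightarrow> p \<in> S \<and> (\<exists>U. open U \<and> p \<in> U \<and> (\<forall>q\<in>S \<inter> U. \<phi> q \<le> \<phi> p))"

lemma has_derivative_gradient_chart:
  assumes "surface_chart S f W V" "w \<in> W"
    and "(\<phi> has_derivative (\<lambda>v. gr (f w) \<bullet> v)) (at (f w))"
  shows "((\<lambda>w. \<phi> (f w)) has_derivative (\<lambda>h. fst h * (gr (f w) \<bullet> pd1 f w) + snd h * (gr (f w) \<bullet> pd2 f w))) (at w)"
  using has_derivative_compose[OF chart_differentiable(1)[OF assms(1,2)] assms(3)]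
  by (rule has_derivative_eq_rhs) (simp add: inner_add_right)

text \<open>The second derivatives of \<open>\<phi>\<close> along the chart consist of the Hessian
  \<open>H\<close> on the partial derivatives of \<open>f\<close> and of the gradient on the second
  derivatives of \<open>f\<close>. Weighted by the inverse metric times the Gram determinant, the
  latter add up to the gradient against \<open>tension f z\<close>; at a critical point the gradient
  is normal, so this vanishes on a minimal surface.\<close>

lemma interior_max_trace:
  assumes min: "minimal_surface S" and ch: "surface_chart S f W V" and z: "z \<in> V" "snd z > 0"
    and gr: "\<And>x. (\<phi> has_derivative (\<lambda>v. gr x \<bullet> v)) (at x)"
    and H: "(gr has_derivative H) (at (f z))"
    and max: "local_max_on \<phi> S (f z)"
  shows "gr (f z) \<bullet> pd1 f z = 0" and "gr (f z) \<bullet> pd2 f z = 0"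
    and "(pd2 f z \<bullet> pd2 f z) * (H (pd1 f z) \<bullet> pd1 f z)
       - (pd1 f z \<bullet> pd2 f z) * (H (pd1 f z) \<bullet> pd2 f z + H (pd2 f z) \<bullet> pd1 f z)
       + (pd1 f z \<bullet> pd1 f z) * (H (pd2 f z) \<bullet> pd2 f z) \<le> 0"
proof -
  let ?a = "pd1 f z" and ?b = "pd2 f z" and ?g = "gr (f z)"
  have zW: "z \<in> W" and W: "open W" and VW: "V \<subseteq> W" and fVS: "f ` V \<subseteq> S" and C2: "C2_on W f"
    using ch z unfolding surface_chart_def by auto
  obtain O' where O': "open O'" "f z \<in> O'" "\<And>q. q \<in> S \<Longrightarrow> q \<in> O' \<Longrightarrow> \<phi> q \<le> \<phi> (f z)"
    using max unfolding local_max_on_def by blast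
  have "open (W \<inter> f -` O')"
    using chart_continuous_on[OF ch] W O'(1) by (simp add: continuous_on_open_vimage Int_commute)
  then have oU: "open ((V \<inter> {z. snd z > 0}) \<inter> (W \<inter> f -` O'))" (is "open ?U")
    using chart_interior_open[OF ch] by blast
  have zU: "z \<in> ?U" using z zW O' by auto
  have DP: "((\<lambda>w. gr (f w) \<bullet> F w) has_derivative
      (\<lambda>h. fst h * (?g \<bullet> F1 + H ?a \<bullet> F z) + snd h * (?g \<bullet> F2 + H ?b \<bullet> F z))) (at z)"
    if "(F has_derivative (\<lambda>h. fst h *\<^sub>R F1 + snd h *\<^sub>R F2)) (at z)" for F F1 F2
  proof -
    interpret linear H by (rule has_derivative_linear[OF H])
    have "((\<lambda>w. gr (f w)) has_derivative (\<lambda>h. H (fst h *\<^sub>R ?a + snd h *\<^sub>R ?b))) (at z)"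
      by (rule has_derivative_compose[OF chart_differentiable(1)[OF ch zW] H])
    from has_derivative_inner[OF this that] show ?thesis
      by (rule has_derivative_eq_rhs) (auto simp: fun_eq_iff inner_add_right inner_add_left add scale algebra_simps)
  qed
  note test = second_derivative_test_plane[OF oU zU, where \<Phi>="\<lambda>w. \<phi> (f w)"
      and P="\<lambda>w. gr (f w) \<bullet> pd1 f w" and Q="\<lambda>w. gr (f w) \<bullet> pd2 f w",
      OF _ DP[OF chart_differentiable(2)[OF ch zW]] DP[OF chart_differentiable(3)[OF ch zW]]]
  have D: "((\<lambda>w. \<phi> (f w)) has_derivative (\<lambda>h. fst h * (gr (f w) \<bullet> pd1 f w) + snd h * (gr (f w) \<bullet> pd2 f w))) (at w)"
    if "w \<in> ?U" for w
    using that by (intro has_derivative_gradient_chart[OF ch] gr) auto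
  have m: "\<phi> (f w) \<le> \<phi> (f z)" if "w \<in> ?U" for w
    by (rule O'(3)) (use that fVS in auto)
  show a: "?g \<bullet> ?a = 0" and b: "?g \<bullet> ?b = 0" using test(1,2)[OF D m] by auto
  have n0: "cross3 ?a ?b \<noteq> 0" using ch zW unfolding surface_chart_def by blast
  note gp = gram_pos[OF n0]
  have "(?b \<bullet> ?b) * (?g \<bullet> pd1 (pd1 f) z + H ?a \<bullet> ?a)
      + (- (?a \<bullet> ?b)) * ((?g \<bullet> pd2 (pd1 f) z + H ?b \<bullet> ?a) + (?g \<bullet> pd1 (pd2 f) z + H ?a \<bullet> ?b))
      + (?a \<bullet> ?a) * (?g \<bullet> pd2 (pd2 f) z + H ?b \<bullet> ?b) \<le> 0"
    by (rule elliptic_le_0[OF test(3)[OF D m]]) (use gp in \<open>auto simp: mult.commute\<close>)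
  moreover have "?g \<bullet> tension f z = 0"
    by (rule tension_tangential[OF min ch z(1) a b])
  ultimately show "(?b \<bullet> ?b) * (H ?a \<bullet> ?a) - (?a \<bullet> ?b) * (H ?a \<bullet> ?b + H ?b \<bullet> ?a) + (?a \<bullet> ?a) * (H ?b \<bullet> ?b) \<le> 0"
    unfolding tension_def C2_on_pd_symmetric[OF C2 W zW, symmetric]
    by (simp add: inner_add_right inner_diff_right algebra_simps)
qed

abbreviation rad :: "real \<times> real \<Rightarrow> R3 \<Rightarrow> real" where
  "rad q X \<equiv> dist (hproj X) q"

lemma rotational_gradient:
  assumes "(\<Psi> has_real_derivative \<Psi>') (at (zc p))"
  shows "((\<lambda>x. \<sigma> * ((rad q x)\<^sup>2 - \<Psi> (zc x))) has_derivative
    (\<lambda>v. (\<sigma> * (2 * (fst (hproj p) - fst q)), \<sigma> * (2 * (snd (hproj p) - snd q)), \<sigma> * - \<Psi>') \<bullet> v)) (at p)"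
proof -
  obtain qx qy where q: "q = (qx, qy)" by fastforce
  have \<phi>: "\<sigma> * ((rad q x)\<^sup>2 - \<Psi> (zc x)) = \<sigma> * ((fst x - qx)\<^sup>2 + (fst (snd x) - qy)\<^sup>2 - \<Psi> (snd (snd x)))" for x
    by (cases x) (simp add: q dist_Pair_Pair dist_real_def)
  have d\<Psi>: "((\<lambda>x::R3. \<Psi> (snd (snd x))) has_derivative (\<lambda>v. \<Psi>' * snd (snd v))) (at p)"
    by (rule has_derivative_compose[where f="\<lambda>x. snd (snd x)"])
      (use assms in \<open>auto intro!: derivative_eq_intros simp: has_field_derivative_def zc_def\<close>)
  show ?thesis unfolding \<phi>
    by (rule derivative_eq_intros refl d\<Psi>)+
      (auto simp: fun_eq_iff q inner_prod_def hproj_def xc_def yc_def algebra_simps)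
qed

text \<open>In the conclusion, \<^term>\<open>m\<close> is the square of the third component of the unit normal of \<^term>\<open>S\<close>.\<close>
lemma interior_max_rotational:
  fixes \<Psi> \<Psi>' :: "real \<Rightarrow> real"
  assumes min: "minimal_surface S" and p: "p \<in> surf_interior S"
    and \<Psi>: "\<And>t. (\<Psi> has_real_derivative \<Psi>' t) (at t)"
    and \<Psi>': "(\<Psi>' has_real_derivative \<Psi>'') (at (zc p))"
    and max: "local_max_on (\<lambda>x. \<sigma> * ((rad q x)\<^sup>2 - \<Psi> (zc x))) S p" and \<sigma>: "\<sigma> = 1 \<or> \<sigma> = -1"
  shows "\<exists>m. 0 \<le> m \<and> m \<le> 1 \<and> m * (4 * (rad q p)\<^sup>2 + (\<Psi>' (zc p))\<^sup>2) = (\<Psi>' (zc p))\<^sup>2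
     \<and> \<sigma> * (2 * (1 + m) - \<Psi>'' * (1 - m)) \<le> 0"
proof -
  obtain f W V z where ch: "surface_chart S f W V" and z: "z \<in> V" "snd z > 0" and pz: "p = f z"
    using p unfolding surf_interior_def by blast
  obtain qx qy where q: "q = (qx, qy)" by fastforce
  let ?\<phi> = "\<lambda>x::R3. \<sigma> * ((rad q x)\<^sup>2 - \<Psi> (zc x))"
  define gr where "gr x = (\<sigma> * (2 * (fst x - qx)), \<sigma> * (2 * (fst (snd x) - qy)), \<sigma> * - \<Psi>' (snd (snd x)))" for x :: R3
  define H where "H v = (\<sigma> * (2 * fst v), \<sigma> * (2 * fst (snd v)), \<sigma> * - (\<Psi>'' * snd (snd v)))" for v :: R3
  have d\<Psi>': "((\<lambda>x::R3. \<Psi>' (snd (snd x))) has_derivative (\<lambda>v. \<Psi>'' * snd (snd v))) (at (f z))"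
    by (rule has_derivative_compose[where f="\<lambda>x. snd (snd x)"])
      (use \<Psi>' in \<open>auto intro!: derivative_eq_intros simp: has_field_derivative_def pz zc_def\<close>)
  have gr: "(?\<phi> has_derivative (\<lambda>v. gr x \<bullet> v)) (at x)" for x
    using rotational_gradient[OF \<Psi>, of \<sigma> q x] by (simp add: gr_def q hproj_def xc_def yc_def zc_def)
  have H: "(gr has_derivative H) (at (f z))"
    unfolding gr_def H_def
    by (rule derivative_eq_intros refl d\<Psi>')+
      (auto simp: fun_eq_iff algebra_simps)
  note mt = interior_max_trace[OF min ch z gr H max[unfolded pz]]
  obtain a1 a2 a3 where a: "pd1 f z = (a1, a2, a3)" using prod_cases3 by blast
  obtain b1 b2 b3 where b: "pd2 f z = (b1, b2, b3)" using prod_cases3 by blast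
  define n1 n2 n3 where "n1 = a2 * b3 - a3 * b2" and "n2 = a3 * b1 - a1 * b3" and "n3 = a1 * b2 - a2 * b1"
  have "cross3 (pd1 f z) (pd2 f z) \<noteq> 0" using ch z unfolding surface_chart_def by blast
  then have n: "(n1, n2, n3) \<noteq> 0" by (simp add: a b cross3_def n1_def n2_def n3_def)
  define D where "D = n1\<^sup>2 + n2\<^sup>2 + n3\<^sup>2"
  have D: "D > 0" using n unfolding D_def zero_prod_def
    by (metis add_nonneg_eq_0_iff less_eq_real_def prod.inject zero_eq_power2 zero_le_power2 add_nonneg_nonneg)
  have Dl: "D = (a1*a1+a2*a2+a3*a3)*(b1*b1+b2*b2+b3*b3) - (a1*b1+a2*b2+a3*b3)\<^sup>2"
    unfolding D_def n1_def n2_def n3_def by (simp add: algebra_simps power2_eq_square)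
  obtain x1 x2 x3 where x: "f z = (x1, x2, x3)" using prod_cases3 by blast
  define g1 g2 g3 where "g1 = 2 * (x1 - qx)" and "g2 = 2 * (x2 - qy)" and "g3 = - \<Psi>' x3"
  have s0: "\<sigma> \<noteq> 0" using \<sigma> by auto
  have "gr (f z) \<bullet> pd1 f z = \<sigma> * (g1 * a1 + g2 * a2 + g3 * a3)"
    "gr (f z) \<bullet> pd2 f z = \<sigma> * (g1 * b1 + g2 * b2 + g3 * b3)"
    by (simp_all add: gr_def x a b inner_prod_def g1_def g2_def g3_def algebra_simps)
  then have ga: "g1 * a1 + g2 * a2 + g3 * a3 = 0" and gb: "g1 * b1 + g2 * b2 + g3 * b3 = 0"
    using mt(1,2) s0 by simp_all
  \<comment> \<open>The gradient is orthogonal to both partial derivatives, hence parallel to the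
    normal \<open>(n1, n2, n3)\<close>; this lets the tilt of the tangent plane be read off from the
    gradient.\<close>
  have "g1 * n3 - g3 * n1 = b2 * (g1 * a1 + g2 * a2 + g3 * a3) - a2 * (g1 * b1 + g2 * b2 + g3 * b3)"
    "g2 * n3 - g3 * n2 = a1 * (g1 * b1 + g2 * b2 + g3 * b3) - b1 * (g1 * a1 + g2 * a2 + g3 * a3)"
    by (simp_all add: n1_def n2_def n3_def algebra_simps)
  then have c1: "g1 * n3 = g3 * n1" and c2: "g2 * n3 = g3 * n2"
    using ga gb by simp_all
  have "n3\<^sup>2 * (g1\<^sup>2 + g2\<^sup>2 + g3\<^sup>2) = (g1 * n3)\<^sup>2 + (g2 * n3)\<^sup>2 + (g3 * n3)\<^sup>2"
    by (simp add: algebra_simps power_mult_distrib)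
  then have e: "n3\<^sup>2 * (g1\<^sup>2 + g2\<^sup>2 + g3\<^sup>2) = g3\<^sup>2 * D"
    unfolding D_def c1 c2 by (simp add: algebra_simps power_mult_distrib)
  \<comment> \<open>The tangential trace is the full trace of the Hessian
    \<open>diag (2, 2, - \<Psi>'')\<close> minus its value on the unit normal, here multiplied by
    \<open>D\<close>.\<close>
  have tr: "\<sigma> * (4 * D - (2 + \<Psi>'') * (D - n3\<^sup>2)) \<le> 0"
  proof -
    have "\<sigma> * (4 * D - (2 + \<Psi>'') * (D - n3\<^sup>2)) = 
        (b1*b1+b2*b2+b3*b3) * (\<sigma> * (2*a1*a1+2*a2*a2-\<Psi>''*a3*a3))
       - (a1*b1+a2*b2+a3*b3) * (2 * \<sigma> * (2*a1*b1+2*a2*b2-\<Psi>''*a3*b3))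
       + (a1*a1+a2*a2+a3*a3) * (\<sigma> * (2*b1*b1+2*b2*b2-\<Psi>''*b3*b3))"
      unfolding Dl n3_def by (simp add: algebra_simps power2_eq_square)
    also have "\<dots> \<le> 0" using mt(3) by (simp add: H_def a b inner_prod_def algebra_simps)
    finally show ?thesis .
  qed
  have "(rad q p)\<^sup>2 = (x1 - qx)\<^sup>2 + (x2 - qy)\<^sup>2"
    by (simp add: pz x q dist_Pair_Pair dist_real_def)
  then have r: "4 * (rad q p)\<^sup>2 = g1\<^sup>2 + g2\<^sup>2" "\<Psi>' (zc p) = - g3"
    by (simp_all add: pz x g1_def g2_def g3_def power2_eq_square algebra_simps)
  show ?thesis
  proof (intro exI[of _ "n3\<^sup>2 / D"] conjI)
    show "n3\<^sup>2 / D \<le> 1" using D by (simp add: D_def)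
    show "n3\<^sup>2 / D * (4 * (rad q p)\<^sup>2 + (\<Psi>' (zc p))\<^sup>2) = (\<Psi>' (zc p))\<^sup>2"
      using e D unfolding r by (simp add: field_simps)
    have "\<sigma> * (2 * (1 + n3\<^sup>2 / D) - \<Psi>'' * (1 - n3\<^sup>2 / D)) = \<sigma> * (4 * D - (2 + \<Psi>'') * (D - n3\<^sup>2)) / D"
      using D by (simp add: field_simps)
    also have "\<dots> \<le> 0" using tr D by (simp add: divide_le_0_iff)
    finally show "\<sigma> * (2 * (1 + n3\<^sup>2 / D) - \<Psi>'' * (1 - n3\<^sup>2 / D)) \<le> 0" .
  qed (use D in auto)
qed

section \<open>Tangent directions of surfaces with boundary\<close>

text \<open>Gram-Schmidt applied to \<open>pd2 f z\<close> against \<open>pd1 f z\<close>, scaled by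
  a positive factor to avoid division. Since charts use the upper half plane, it points into the
  surface at boundary points.\<close>

definition conormal :: "(real \<times> real \<Rightarrow> R3) \<Rightarrow> real \<times> real \<Rightarrow> R3" where
  "conormal f z = (pd1 f z \<bullet> pd1 f z) *\<^sub>R pd2 f z - (pd1 f z \<bullet> pd2 f z) *\<^sub>R pd1 f z"

lemma conormal_inner:
  "conormal f z \<bullet> pd1 f z = 0"
  "conormal f z \<bullet> pd2 f z = (pd1 f z \<bullet> pd1 f z) * (pd2 f z \<bullet> pd2 f z) - (pd1 f z \<bullet> pd2 f z)\<^sup>2"
  by (simp_all add: conormal_def inner_diff_left inner_diff_right inner_commute power2_eq_square)

text \<open>One-sided velocities of curves in the set. The notion mentions no chart, so statements
  about it transfer between two charts around the same point.\<close>

definition tangent_dir :: "'a::real_normed_vector set \<Rightarrow> 'a \<Rightarrow> 'a \<Rightarrow> bool" where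
  "tangent_dir S p u \<longleftrightarrow>
     (\<exists>X. X 0 = p \<and> (X has_vector_derivative u) (at_right 0) \<and> (\<forall>\<^sub>F t in at_right 0. X t \<in> S))"

lemma at_right_quotient:
  assumes "(X has_vector_derivative u) (at_right (0::real))"
  shows "((\<lambda>t. (X t - X 0) /\<^sub>R t) \<longlongrightarrow> u) (at_right 0)"
proof -
  have "((\<lambda>y. (1 / norm (y - 0)) *\<^sub>R (X y - (X 0 + (y - 0) *\<^sub>R u))) \<longlongrightarrow> 0) (at_right 0)"
    using assms unfolding has_vector_derivative_def has_derivative_within by blast
  then have "((\<lambda>t. (X t - X 0) /\<^sub>R t - u) \<longlongrightarrow> 0) (at_right 0)"
    by (rule Lim_transform_eventually)
      (auto simp: eventually_at_right_field scaleR_diff_right divide_inverse algebra_simps intro!: exI[of _ 1])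
  then show ?thesis by (simp add: LIM_zero_iff)
qed

lemma tangent_dir_local_max:
  assumes "tangent_dir S p u" "local_max_on \<phi> S p" "(\<phi> has_derivative (\<lambda>v. G \<bullet> v)) (at p)"
  shows "G \<bullet> u \<le> 0"
proof (rule ccontr)
  assume pos: "\<not> G \<bullet> u \<le> 0"
  obtain X where X: "X 0 = p" "(X has_vector_derivative u) (at_right 0)" "\<forall>\<^sub>F t in at_right 0. X t \<in> S"
    using assms(1) unfolding tangent_dir_def by blast
  obtain U where U: "open U" "p \<in> U" "\<And>q. q \<in> S \<Longrightarrow> q \<in> U \<Longrightarrow> \<phi> q \<le> \<phi> p"
    using assms(2) unfolding local_max_on_def by blast
  have "(X \<longlongrightarrow> X 0) (at_right 0)"
    using has_vector_derivative_continuous[OF X(2)] by (simp add: continuous_within)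
  then have "\<forall>\<^sub>F t in at_right 0. X t \<in> U" using U X(1) by (metis topological_tendstoD)
  with X(3) have ev: "\<forall>\<^sub>F t in at_right 0. \<phi> (X t) \<le> \<phi> p"
    by eventually_elim (use U in auto)
  have "((\<lambda>t. \<phi> (X t)) has_derivative (\<lambda>t. G \<bullet> (t *\<^sub>R u))) (at_right 0)"
    by (rule has_derivative_compose[OF X(2)[unfolded has_vector_derivative_def]]) (use assms(3) X(1) in simp)
  then have "((\<lambda>t. \<phi> (X t)) has_real_derivative (G \<bullet> u)) (at_right 0)"
    unfolding has_field_derivative_def by (rule has_derivative_eq_rhs) (auto simp: mult.commute)
  then obtain d where d: "d > 0" "\<And>h. h > 0 \<Longrightarrow> h < d \<Longrightarrow> \<phi> (X 0) < \<phi> (X (0 + h))"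
    using has_real_derivative_pos_inc_right[of "\<lambda>t. \<phi> (X t)" "G \<bullet> u" 0 "{0<..}"] pos by auto
  obtain b where "b > 0" "\<And>t. 0 < t \<Longrightarrow> t < b \<Longrightarrow> \<phi> (X t) \<le> \<phi> p"
    using ev unfolding eventually_at_right_field by auto
  with d(1) d(2)[of "min d b / 2"] X(1) show False
    by (smt (verit) field_sum_of_halves min_def)
qed

text \<open>The parameters \<open>z t\<close> are only known to converge to \<open>z0\<close>. A
  left inverse of the injective derivative recovers their difference quotients from those of
  \<open>f\<close>, up to an error that is small relative to the quotients themselves.\<close>

lemma immersion_cone:
  fixes f :: "'a::euclidean_space \<Rightarrow> 'b::euclidean_space" and z :: "real \<Rightarrow> 'a"
  assumes D: "(f has_derivative D) (at z0)" and inj: "inj D"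
    and z: "(z \<longlongrightarrow> z0) (at_right 0)"
    and q: "((\<lambda>t. (f (z t) - f z0) /\<^sub>R t) \<longlongrightarrow> u) (at_right 0)"
  shows "\<exists>h. D h = u \<and> ((\<lambda>t. (z t - z0) /\<^sub>R t) \<longlongrightarrow> h) (at_right 0)"
proof -
  have lin: "linear D" and bl: "bounded_linear D" using D has_derivative_linear has_derivative_bounded_linear by blast+
  obtain B where B: "linear B" "B \<circ> D = id" using linear_injective_left_inverse[OF lin inj] by blast
  have blB: "bounded_linear B" using B(1) linear_conv_bounded_linear by blast
  then obtain K where K: "K > 0" "\<And>x. norm (B x) \<le> norm x * K"
    using bounded_linear.pos_bounded by blast
  define Q where "Q t = (f (z t) - f z0) /\<^sub>R t" for t
  define h where "h t = (z t - z0) /\<^sub>R t" for t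
  define E where "E t = Q t - D (h t)" for t
  have Eb: "\<forall>\<^sub>F t in at_right 0. norm (E t) \<le> e * norm (h t)" if e: "e > 0" for e
  proof -
    obtain d where d: "d > 0" "\<And>y. norm (y - z0) < d \<Longrightarrow> norm (f y - f z0 - D (y - z0)) \<le> e * norm (y - z0)"
      using D e unfolding has_derivative_at_alt by blast
    have "\<forall>\<^sub>F t in at_right 0. dist (z t) z0 < d" using z d(1) by (rule tendstoD)
    moreover have "\<forall>\<^sub>F t in at_right (0::real). t > 0" by (simp add: eventually_at_right_less)
    ultimately show ?thesis
    proof eventually_elim
      case (elim t)
      have "E t = (f (z t) - f z0 - D (z t - z0)) /\<^sub>R t"
        unfolding E_def Q_def h_def linear_cmul[OF lin] by (simp add: scaleR_diff_right)
      then have "norm (E t) = norm (f (z t) - f z0 - D (z t - z0)) / t"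
        using elim by (simp add: divide_inverse mult.commute)
      also have "\<dots> \<le> e * norm (z t - z0) / t"
        using elim d(2)[of "z t"] by (intro divide_right_mono) (auto simp: dist_norm)
      also have "\<dots> = e * norm (h t)"
        using elim by (simp add: h_def divide_inverse mult.commute mult.left_commute)
      finally show ?case .
    qed
  qed
  have hB: "h t = B (Q t) - B (E t)" for t
  proof -
    have "B (D (h t)) = h t" using B(2) by (metis comp_apply id_apply)
    then show ?thesis by (simp add: E_def linear_diff[OF B(1)])
  qed
  have Q: "(Q \<longlongrightarrow> u) (at_right 0)" using q unfolding Q_def .
  have BQ: "((\<lambda>t. B (Q t)) \<longlongrightarrow> B u) (at_right 0)"
    using bounded_linear.tendsto[OF blB Q] .
  have "\<forall>\<^sub>F t in at_right 0. dist (B (Q t)) (B u) < 1" using BQ by (rule tendstoD) simp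
  \<comment> \<open>With this factor, \<open>B (E t)\<close> has at most half the norm of
    \<open>h t\<close> and can be absorbed; boundedness of \<open>h\<close> has to come before its
    convergence.\<close>
  moreover have "\<forall>\<^sub>F t in at_right 0. norm (E t) \<le> 1 / (2 * K) * norm (h t)"
    by (rule Eb) (use K(1) in simp)
  ultimately have hbd: "\<forall>\<^sub>F t in at_right 0. norm (h t) \<le> 2 * (norm (B u) + 1)"
  proof eventually_elim
    case (elim t)
    have "norm (h t) \<le> norm (B (Q t)) + norm (B (E t))" unfolding hB by (rule norm_triangle_ineq4)
    also have "norm (B (E t)) \<le> (1 / (2 * K) * norm (h t)) * K"
      using K(2)[of "E t"] elim(2) K(1) by (meson mult_right_mono order_trans less_imp_le)
    also have "\<dots> = norm (h t) / 2" using K(1) by simp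
    finally have "norm (h t) \<le> 2 * norm (B (Q t))" by simp
    moreover have "norm (B (Q t)) \<le> norm (B u) + 1"
      using elim(1) norm_triangle_ineq2[of "B (Q t)" "B u"] by (simp add: dist_norm)
    ultimately show ?case by simp
  qed
  have E0: "(E \<longlongrightarrow> 0) (at_right 0)"
  proof (rule tendstoI)
    fix e :: real assume e: "e > 0"
    define M where "M = 2 * (norm (B u) + 1)"
    have M: "M > 0" by (simp add: M_def add_nonneg_pos)
    have "\<forall>\<^sub>F t in at_right 0. norm (E t) \<le> e / (2 * M) * norm (h t)"
      by (rule Eb) (use e M in simp)
    with hbd[folded M_def] show "\<forall>\<^sub>F t in at_right 0. dist (E t) 0 < e"
    proof eventually_elim
      case (elim t)
      have "norm (E t) \<le> e / (2 * M) * M"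
        using elim e M by (meson mult_left_mono order_trans divide_nonneg_pos less_imp_le mult_pos_pos zero_less_numeral)
      also have "\<dots> = e / 2" using M by simp
      also have "\<dots> < e" using e by simp
      finally show ?case by simp
    qed
  qed
  have hl: "(h \<longlongrightarrow> B u) (at_right 0)"
  proof -
    have "((\<lambda>t. B (Q t) - B (E t)) \<longlongrightarrow> B u - B 0) (at_right 0)"
      by (intro tendsto_diff BQ bounded_linear.tendsto[OF blB E0])
    then show ?thesis unfolding hB[symmetric] by (simp add: linear_0[OF B(1)])
  qed
  have "((\<lambda>t. D (h t) + E t) \<longlongrightarrow> D (B u) + 0) (at_right 0)"
    by (intro tendsto_add E0 bounded_linear.tendsto[OF bl hl])
  moreover have "D (h t) + E t = Q t" for t by (simp add: E_def)
  ultimately have "D (B u) = u" using tendsto_unique[OF _ Q, of "D (B u)"] by simp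
  with hl show ?thesis unfolding h_def by blast
qed

lemma chart_tangent_dir:
  assumes ch: "surface_chart S f W V" and z: "z \<in> V"
    and d: "\<forall>\<^sub>F t in at_right 0. z + t *\<^sub>R d \<in> V"
  shows "tangent_dir S (f z) (fst d *\<^sub>R pd1 f z + snd d *\<^sub>R pd2 f z)"
  unfolding tangent_dir_def
proof (intro exI[of _ "\<lambda>t. f (z + t *\<^sub>R d)"] conjI)
  have zW: "z \<in> W" using ch z unfolding surface_chart_def by auto
  have l: "((\<lambda>t::real. z + t *\<^sub>R d) has_derivative (\<lambda>t. t *\<^sub>R d)) (at_right 0)"
    by (auto intro!: derivative_eq_intros)
  have "((\<lambda>t. f (z + t *\<^sub>R d)) has_derivative (\<lambda>t. fst (t *\<^sub>R d) *\<^sub>R pd1 f z + snd (t *\<^sub>R d) *\<^sub>R pd2 f z)) (at_right 0)"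
    by (rule has_derivative_compose[OF l]) (use chart_differentiable(1)[OF ch zW] in simp)
  then show "((\<lambda>t. f (z + t *\<^sub>R d)) has_vector_derivative fst d *\<^sub>R pd1 f z + snd d *\<^sub>R pd2 f z) (at_right 0)"
    unfolding has_vector_derivative_def
    by (rule has_derivative_eq_rhs) (auto simp: scaleR_add_right)
  show "\<forall>\<^sub>F t in at_right 0. f (z + t *\<^sub>R d) \<in> S"
    using d by eventually_elim (use ch in \<open>auto simp: surface_chart_def\<close>)
qed simp

lemma chart_direction_eventually:
  assumes ch: "surface_chart S f W V" and z: "z \<in> V" and d: "snd z > 0 \<or> snd d \<ge> 0"
  shows "\<forall>\<^sub>F t in at_right 0. z + t *\<^sub>R d \<in> V"
proof -
  obtain U where U: "open U" "V = halfplane \<inter> U"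
    using ch unfolding surface_chart_def openin_open by blast
  have l: "((\<lambda>t. z + t *\<^sub>R d) \<longlongrightarrow> z + 0 *\<^sub>R d) (at_right 0)" by (intro tendsto_intros)
  then have "\<forall>\<^sub>F t in at_right 0. z + t *\<^sub>R d \<in> U"
    using topological_tendstoD[OF l U(1)] z U by simp
  moreover have "\<forall>\<^sub>F t in at_right 0. snd (z + t *\<^sub>R d) \<ge> 0"
  proof (cases "snd z > 0")
    case True
    have "((\<lambda>t. snd (z + t *\<^sub>R d)) \<longlongrightarrow> snd (z + 0 *\<^sub>R d)) (at_right 0)" by (intro tendsto_intros)
    from order_tendstoD(1)[OF this, of 0] True show ?thesis by (auto elim: eventually_mono)
  next
    case False
    then have "snd d \<ge> 0" "snd z \<ge> 0" using d z U by (auto simp: halfplane_def)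
    then show ?thesis by (auto simp: eventually_at_right_field intro!: exI[of _ 1])
  qed
  ultimately show ?thesis by eventually_elim (auto simp: U halfplane_def)
qed

text \<open>A curve in \<open>S\<close> is lifted through the inverse of the chart, which is merely
  continuous; \<open>immersion_cone\<close> supplies the velocity of the lift. The sign of
  \<open>snd h\<close> holds because the lift starts on the edge of the half plane and stays inside
  it.\<close>

lemma tangent_dir_chart:
  assumes ch: "surface_chart S f W V" and z0: "z0 \<in> V" and u: "tangent_dir S (f z0) u"
  shows "\<exists>h. u = fst h *\<^sub>R pd1 f z0 + snd h *\<^sub>R pd2 f z0 \<and> (snd z0 = 0 \<longrightarrow> snd h \<ge> 0)"
proof -
  have z0W: "z0 \<in> W" using ch z0 unfolding surface_chart_def by auto
  obtain X where X: "X 0 = f z0" "(X has_vector_derivative u) (at_right 0)" "\<forall>\<^sub>F t in at_right 0. X t \<in> S"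
    using u unfolding tangent_dir_def by blast
  obtain k where k: "homeomorphism V (f ` V) f k" using ch unfolding surface_chart_def by blast
  obtain O' where O': "open O'" "f ` V = S \<inter> O'"
    using ch unfolding surface_chart_def openin_open by blast
  have XL: "(X \<longlongrightarrow> f z0) (at_right 0)"
    using has_vector_derivative_continuous[OF X(2)] X(1) by (simp add: continuous_within)
  have "f z0 \<in> O'" using O'(2) z0 by blast
  then have "\<forall>\<^sub>F t in at_right 0. X t \<in> O'" using XL O'(1) by (metis topological_tendstoD)
  with X(3) have XV: "\<forall>\<^sub>F t in at_right 0. X t \<in> f ` V" by eventually_elim (use O' in auto)
  define z where "z t = k (X t)" for t
  have kz0: "k (f z0) = z0" using k z0 by (simp add: homeomorphism_apply1)
  have zl: "(z \<longlongrightarrow> z0) (at_right 0)"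
    unfolding z_def using continuous_on_tendsto_compose[OF homeomorphism_cont2[OF k] XL _ XV] z0 kz0 by auto
  have fz: "\<forall>\<^sub>F t in at_right 0. f (z t) = X t \<and> z t \<in> V"
    using XV by eventually_elim (use k in \<open>auto simp: z_def homeomorphism_def\<close>)
  have "((\<lambda>t. (X t - X 0) /\<^sub>R t) \<longlongrightarrow> u) (at_right 0)" by (rule at_right_quotient[OF X(2)])
  then have q: "((\<lambda>t. (f (z t) - f z0) /\<^sub>R t) \<longlongrightarrow> u) (at_right 0)"
    by (rule Lim_transform_eventually) (use fz X(1) in \<open>auto elim!: eventually_mono\<close>)
  have inj: "inj (\<lambda>h. fst h *\<^sub>R pd1 f z0 + snd h *\<^sub>R pd2 f z0)" (is "inj ?D")
  proof -
    have lin: "linear ?D" using chart_differentiable(1)[OF ch z0W] by (rule has_derivative_linear)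
    have n: "cross3 (pd1 f z0) (pd2 f z0) \<noteq> 0" using ch z0W unfolding surface_chart_def by blast
    have "h = 0" if "?D h = 0" for h
    proof -
      have "conormal f z0 \<bullet> ?D h = snd h * (conormal f z0 \<bullet> pd2 f z0)"
        by (simp add: inner_add_right conormal_inner(1))
      then have "snd h = 0" using that gram_pos(3)[OF n] by (simp add: conormal_inner(2))
      moreover from this have "fst h = 0" using that gram_pos(1)[OF n] by auto
      ultimately show ?thesis by (simp add: prod_eq_iff)
    qed
    then show ?thesis using linear_injective_0[OF lin] by blast
  qed
  obtain h where h: "?D h = u" "((\<lambda>t. (z t - z0) /\<^sub>R t) \<longlongrightarrow> h) (at_right 0)"
    using immersion_cone[OF chart_differentiable(1)[OF ch z0W] inj zl q] by blast
  have "snd h \<ge> 0" if s0: "snd z0 = 0"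
  proof (rule tendsto_lowerbound[OF tendsto_snd[OF h(2)]])
    have V: "V \<subseteq> halfplane" using ch openin_imp_subset unfolding surface_chart_def by blast
    have "\<forall>\<^sub>F t in at_right (0::real). t > 0" by (simp add: eventually_at_right_less)
    then show "\<forall>\<^sub>F t in at_right 0. 0 \<le> snd ((z t - z0) /\<^sub>R t)"
      using fz by eventually_elim (use s0 V in \<open>auto simp: halfplane_def\<close>)
  qed simp
  with h(1) show ?thesis by (metis (no_types))
qed

section \<open>The contact angle condition\<close>

lemma cross3_scaleR: "cross3 (a *\<^sub>R u) (b *\<^sub>R u + c *\<^sub>R v) = (a * c) *\<^sub>R cross3 u v"
  by (cases u; cases v) (simp add: cross3_def algebra_simps)

lemma chart_cross_nonzero:
  assumes "surface_chart S f W V" "z \<in> V" shows "cross3 (pd1 f z) (pd2 f z) \<noteq> 0"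
  using assms unfolding surface_chart_def by blast

lemma boundary_chart_tangent_dirs:
  assumes ch: "surface_chart S f W V" and z: "(s, 0) \<in> V"
  shows "tangent_dir S (f (s, 0)) (pd1 f (s, 0))" "tangent_dir S (f (s, 0)) (- pd1 f (s, 0))"
    "tangent_dir S (f (s, 0)) (pd2 f (s, 0))"
  using chart_tangent_dir[OF ch z chart_direction_eventually[OF ch z, of "(1, 0)"]]
    chart_tangent_dir[OF ch z chart_direction_eventually[OF ch z, of "(-1, 0)"]]
    chart_tangent_dir[OF ch z chart_direction_eventually[OF ch z, of "(0, 1)"]] by simp_all

text \<open>At a boundary point the tangent cone is a half plane, and the only line in it is the
  tangent of the boundary: the conormal components of \<open>u\<close> and \<open>- u\<close> are
  both nonnegative and add up to zero.\<close>

lemma boundary_opposite_dirs: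
  assumes ch: "surface_chart S f W V" and z: "(s, 0) \<in> V"
    and u: "tangent_dir S (f (s, 0)) u" "tangent_dir S (f (s, 0)) (- u)"
  shows "\<exists>c. u = c *\<^sub>R pd1 f (s, 0)"
proof -
  let ?z = "(s, 0::real)"
  obtain h where h: "u = fst h *\<^sub>R pd1 f ?z + snd h *\<^sub>R pd2 f ?z" "snd h \<ge> 0"
    using tangent_dir_chart[OF ch z u(1)] by auto
  obtain k where k: "- u = fst k *\<^sub>R pd1 f ?z + snd k *\<^sub>R pd2 f ?z" "snd k \<ge> 0"
    using tangent_dir_chart[OF ch z u(2)] by auto
  have "conormal f ?z \<bullet> u + conormal f ?z \<bullet> (- u) = 0" by simp
  then have "(snd h + snd k) * (conormal f ?z \<bullet> pd2 f ?z) = 0"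
    unfolding h(1) k(1)[unfolded h(1)] by (simp add: inner_add_right conormal_inner(1) algebra_simps)
  then have "snd h + snd k = 0"
    unfolding conormal_inner using gram_pos(3)[OF chart_cross_nonzero[OF ch z]] by simp
  then have "snd h = 0" using h(2) k(2) by simp
  with h(1) show ?thesis by auto
qed

text \<open>At an interior point all directions occur together with their opposites. If the point
  were also a boundary point, \<open>boundary_opposite_dirs\<close> would make both partial
  derivatives multiples of one vector.\<close>

lemma boundary_not_interior:
  assumes "p \<in> surf_boundary S" shows "p \<notin> surf_interior S"
proof
  assume "p \<in> surf_interior S"
  then obtain f W V z where ch: "surface_chart S f W V" "z \<in> V" "snd z > 0" "p = f z"
    unfolding surf_interior_def by blast
  obtain f' W' V' s where ch': "surface_chart S f' W' V'" "(s, 0) \<in> V'" "p = f' (s, 0)"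
    using assms unfolding surf_boundary_def by blast
  have td: "tangent_dir S (f' (s, 0)) (fst d *\<^sub>R pd1 f z + snd d *\<^sub>R pd2 f z)" for d
    using chart_tangent_dir[OF ch(1,2) chart_direction_eventually[OF ch(1,2)], of d] ch ch' by simp
  obtain a where a: "pd1 f z = a *\<^sub>R pd1 f' (s, 0)"
    using boundary_opposite_dirs[OF ch'(1,2), of "pd1 f z"] td[of "(1,0)"] td[of "(-1,0)"] by auto
  obtain b where b: "pd2 f z = b *\<^sub>R pd1 f' (s, 0)"
    using boundary_opposite_dirs[OF ch'(1,2), of "pd2 f z"] td[of "(0,1)"] td[of "(0,-1)"] by auto
  have "cross3 (pd1 f z) (pd2 f z) = 0"
    unfolding a b using cross3_scaleR[of a _ b 0] by simp
  with chart_cross_nonzero[OF ch(1,2)] show False ..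
qed

text \<open>The tangent cone fixes the boundary line and the inner side of it, hence the ray spanned
  by the conormal.\<close>

lemma conormal_chart_independent:
  assumes ch: "surface_chart S f W V" "(s, 0) \<in> V" and ch': "surface_chart S f' W' V'" "(s', 0) \<in> V'"
    and eq: "f (s, 0) = f' (s', 0)"
  shows "\<exists>c>0. conormal f' (s', 0) = c *\<^sub>R conormal f (s, 0)"
proof -
  let ?z = "(s, 0::real)" and ?z' = "(s', 0::real)"
  note td = boundary_chart_tangent_dirs[OF ch', folded eq]
  obtain a where a: "pd1 f' ?z' = a *\<^sub>R pd1 f ?z"
    using boundary_opposite_dirs[OF ch td(1,2)] by blast
  obtain h where h: "pd2 f' ?z' = fst h *\<^sub>R pd1 f ?z + snd h *\<^sub>R pd2 f ?z" "snd h \<ge> 0"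
    using tangent_dir_chart[OF ch td(3)] by auto
  have "a * snd h \<noteq> 0"
    using chart_cross_nonzero[OF ch'] unfolding a h(1) cross3_scaleR by auto
  then have "a\<^sup>2 * snd h > 0" using h(2) by auto
  moreover have "conormal f' ?z' = (a\<^sup>2 * snd h) *\<^sub>R conormal f ?z"
    unfolding conormal_def a h(1)
    by (simp add: inner_add_right algebra_simps power2_eq_square)
  ultimately show ?thesis by blast
qed

section \<open>Regular Jordan curves and their tangent directions\<close>

lemma regular_jordan_periodic:
  assumes "regular_jordan g" shows "g (t + of_int n) = g t"
proof -
  have per: "g (t + 1) = g t" for t using assms unfolding regular_jordan_def by blast
  have nat: "g (t + of_nat k) = g t" for t k
    by (induction k) (use per in \<open>simp_all add: add.assoc[symmetric] add.commute[of 1]\<close>)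
  show ?thesis
  proof (cases "n \<ge> 0")
    case True then show ?thesis using nat[of t "nat n"] by simp
  next
    case False then show ?thesis using nat[of "t + of_int n" "nat (- n)"] by simp
  qed
qed

lemma regular_jordan_inj:
  assumes "regular_jordan g" "g t = g t'" "\<bar>t - t'\<bar> < 1" shows "t = t'"
proof -
  have "g (frac t) = g t" "g (frac t') = g t'"
    using regular_jordan_periodic[OF assms(1), of t "- \<lfloor>t\<rfloor>"] regular_jordan_periodic[OF assms(1), of t' "- \<lfloor>t'\<rfloor>"]
    by (simp_all add: frac_def)
  then have "frac t = frac t'"
    using assms unfolding regular_jordan_def inj_on_def by (metis atLeastLessThan_iff frac_ge_0 frac_lt_1)
  then have e: "t - t' = of_int (\<lfloor>t\<rfloor> - \<lfloor>t'\<rfloor>)" by (simp add: frac_def)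
  with assms(3) have "\<bar>\<lfloor>t\<rfloor> - \<lfloor>t'\<rfloor>\<bar> < 1" by (metis of_int_abs of_int_less_1_iff)
  with e show ?thesis by simp
qed

lemma regular_jordan_derivative:
  assumes "regular_jordan g"
  shows "(g has_vector_derivative vector_derivative g (at t)) (at t)" "vector_derivative g (at t) \<noteq> 0"
  using assms unfolding regular_jordan_def C1_differentiable_on_def
  by (auto intro!: vector_derivative_works[THEN iffD1] differentiableI_vector)

lemma regular_jordan_continuous:
  assumes "regular_jordan g" shows "continuous_on A g"
  by (meson assms continuous_at_imp_continuous_on has_vector_derivative_continuous regular_jordan_derivative(1))

text \<open>Again \<open>immersion_cone\<close>, now with parameters chosen in a window of length
  one centred at \<open>t0\<close>, so that \<open>g t0\<close> has no second preimage in
  it.\<close>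

lemma curve_tangent_dir:
  assumes g: "regular_jordan g" and u: "tangent_dir (curveC g) (g t0) u"
  shows "\<exists>c. u = c *\<^sub>R vector_derivative g (at t0)"
proof -
  let ?I = "{t0 - 1/2..t0 + 1/2}"
  obtain X where X: "X 0 = g t0" "(X has_vector_derivative u) (at_right 0)" "\<forall>\<^sub>F t in at_right 0. X t \<in> curveC g"
    using u unfolding tangent_dir_def by blast
  have "\<exists>\<tau>\<in>?I. g \<tau> = x" if x: "x \<in> curveC g" for x
  proof -
    obtain s where s: "x = g s" using x unfolding curveC_def by blast
    define n where "n = \<lfloor>s - t0 + 1/2\<rfloor>"
    have "g (s + of_int (- n)) = x" using regular_jordan_periodic[OF g] s by metis
    moreover have "s + of_int (- n) \<in> ?I" unfolding n_def by (simp; linarith)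
    ultimately show ?thesis by blast
  qed
  then obtain k where k: "\<And>x. x \<in> curveC g \<Longrightarrow> k x \<in> ?I \<and> g (k x) = x" by metis
  define z where "z t = k (X t)" for t
  have XL: "(X \<longlongrightarrow> g t0) (at_right 0)"
    using has_vector_derivative_continuous[OF X(2)] X(1) by (simp add: continuous_within)
  have zl: "(z \<longlongrightarrow> t0) (at_right 0)"
  proof (rule tendstoI)
    fix e :: real assume e: "e > 0"
    \<comment> \<open>The part of the curve with parameters in the window but away from
      \<open>t0\<close> is compact and misses \<open>g t0\<close>, so points near
      \<open>g t0\<close> have parameters near \<open>t0\<close>.\<close>
    define A where "A = g ` (?I - ball t0 e)"
    have "compact A" unfolding A_def
      by (intro compact_continuous_image regular_jordan_continuous[OF g] compact_diff) auto
    moreover have "g t0 \<notin> A"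
      unfolding A_def using regular_jordan_inj[OF g, of t0] e by (force simp: dist_real_def)
    ultimately obtain d where d: "d > 0" "\<And>x. x \<in> A \<Longrightarrow> d \<le> dist (g t0) x"
      by (metis separate_point_closed compact_imp_closed)
    have "\<forall>\<^sub>F t in at_right 0. dist (X t) (g t0) < d" using XL d(1) by (rule tendstoD)
    with X(3) show "\<forall>\<^sub>F t in at_right 0. dist (z t) t0 < e"
    proof eventually_elim
      case (elim t)
      have kk: "k (X t) \<in> ?I" "g (k (X t)) = X t" using k elim(1) by auto
      have "X t \<notin> A" using d(2)[of "X t"] elim(2) by (auto simp: dist_commute)
      with kk have "k (X t) \<in> ball t0 e" unfolding A_def by (metis DiffI image_eqI)
      then show ?case by (simp add: z_def dist_commute)
    qed
  qed
  have "((\<lambda>t. (X t - X 0) /\<^sub>R t) \<longlongrightarrow> u) (at_right 0)" by (rule at_right_quotient[OF X(2)])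
  then have q: "((\<lambda>t. (g (z t) - g t0) /\<^sub>R t) \<longlongrightarrow> u) (at_right 0)"
    by (rule Lim_transform_eventually) (rule eventually_mono[OF X(3)], use X(1) k in \<open>simp add: z_def\<close>)
  have D: "(g has_derivative (\<lambda>h. h *\<^sub>R vector_derivative g (at t0))) (at t0)"
    using regular_jordan_derivative(1)[OF g] unfolding has_vector_derivative_def .
  have "inj (\<lambda>h. h *\<^sub>R vector_derivative g (at t0))"
    using regular_jordan_derivative(2)[OF g] by (auto simp: inj_on_def)
  from immersion_cone[OF D this zl q] show ?thesis by blast
qed

text \<open>Three orthonormal vectors form a basis because the third one is plus or minus the cross
  product of the first two.\<close>

lemma orthonormal_frame_inner:
  fixes a b c :: R3
  assumes "norm a = 1" "norm b = 1" "norm c = 1" "a \<bullet> b = 0" "a \<bullet> c = 0" "b \<bullet> c = 0"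
  shows "u \<bullet> v = (u \<bullet> a) * (v \<bullet> a) + (u \<bullet> b) * (v \<bullet> b) + (u \<bullet> c) * (v \<bullet> c)"
proof -
  let ?n = "cross3 a b"
  have 1: "a \<bullet> a = 1" "b \<bullet> b = 1" "c \<bullet> c = 1" using assms by (simp_all add: dot_square_norm)
  have n1: "?n \<bullet> ?n = 1" unfolding lagrange_identity using 1 assms(4) by simp
  have ex: "q = (q \<bullet> ?n) *\<^sub>R ?n + (q \<bullet> a) *\<^sub>R a + (q \<bullet> b) *\<^sub>R b" for q
    using cross3_frame_expansion[of a b q] n1 1 assms(4) by simp
  have c: "c = (c \<bullet> ?n) *\<^sub>R ?n" using ex[of c] assms(5,6) by (simp add: inner_commute)
  have cn: "(c \<bullet> ?n)\<^sup>2 = 1"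
    using 1(3) n1 by (subst (asm) (1 2) c) (simp add: power2_eq_square)
  have "u \<bullet> v = (u \<bullet> ?n) * (v \<bullet> ?n) + (u \<bullet> a) * (v \<bullet> a) + (u \<bullet> b) * (v \<bullet> b)"
    by (subst ex[of v]) (simp add: inner_add_right algebra_simps)
  moreover have "(u \<bullet> c) * (v \<bullet> c) = (c \<bullet> ?n)\<^sup>2 * ((u \<bullet> ?n) * (v \<bullet> ?n))"
    by (subst (1 2) c) (simp add: power2_eq_square)
  ultimately show ?thesis using cn by simp
qed

lemma sigma_normal_properties:
  assumes "regular_jordan g"
  shows "norm (sigma_normal g t) = 1" "zc (sigma_normal g t) = 0"
    "hproj w = c *\<^sub>R vector_derivative g (at t) \<Longrightarrow> sigma_normal g t \<bullet> w = 0"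
proof -
  let ?v = "vector_derivative g (at t)"
  have v: "norm ?v \<noteq> 0" using regular_jordan_derivative(2)[OF assms] by simp
  have nv: "(norm ?v)\<^sup>2 = (fst ?v)\<^sup>2 + (snd ?v)\<^sup>2" by (simp add: norm_prod_def)
  show "zc (sigma_normal g t) = 0" by (simp add: sigma_normal_def Let_def)
  have "sigma_normal g t \<bullet> sigma_normal g t = ((fst ?v)\<^sup>2 + (snd ?v)\<^sup>2) / (norm ?v)\<^sup>2"
    by (simp add: sigma_normal_def Let_def inner_prod_def power2_eq_square add_divide_distrib)
  then show "norm (sigma_normal g t) = 1" using v nv by (simp add: norm_eq_sqrt_inner prod_eq_iff)
  show "sigma_normal g t \<bullet> w = 0" if "hproj w = c *\<^sub>R ?v"
    using that by (cases w; cases ?v) (simp add: sigma_normal_def Let_def inner_prod_def)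
qed

lemma hproj_bounded_linear: "bounded_linear hproj"
proof -
  have "hproj = (\<lambda>p. (fst p, fst (snd p)))" by (auto simp: hproj_def xc_def yc_def)
  then show ?thesis
    using bounded_linear_Pair[OF bounded_linear_fst bounded_linear_compose[OF bounded_linear_fst bounded_linear_snd]] by metis
qed

lemma zc_bounded_linear: "bounded_linear zc"
proof -
  have "zc = (\<lambda>p. snd (snd p))" by (auto simp: zc_def)
  then show ?thesis using bounded_linear_compose[OF bounded_linear_snd bounded_linear_snd] by metis
qed

lemma capillary_surfaceD:
  assumes "capillary_surface S g gam"
  shows "minimal_surface S" "embedded_surface S" "closed S" "connected S" "S \<inter> K_int g = {}"
    "surf_boundary S \<noteq> {}" "compact (surf_boundary S)" "connected (surf_boundary S)"
    "surf_boundary S \<subseteq> Sigma_cyl g" "0 \<le> gam" "gam \<le> pi"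
  using assms unfolding capillary_surface_def minimal_surface_def by blast+

lemma surf_boundary_subset: "surf_boundary S \<subseteq> S"
  unfolding surf_boundary_def surface_chart_def by blast

lemma boundary_chart_sigma_normal:
  assumes g: "regular_jordan g" and cap: "capillary_surface S g gam"
    and ch: "surface_chart S f W V" "(s, 0) \<in> V" and t: "g t = hproj (f (s, 0))"
  shows "sigma_normal g t \<bullet> pd1 f (s, 0) = 0"
proof -
  let ?z = "(s, 0::real)"
  have zW: "?z \<in> W" using ch unfolding surface_chart_def by auto
  have "tangent_dir (curveC g) (g t) (hproj (pd1 f ?z))"
    unfolding tangent_dir_def
  proof (intro exI[of _ "\<lambda>t. hproj (f (s + t, 0))"] conjI)
    have l: "((\<lambda>t::real. (s + t, 0::real)) has_derivative (\<lambda>t. (t, 0))) (at_right 0)"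
      by (auto intro!: derivative_eq_intros)
    have 1: "((\<lambda>t. f (s + t, 0)) has_derivative (\<lambda>t. fst (t, 0::real) *\<^sub>R pd1 f ?z + snd (t, 0) *\<^sub>R pd2 f ?z)) (at_right 0)"
      by (rule has_derivative_compose[OF l]) (use chart_differentiable(1)[OF ch(1) zW] in simp)
    from bounded_linear.has_derivative[OF hproj_bounded_linear 1]
    show "((\<lambda>t. hproj (f (s + t, 0))) has_vector_derivative hproj (pd1 f ?z)) (at_right 0)"
      unfolding has_vector_derivative_def
      by (rule has_derivative_eq_rhs) (simp add: linear_cmul[OF bounded_linear.linear[OF hproj_bounded_linear]])
    show "\<forall>\<^sub>F t in at_right 0. hproj (f (s + t, 0)) \<in> curveC g"
      using chart_direction_eventually[OF ch, of "(1, 0)", simplified]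
    proof eventually_elim
      case (elim t)
      then have "f (s + t, 0) \<in> surf_boundary S" using ch unfolding surf_boundary_def by blast
      then show ?case using capillary_surfaceD(9)[OF cap] unfolding Sigma_cyl_def by blast
    qed
  qed (use t in simp)
  from curve_tangent_dir[OF g this] show ?thesis
    using sigma_normal_properties(3)[OF g] by blast
qed

text \<open>\<open>T\<close>, \<open>\<eta>\<close> and the unit normal \<open>n\<close> of
  \<open>S\<close> are orthonormal. The normal of the cylinder is orthogonal to \<open>T\<close> and
  has component \<open>cos gam\<close> on \<open>n\<close>, which leaves plus or minus
  \<open>sin gam\<close> on \<open>\<eta>\<close>; it is also horizontal, which links the vertical
  components of \<open>\<eta>\<close> and \<open>n\<close>. Squares are used because the signs
  depend on the orientations of \<open>g\<close> and of the chosen normal field.\<close>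

lemma boundary_frame:
  assumes g: "regular_jordan g" and cap: "capillary_surface S g gam" and gr: "boundary_graph_over S g"
    and ch: "surface_chart S f W V" "(s, 0) \<in> V"
  defines "T \<equiv> pd1 f (s, 0) /\<^sub>R norm (pd1 f (s, 0))" and "\<eta> \<equiv> conormal f (s, 0) /\<^sub>R norm (conormal f (s, 0))"
  shows "norm T = 1" "norm \<eta> = 1" "T \<bullet> \<eta> = 0"
    "(zc \<eta>)\<^sup>2 = (cos gam)\<^sup>2 * (norm (hproj T))\<^sup>2" "hproj T \<noteq> 0"
    "\<And>t. g t = hproj (f (s, 0)) \<Longrightarrow> sigma_normal g t \<bullet> T = 0 \<and> (sigma_normal g t \<bullet> \<eta>)\<^sup>2 = (sin gam)\<^sup>2"
    "\<And>\<phi> G. local_max_on \<phi> S (f (s, 0)) \<Longrightarrow> (\<phi> has_derivative (\<lambda>v. G \<bullet> v)) (at (f (s, 0))) \<Longrightarrow> G \<bullet> T = 0 \<and> G \<bullet> \<eta> \<le> 0"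
proof -
  let ?z = "(s, 0::real)" and ?a = "pd1 f (s, 0)" and ?b = "pd2 f (s, 0)" and ?k = "conormal f (s, 0)"
  note gp = gram_pos[OF chart_cross_nonzero[OF ch]]
  have a0: "?a \<noteq> 0" and k0: "?k \<noteq> 0" using gp conormal_inner(2)[of f ?z] by auto
  show T1: "norm T = 1" and e1: "norm \<eta> = 1" unfolding T_def \<eta>_def using a0 k0 by simp_all
  show Te: "T \<bullet> \<eta> = 0" unfolding T_def \<eta>_def using conormal_inner(1)[of f ?z] by (simp add: inner_commute)
  have hl: "hproj (c *\<^sub>R v) = c *\<^sub>R hproj v" for c v
    by (rule linear_cmul[OF bounded_linear.linear[OF hproj_bounded_linear]])
  show "hproj T \<noteq> 0" unfolding T_def hl using gr ch a0 unfolding boundary_graph_over_def by auto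
  have pb: "f ?z \<in> surf_boundary S" using ch unfolding surf_boundary_def by blast
  obtain \<nu> where \<nu>: "norm (\<nu> (f ?z)) = 1" "\<nu> (f ?z) \<bullet> ?a = 0" "\<nu> (f ?z) \<bullet> ?b = 0"
    "\<And>t. g t = hproj (f ?z) \<Longrightarrow> \<nu> (f ?z) \<bullet> sigma_normal g t = cos gam"
    using cap pb ch unfolding capillary_surface_def by blast
  define n where "n = \<nu> (f ?z)"
  have n1: "norm n = 1" using \<nu> n_def by simp
  have Tn: "T \<bullet> n = 0" and en: "\<eta> \<bullet> n = 0"
    using \<nu>(2,3) by (simp_all add: T_def \<eta>_def n_def conormal_def inner_diff_left inner_commute[of _ "\<nu> _"] inner_diff_right)
  note fr = orthonormal_frame_inner[OF T1 e1 n1 Te Tn en]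
  have N: "sigma_normal g t \<bullet> T = 0 \<and> (sigma_normal g t \<bullet> \<eta>)\<^sup>2 = (sin gam)\<^sup>2
     \<and> (zc \<eta>)\<^sup>2 = (cos gam)\<^sup>2 * (norm (hproj T))\<^sup>2" if t: "g t = hproj (f ?z)" for t
  proof -
    let ?N = "sigma_normal g t"
    have NT: "?N \<bullet> T = 0"
      unfolding T_def using boundary_chart_sigma_normal[OF g cap ch t] by simp
    have Nn: "?N \<bullet> n = cos gam" using \<nu>(4)[OF t] by (simp add: n_def inner_commute)
    have "?N \<bullet> ?N = 1" using sigma_normal_properties(1)[OF g] by (simp add: dot_square_norm)
    then have NN: "(?N \<bullet> \<eta>)\<^sup>2 + (cos gam)\<^sup>2 = 1" using fr[of ?N ?N] NT Nn by (simp add: power2_eq_square)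
    then have s2: "(?N \<bullet> \<eta>)\<^sup>2 = (sin gam)\<^sup>2" using sin_cos_squared_add[of gam] by linarith
    let ?e = "(0, 0, 1) :: R3"
    have ze: "?e \<bullet> v = zc v" for v by (simp add: inner_R3)
    have "?N \<bullet> ?e = 0" using sigma_normal_properties(2)[OF g] ze by (metis inner_commute)
    then have "(?N \<bullet> \<eta>) * zc \<eta> + cos gam * zc n = 0" using fr[of ?N ?e] NT Nn unfolding ze by simp
    then have "(?N \<bullet> \<eta>)\<^sup>2 * (zc \<eta>)\<^sup>2 = (cos gam)\<^sup>2 * (zc n)\<^sup>2"
      by (metis add_eq_0_iff power2_minus power_mult_distrib)
    moreover have "(zc T)\<^sup>2 + (zc \<eta>)\<^sup>2 + (zc n)\<^sup>2 = 1"
      using fr[of ?e ?e] unfolding ze by (simp add: power2_eq_square)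
    moreover have "(norm (hproj T))\<^sup>2 + (zc T)\<^sup>2 = 1"
    proof -
      have "T \<bullet> T = 1" using T1 by (simp add: dot_square_norm)
      then show ?thesis
        by (simp add: hproj_def norm_prod_def inner_R3 power2_eq_square)
    qed
    ultimately have "(zc \<eta>)\<^sup>2 = (cos gam)\<^sup>2 * (norm (hproj T))\<^sup>2" using NN by algebra
    with NT s2 show ?thesis by blast
  qed
  then show "sigma_normal g t \<bullet> T = 0 \<and> (sigma_normal g t \<bullet> \<eta>)\<^sup>2 = (sin gam)\<^sup>2" if "g t = hproj (f ?z)" for t
    using that by blast
  obtain t where "g t = hproj (f ?z)"
    using pb capillary_surfaceD(9)[OF cap] unfolding Sigma_cyl_def curveC_def by force
  with N show "(zc \<eta>)\<^sup>2 = (cos gam)\<^sup>2 * (norm (hproj T))\<^sup>2" by blast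
  show "G \<bullet> T = 0 \<and> G \<bullet> \<eta> \<le> 0"
    if "local_max_on \<phi> S (f ?z)" "(\<phi> has_derivative (\<lambda>v. G \<bullet> v)) (at (f ?z))" for \<phi> G
  proof -
    note td = boundary_chart_tangent_dirs[OF ch]
    have a: "G \<bullet> ?a = 0" using tangent_dir_local_max[OF td(1) that] tangent_dir_local_max[OF td(2) that] by simp
    have b: "G \<bullet> ?b \<le> 0" using tangent_dir_local_max[OF td(3) that] .
    have "G \<bullet> ?k \<le> 0" unfolding conormal_def using a b gp(1) by (simp add: inner_diff_right mult_le_0_iff)
    then show ?thesis unfolding T_def \<eta>_def using a by (simp add: mult_le_0_iff)
  qed
qed

text \<open>If the contact angle is not right, the inward conormal is nowhere horizontal along the
  connected boundary, so its vertical component has a constant sign.\<close>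
lemma boundary_conormal_sign:
  assumes g: "regular_jordan g" and cap: "capillary_surface S g gam" and gr: "boundary_graph_over S g"
  obtains \<delta> where "\<delta> = 1 \<or> \<delta> = -1"
    "\<And>f W V s. surface_chart S f W V \<Longrightarrow> (s, 0) \<in> V \<Longrightarrow> \<delta> * zc (conormal f (s, 0)) \<ge> 0"
proof (cases "cos gam = 0")
  case True
  have "zc (conormal f (s, 0)) = 0" if ch: "surface_chart S f W V" "(s, 0) \<in> V" for f W V s
  proof -
    have "zc (conormal f (s, 0) /\<^sub>R norm (conormal f (s, 0))) = 0"
      using boundary_frame(4)[OF g cap gr ch] True by simp
    then show ?thesis using boundary_frame(2)[OF g cap gr ch]
      by (auto simp: linear_cmul[OF bounded_linear.linear[OF zc_bounded_linear]])
  qed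
  then show thesis using that[of 1] by simp
next
  case False
  define P where "P \<delta> = {p. \<exists>f W V s. surface_chart S f W V \<and> (s, 0) \<in> V \<and> p = f (s, 0) \<and> \<delta> * zc (conormal f (s, 0)) > 0}" for \<delta> :: real
  have zl: "zc (c *\<^sub>R v) = c * zc v" for c v
    using linear_cmul[OF bounded_linear.linear[OF zc_bounded_linear]] by simp
  have nz: "zc (conormal f (s, 0)) \<noteq> 0" if ch: "surface_chart S f W V" "(s, 0) \<in> V" for f W V s
  proof
    assume "zc (conormal f (s, 0)) = 0"
    then have "zc (conormal f (s, 0) /\<^sub>R norm (conormal f (s, 0))) = 0" by (simp add: zl)
    then show False using boundary_frame(4,5)[OF g cap gr ch] False by simp
  qed
  have cover: "surf_boundary S = P 1 \<union> P (-1)"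
  proof
    show "surf_boundary S \<subseteq> P 1 \<union> P (-1)"
    proof
      fix p assume "p \<in> surf_boundary S"
      then obtain f W V s where c: "surface_chart S f W V" "(s, 0) \<in> V" "p = f (s, 0)"
        unfolding surf_boundary_def by blast
      with nz[OF c(1,2)] have "1 * zc (conormal f (s, 0)) > 0 \<or> -1 * zc (conormal f (s, 0)) > 0" by auto
      with c show "p \<in> P 1 \<union> P (-1)" unfolding P_def by blast
    qed
  qed (auto simp: P_def surf_boundary_def)
  have op: "openin (top_of_set (surf_boundary S)) (P \<delta>)" if d: "\<delta> = 1 \<or> \<delta> = -1" for \<delta>
  proof (subst openin_subopen, intro ballI)
    fix p assume "p \<in> P \<delta>"
    then obtain f W V s where c: "surface_chart S f W V" "(s, 0) \<in> V" "p = f (s, 0)" "\<delta> * zc (conormal f (s, 0)) > 0"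
      unfolding P_def by blast
    define V' where "V' = {z \<in> V. \<delta> * zc (conormal f z) > 0}"
    have VW: "V \<subseteq> W" and C2: "C2_on W f" and oV: "openin (top_of_set S) (f ` V)"
      using c(1) unfolding surface_chart_def by auto
    obtain k where k: "homeomorphism V (f ` V) f k" using c(1) unfolding surface_chart_def by blast
    have "continuous_on V (\<lambda>z. \<delta> * zc (conormal f z))"
      unfolding conormal_def using C2 VW unfolding C2_on_def
      by (intro continuous_intros bounded_linear.continuous_on[OF zc_bounded_linear])
        (auto intro: continuous_on_subset)
    then have "openin (top_of_set V) (V \<inter> (\<lambda>z. \<delta> * zc (conormal f z)) -` {0<..})"
      by (rule continuous_openin_preimage_gen) simp
    moreover have "V \<inter> (\<lambda>z. \<delta> * zc (conormal f z)) -` {0<..} = V'" by (auto simp: V'_def)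
    ultimately have "openin (top_of_set (f ` V)) (f ` V')"
      using homeomorphism_imp_open_map[OF k] by simp
    then have "openin (top_of_set S) (f ` V')" using oV openin_trans by blast
    then obtain O' where O': "open O'" "f ` V' = S \<inter> O'" unfolding openin_open by blast
    have sub: "surf_boundary S \<inter> O' \<subseteq> P \<delta>"
    proof
      fix q assume q: "q \<in> surf_boundary S \<inter> O'"
      then have "q \<in> f ` V'" using O' surf_boundary_subset by blast
      then obtain z where z: "z \<in> V" "q = f z" "\<delta> * zc (conormal f z) > 0" unfolding V'_def by blast
      \<comment> \<open>A chart point with positive second coordinate would be an interior point as
        well, so boundary points near \<open>p\<close> lie on the edge of this same chart.\<close>
      have "\<not> snd z > 0" using boundary_not_interior[of q S] q z c(1) unfolding surf_interior_def by blast
      moreover have "snd z \<ge> 0" using z c(1) openin_imp_subset unfolding surface_chart_def halfplane_def by blast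
      ultimately have "z = (fst z, 0)" by (simp add: prod_eq_iff)
      with z c(1) show "q \<in> P \<delta>" unfolding P_def by (metis (mono_tags, lifting) mem_Collect_eq)
    qed
    have "p \<in> f ` V'" using c unfolding V'_def by blast
    moreover have "p \<in> surf_boundary S" using c unfolding surf_boundary_def by blast
    ultimately show "\<exists>T. openin (top_of_set (surf_boundary S)) T \<and> p \<in> T \<and> T \<subseteq> P \<delta>"
      using O' sub by (intro exI[of _ "surf_boundary S \<inter> O'"]) (auto simp: openin_open)
  qed
  have disj: "P 1 \<inter> P (-1) = {}"
  proof (rule ccontr)
    assume "P 1 \<inter> P (-1) \<noteq> {}"
    then obtain f W V s f' W' V' s' where c: "surface_chart S f W V" "(s, 0) \<in> V" "surface_chart S f' W' V'" "(s', 0) \<in> V'"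
      "f (s, 0) = f' (s', 0)" "zc (conormal f (s, 0)) > 0" "zc (conormal f' (s', 0)) < 0"
      unfolding P_def by force
    obtain k where "k > 0" "conormal f' (s', 0) = k *\<^sub>R conormal f (s, 0)"
      using conormal_chart_independent[OF c(1-5)] by blast
    with c(6,7) show False by (simp add: zl mult_less_0_iff)
  qed
  have "P 1 = {} \<or> P (-1) = {}"
    using capillary_surfaceD(8)[OF cap] op[of 1] op[of "-1"] disj cover
    unfolding connected_openin by blast
  then obtain \<delta> where d: "\<delta> = 1 \<or> \<delta> = -1" "P (- \<delta>) = {}" by force
  have "\<delta> * zc (conormal f (s, 0)) \<ge> 0" if ch: "surface_chart S f W V" "(s, 0) \<in> V" for f W V s
  proof (rule ccontr)
    assume "\<not> \<delta> * zc (conormal f (s, 0)) \<ge> 0"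
    then have "- \<delta> * zc (conormal f (s, 0)) > 0" by simp
    then have "f (s, 0) \<in> P (- \<delta>)" unfolding P_def using ch by blast
    with d(2) show False by simp
  qed
  with d(1) show thesis using that by blast
qed

text \<open>All first-order information used at a boundary point, freed from charts. The sign
  \<open>\<delta>\<close> is a parameter because \<open>boundary_contact_exists\<close> provides a
  single one for the whole boundary.\<close>

definition boundary_contact :: "R3 set \<Rightarrow> (real \<Rightarrow> real \<times> real) \<Rightarrow> real \<Rightarrow> real \<Rightarrow> R3 \<Rightarrow> R3 \<Rightarrow> R3 \<Rightarrow> bool" where
  "boundary_contact S g gam \<delta> p T \<eta> \<longleftrightarrow> norm T = 1 \<and> norm \<eta> = 1 \<and> T \<bullet> \<eta> = 0
     \<and> zc \<eta> = \<delta> * \<bar>cos gam\<bar> * norm (hproj T)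
     \<and> (\<forall>t. g t = hproj p \<longrightarrow> sigma_normal g t \<bullet> T = 0 \<and> (sigma_normal g t \<bullet> \<eta>)\<^sup>2 = (sin gam)\<^sup>2)
     \<and> (\<forall>\<phi> G. local_max_on \<phi> S p \<and> (\<phi> has_derivative (\<lambda>v. G \<bullet> v)) (at p) \<longrightarrow> G \<bullet> T = 0 \<and> G \<bullet> \<eta> \<le> 0)"

lemma boundary_contact_exists:
  assumes g: "regular_jordan g" and cap: "capillary_surface S g gam" and gr: "boundary_graph_over S g"
  obtains \<delta> where "\<delta> = 1 \<or> \<delta> = -1" "\<And>p. p \<in> surf_boundary S \<Longrightarrow> \<exists>T \<eta>. boundary_contact S g gam \<delta> p T \<eta>"
proof -
  obtain \<delta> where d: "\<delta> = 1 \<or> \<delta> = -1"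
    "\<And>f W V s. surface_chart S f W V \<Longrightarrow> (s, 0) \<in> V \<Longrightarrow> \<delta> * zc (conormal f (s, 0)) \<ge> 0"
    using boundary_conormal_sign[OF assms] by blast
  have "\<exists>T \<eta>. boundary_contact S g gam \<delta> p T \<eta>" if p: "p \<in> surf_boundary S" for p
  proof -
    obtain f W V s where ch: "surface_chart S f W V" "(s, 0) \<in> V" and pf: "p = f (s, 0)"
      using p unfolding surf_boundary_def by blast
    define T where "T = pd1 f (s, 0) /\<^sub>R norm (pd1 f (s, 0))"
    define \<eta> where "\<eta> = conormal f (s, 0) /\<^sub>R norm (conormal f (s, 0))"
    note fr = boundary_frame[OF g cap gr ch, folded T_def \<eta>_def pf]
    have "zc \<eta> = inverse (norm (conormal f (s, 0))) * zc (conormal f (s, 0))"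
      unfolding \<eta>_def using linear_cmul[OF bounded_linear.linear[OF zc_bounded_linear]] by simp
    then have "\<delta> * zc \<eta> = inverse (norm (conormal f (s, 0))) * (\<delta> * zc (conormal f (s, 0)))"
      by simp
    then have "\<delta> * zc \<eta> \<ge> 0" using d(2)[OF ch] by (metis mult_nonneg_nonneg inverse_nonnegative_iff_nonnegative norm_ge_zero)
    moreover have "(\<delta> * zc \<eta>)\<^sup>2 = (\<bar>cos gam\<bar> * norm (hproj T))\<^sup>2"
      using fr(4) d(1) by (auto simp: power_mult_distrib)
    ultimately have "\<delta> * zc \<eta> = \<bar>cos gam\<bar> * norm (hproj T)"
      by (simp add: power2_eq_iff_nonneg)
    then have "zc \<eta> = \<delta> * \<bar>cos gam\<bar> * norm (hproj T)" using d(1) by auto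
    with fr show ?thesis unfolding boundary_contact_def by blast
  qed
  with d(1) show thesis using that by blast
qed

section \<open>The strong maximum principle\<close>

text \<open>A small multiple of \<open>w\<close>, a Gaussian centred at \<open>q\<close>, is added
  to \<open>F\<close>. On the part \<open>K\<close> of the ball near \<open>x1\<close>,
  \<open>w\<close> is a strict subsolution, so the sum has its maximum over \<open>K\<close> at
  \<open>x1\<close>; as \<open>w\<close> strictly increases from \<open>x1\<close> towards
  \<open>q\<close>, \<open>F\<close> must strictly decrease. On the outer sphere \<open>w\<close> is
  constant, so no normalisation is required.\<close>

lemma hopf_boundary_point:
  fixes F F1 F2 F11 F12 F21 F22 A B C c1 c2 :: "real \<times> real \<Rightarrow> real"
  assumes r: "r > 0" "dist x1 q = r"
    and D: "\<And>z. z \<in> cball q r \<Longrightarrow> (F has_derivative (\<lambda>h. fst h * F1 z + snd h * F2 z)) (at z)"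
    and D1: "\<And>z. z \<in> cball q r \<Longrightarrow> (F1 has_derivative (\<lambda>h. fst h * F11 z + snd h * F12 z)) (at z)"
    and D2: "\<And>z. z \<in> cball q r \<Longrightarrow> (F2 has_derivative (\<lambda>h. fst h * F21 z + snd h * F22 z)) (at z)"
    and pde: "\<And>z. z \<in> cball q r \<Longrightarrow> A z * F11 z + B z * (F12 z + F21 z) + C z * F22 z = c1 z * F1 z + c2 z * F2 z"
    and ell: "\<And>z. z \<in> cball q r \<Longrightarrow> A z > 0 \<and> A z * C z - (B z)\<^sup>2 > 0"
    and cont: "continuous_on (cball q r) A" "continuous_on (cball q r) B" "continuous_on (cball q r) C"
      "continuous_on (cball q r) c1" "continuous_on (cball q r) c2"
    and less: "\<And>z. z \<in> cball q r \<Longrightarrow> z \<noteq> x1 \<Longrightarrow> F z < F x1"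
  shows "F1 x1 * (fst q - fst x1) + F2 x1 * (snd q - snd x1) < 0"
proof -
  obtain q1 q2 where q: "q = (q1, q2)" by fastforce
  define v1 where "v1 z = fst z - q1" for z :: "real \<times> real"
  define v2 where "v2 z = snd z - q2" for z :: "real \<times> real"
  have dq: "(dist z q)\<^sup>2 = (v1 z)\<^sup>2 + (v2 z)\<^sup>2" for z
    by (cases z) (simp add: q v1_def v2_def dist_Pair_Pair dist_real_def)
  \<comment> \<open>Points of \<open>K\<close> have distance at least \<open>r / 2\<close> from
    \<open>q\<close>, which keeps \<open>form\<close> positive there.\<close>
  define K where "K = cball q r \<inter> cball x1 (r/2)"
  have K: "compact K" "K \<subseteq> cball q r" unfolding K_def by auto
  have x1K: "x1 \<in> K" using r by (auto simp: K_def dist_commute)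
  have cK: "continuous_on K A" "continuous_on K B" "continuous_on K C" "continuous_on K c1" "continuous_on K c2"
    using cont K(2) continuous_on_subset by blast+
  define form where "form z = A z * (v1 z)\<^sup>2 + 2 * B z * v1 z * v2 z + C z * (v2 z)\<^sup>2" for z
  have form_pos: "form z > 0" if z: "z \<in> K" for z
  proof -
    have e: "A z > 0" "A z * C z - (B z)\<^sup>2 > 0" using ell z K(2) by blast+
    have "dist x1 q \<le> dist x1 z + dist z q" by (rule dist_triangle)
    then have "dist z q \<ge> r / 2" using z r by (auto simp: K_def dist_commute)
    then have "(dist z q)\<^sup>2 > 0" using r by (intro zero_less_power) linarith
    then have nz: "v1 z \<noteq> 0 \<or> v2 z \<noteq> 0" unfolding dq by auto
    have "A z * form z = (A z * v1 z + B z * v2 z)\<^sup>2 + (A z * C z - (B z)\<^sup>2) * (v2 z)\<^sup>2"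
      by (simp add: form_def algebra_simps power2_eq_square)
    also have "\<dots> > 0"
    proof (cases "v2 z = 0")
      case True then show ?thesis using nz e by simp
    next
      case False then show ?thesis using e by (intro add_nonneg_pos) auto
    qed
    finally show ?thesis using e by (simp add: zero_less_mult_iff)
  qed
  have "continuous_on K form" unfolding form_def v1_def v2_def by (intro continuous_intros cK)
  then obtain zt where zt: "zt \<in> K" "\<And>z. z \<in> K \<Longrightarrow> form zt \<le> form z"
    using continuous_attains_inf[OF K(1)] x1K by blast
  define \<theta> where "\<theta> = form zt"
  have \<theta>: "\<theta> > 0" using form_pos zt \<theta>_def by blast
  define rhs where "rhs z = A z + C z - (c1 z * v1 z + c2 z * v2 z)" for z
  have "continuous_on K rhs" unfolding rhs_def v1_def v2_def by (intro continuous_intros cK)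
  then obtain zb where zb: "zb \<in> K" "\<And>z. z \<in> K \<Longrightarrow> rhs z \<le> rhs zb"
    using continuous_attains_sup[OF K(1)] x1K by blast
  \<comment> \<open>Large enough for \<open>key\<close>: the operator applied to \<open>w\<close> is
    \<open>2 * lam * w z * (2 * lam * form z - rhs z)\<close>, hence positive on
    \<open>K\<close>.\<close>
  define lam where "lam = (\<bar>rhs zb\<bar> + 1) / (2 * \<theta>)"
  have lam: "lam > 0" using \<theta> by (simp add: lam_def)
  have key: "2 * lam * form z > rhs z" if "z \<in> K" for z
  proof -
    have "rhs z < 2 * lam * \<theta>" using zb(2)[OF that] \<theta> by (simp add: lam_def)
    also have "\<dots> \<le> 2 * lam * form z" using zt(2)[OF that] lam by (simp add: \<theta>_def)
    finally show ?thesis .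
  qed
  define w where "w z = exp (- lam * ((v1 z)\<^sup>2 + (v2 z)\<^sup>2))" for z
  have w: "0 < w z" "w z \<le> 1" for z using lam by (auto simp: w_def)
  have wD: "(w has_derivative (\<lambda>h. fst h * (- 2 * lam * v1 z * w z) + snd h * (- 2 * lam * v2 z * w z))) (at z)" for z
    unfolding w_def v1_def v2_def
    by (auto intro!: derivative_eq_intros simp: fun_eq_iff algebra_simps)
  have vD: "(v1 has_derivative fst) (at z)" "(v2 has_derivative snd) (at z)" for z
    unfolding v1_def v2_def by (auto intro!: derivative_eq_intros)
  define S' where "S' = cball q r \<inter> sphere x1 (r/2)"
  have "\<exists>\<epsilon>>0. \<forall>z\<in>S'. F z + \<epsilon> < F x1"
  proof (cases "S' = {}")
    case False
    have "compact S'" "S' \<subseteq> cball q r" unfolding S'_def by auto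
    moreover have "continuous_on S' F"
      using \<open>S' \<subseteq> cball q r\<close>
      by (intro continuous_at_imp_continuous_on ballI has_derivative_continuous[OF D]) auto
    ultimately obtain y where y: "y \<in> S'" "\<And>z. z \<in> S' \<Longrightarrow> F z \<le> F y"
      using continuous_attains_sup[of S' F] False by blast
    have "y \<in> cball q r" "y \<noteq> x1" using y(1) r by (auto simp: S'_def)
    then have "F y < F x1" by (rule less)
    moreover have "F z + (F x1 - F y) / 2 < F x1" if "z \<in> S'" for z
      using y(2)[OF that] \<open>F y < F x1\<close> by (simp add: field_simps)
    ultimately show ?thesis by (intro exI[of _ "(F x1 - F y) / 2"]) simp
  qed (auto intro: exI[of _ 1])
  then obtain \<epsilon> where \<epsilon>: "\<epsilon> > 0" "\<And>z. z \<in> S' \<Longrightarrow> F z + \<epsilon> < F x1" by blast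
  define \<Phi> where "\<Phi> z = F z + \<epsilon> * w z" for z
  have \<Phi>D: "(\<Phi> has_derivative (\<lambda>h. fst h * (F1 z + \<epsilon> * (- 2 * lam * v1 z * w z)) + snd h * (F2 z + \<epsilon> * (- 2 * lam * v2 z * w z)))) (at z)"
    if "z \<in> cball q r" for z
    unfolding \<Phi>_def
    by (rule has_derivative_eq_rhs[OF has_derivative_add[OF D[OF that] has_derivative_mult_right[OF wD]]])
      (auto simp: fun_eq_iff algebra_simps)
  have \<Phi>_le: "\<Phi> z \<le> \<Phi> x1" if z: "z \<in> K" for z
  proof (rule ccontr)
    assume "\<not> \<Phi> z \<le> \<Phi> x1"
    have "continuous_on K \<Phi>"
      using K(2) by (intro continuous_at_imp_continuous_on ballI has_derivative_continuous[OF \<Phi>D]) auto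
    then obtain y where y: "y \<in> K" "\<And>z. z \<in> K \<Longrightarrow> \<Phi> z \<le> \<Phi> y"
      using continuous_attains_sup[OF K(1)] x1K by blast
    have gt: "\<Phi> y > \<Phi> x1" using y(2)[OF z] \<open>\<not> \<Phi> z \<le> \<Phi> x1\<close> by simp
    then have yx: "y \<noteq> x1" by auto
    have yq: "y \<in> cball q r" using y K by blast
    have nq: "dist y q \<noteq> r"
    proof
      assume "dist y q = r"
      then have "w y = w x1" unfolding w_def dq[symmetric] using r by simp
      with gt less[OF yq yx] show False by (simp add: \<Phi>_def)
    qed
    have nx: "dist y x1 \<noteq> r / 2"
    proof
      assume "dist y x1 = r / 2"
      then have "F y + \<epsilon> < F x1" using \<epsilon>(2) yq by (auto simp: S'_def dist_commute)
      moreover have "\<epsilon> * w y \<le> \<epsilon>" "\<epsilon> * w x1 > 0" using w \<epsilon>(1) by auto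
      ultimately show False using gt by (simp add: \<Phi>_def)
    qed
    define U where "U = ball q r \<inter> ball x1 (r/2)"
    have U: "open U" "y \<in> U" "U \<subseteq> K"
      using nq nx y(1) unfolding U_def K_def by (auto simp: dist_commute)
    let ?P = "\<lambda>z. F1 z + \<epsilon> * (- 2 * lam * v1 z * w z)" and ?Q = "\<lambda>z. F2 z + \<epsilon> * (- 2 * lam * v2 z * w z)"
    let ?P1 = "F11 y + \<epsilon> * w y * (4 * lam\<^sup>2 * (v1 y)\<^sup>2 - 2 * lam)"
      and ?P2 = "F12 y + \<epsilon> * w y * (4 * lam\<^sup>2 * v1 y * v2 y)"
      and ?Q1 = "F21 y + \<epsilon> * w y * (4 * lam\<^sup>2 * v1 y * v2 y)"
      and ?Q2 = "F22 y + \<epsilon> * w y * (4 * lam\<^sup>2 * (v2 y)\<^sup>2 - 2 * lam)"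
    have PD: "(?P has_derivative (\<lambda>h. fst h * ?P1 + snd h * ?P2)) (at y)"
      by (rule derivative_eq_intros D1[OF yq] wD vD refl)+ (auto simp: fun_eq_iff algebra_simps power2_eq_square)
    have QD: "(?Q has_derivative (\<lambda>h. fst h * ?Q1 + snd h * ?Q2)) (at y)"
      by (rule derivative_eq_intros D2[OF yq] wD vD refl)+ (auto simp: fun_eq_iff algebra_simps power2_eq_square)
    have UK: "z \<in> cball q r" "\<Phi> z \<le> \<Phi> y" if "z \<in> U" for z using that U(3) K(2) y(2) by blast+
    note test = second_derivative_test_plane[OF U(1,2) \<Phi>D[OF UK(1)] PD QD UK(2)]
    have p0: "?P y = 0" "?Q y = 0" using test(1,2) by blast+
    have "A y * ?P1 + B y * (?P2 + ?Q1) + C y * ?Q2 \<le> 0"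
      by (rule elliptic_le_0[OF test(3)]) (use ell[OF yq] in auto)
    also have "A y * ?P1 + B y * (?P2 + ?Q1) + C y * ?Q2
       = (A y * F11 y + B y * (F12 y + F21 y) + C y * F22 y) + \<epsilon> * w y * (4 * lam\<^sup>2 * form y - 2 * lam * (A y + C y))"
      by (simp add: form_def algebra_simps power2_eq_square)
    also have "\<dots> = \<epsilon> * w y * (2 * lam * (c1 y * v1 y + c2 y * v2 y)) + \<epsilon> * w y * (4 * lam\<^sup>2 * form y - 2 * lam * (A y + C y))"
      unfolding pde[OF yq] using p0 by (simp add: algebra_simps)
    also have "\<dots> = (2 * lam * \<epsilon> * w y) * (2 * lam * form y - rhs y)"
      by (simp add: rhs_def algebra_simps power2_eq_square)
    finally show False using key[OF y(1)] lam \<epsilon>(1) w(1)[of y]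
      by (smt (verit) mult_pos_pos)
  qed
  have lm: "local_max_on \<Phi> K x1" unfolding local_max_on_def using \<Phi>_le x1K by blast
  define G where "G = (F1 x1 + \<epsilon> * (- 2 * lam * v1 x1 * w x1), F2 x1 + \<epsilon> * (- 2 * lam * v2 x1 * w x1))"
  have GD: "(\<Phi> has_derivative (\<lambda>v. G \<bullet> v)) (at x1)"
    using \<Phi>D[of x1] x1K K(2) by (auto simp: G_def inner_prod_def mult.commute elim!: has_derivative_eq_rhs)
  have "tangent_dir K x1 (q - x1)"
    unfolding tangent_dir_def
  proof (intro exI[of _ "\<lambda>t. x1 + t *\<^sub>R (q - x1)"] conjI)
    show "((\<lambda>t. x1 + t *\<^sub>R (q - x1)) has_vector_derivative q - x1) (at_right 0)"
      by (auto intro!: derivative_eq_intros simp: has_vector_derivative_def)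
    have "x1 + t *\<^sub>R (q - x1) \<in> K" if "0 < t" "t < 1/2" for t
    proof -
      have "dist q (x1 + t *\<^sub>R (q - x1)) = norm ((1 - t) *\<^sub>R (q - x1))"
        by (simp add: dist_norm algebra_simps)
      also have "\<dots> = (1 - t) * r" using r that by (simp add: dist_norm norm_minus_commute)
      also have "\<dots> \<le> r" using r that by (simp add: algebra_simps)
      finally have 1: "dist q (x1 + t *\<^sub>R (q - x1)) \<le> r" .
      have "dist x1 (x1 + t *\<^sub>R (q - x1)) = t * r" using r that by (simp add: dist_norm norm_minus_commute)
      also have "\<dots> \<le> r / 2" using r that by simp
      finally show ?thesis using 1 by (simp add: K_def)
    qed
    then show "\<forall>\<^sub>F t in at_right 0. x1 + t *\<^sub>R (q - x1) \<in> K"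
      unfolding eventually_at_right_field by (intro exI[of _ "1/2"]) auto
  qed simp
  from tangent_dir_local_max[OF this lm GD]
  have "F1 x1 * (q1 - fst x1) + F2 x1 * (q2 - snd x1) + 2 * \<epsilon> * lam * w x1 * ((v1 x1)\<^sup>2 + (v2 x1)\<^sup>2) \<le> 0"
    by (simp add: G_def q inner_prod_def v1_def v2_def algebra_simps power2_eq_square)
  moreover have "2 * \<epsilon> * lam * w x1 * ((v1 x1)\<^sup>2 + (v2 x1)\<^sup>2) > 0"
    unfolding dq[symmetric] using \<epsilon>(1) lam w(1)[of x1] r by simp
  ultimately show ?thesis by (simp add: q)
qed

text \<open>On a minimal surface \<open>tension f\<close> is tangential, so expanding it in
  \<open>pd1 f\<close> and \<open>pd2 f\<close> shows that every linear coordinate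
  \<open>e \<bullet> f\<close> solves a linear elliptic equation without zeroth order term. The
  factor \<open>N\<close> clears the Gram determinant.\<close>

lemma chart_hopf:
  assumes min: "minimal_surface S" and ch: "surface_chart S f W V"
    and r: "r > 0" "dist x1 q = r" and sub: "cball q r \<subseteq> V"
    and less: "\<And>z. z \<in> cball q r \<Longrightarrow> z \<noteq> x1 \<Longrightarrow> e \<bullet> f z < e \<bullet> f x1"
  shows "(e \<bullet> pd1 f x1) * (fst q - fst x1) + (e \<bullet> pd2 f x1) * (snd q - snd x1) < 0"
proof -
  have W: "open W" "cball q r \<subseteq> W" and C2: "C2_on W f" using ch sub unfolding surface_chart_def by auto
  let ?E = "\<lambda>z. pd1 f z \<bullet> pd1 f z" and ?F = "\<lambda>z. pd1 f z \<bullet> pd2 f z" and ?G = "\<lambda>z. pd2 f z \<bullet> pd2 f z"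
  let ?c1 = "\<lambda>z. ?G z * (tension f z \<bullet> pd1 f z) - ?F z * (tension f z \<bullet> pd2 f z)"
    and ?c2 = "\<lambda>z. ?E z * (tension f z \<bullet> pd2 f z) - ?F z * (tension f z \<bullet> pd1 f z)"
  define N where "N z = ?E z * ?G z - (?F z)\<^sup>2" for z
  have Dg: "((\<lambda>w. e \<bullet> H w) has_derivative (\<lambda>h. fst h * (e \<bullet> H1) + snd h * (e \<bullet> H2))) (at z)"
    if "(H has_derivative (\<lambda>h. fst h *\<^sub>R H1 + snd h *\<^sub>R H2)) (at z)" for H :: "real \<times> real \<Rightarrow> R3" and H1 H2 z
    using has_derivative_inner_right[OF that, of e]
    by (rule has_derivative_eq_rhs) (simp add: inner_add_right)
  have c: "continuous_on (cball q r) (pd1 f)" "continuous_on (cball q r) (pd2 f)"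
    "continuous_on (cball q r) (pd1 (pd1 f))" "continuous_on (cball q r) (pd2 (pd1 f))" "continuous_on (cball q r) (pd2 (pd2 f))"
    using C2 W(2) unfolding C2_on_def by (auto intro: continuous_on_subset)
  show ?thesis
  proof (rule hopf_boundary_point[OF r, where F="\<lambda>z. e \<bullet> f z"
      and ?F1.0="\<lambda>z. e \<bullet> pd1 f z" and ?F2.0="\<lambda>z. e \<bullet> pd2 f z"
      and ?F11.0="\<lambda>z. e \<bullet> pd1 (pd1 f) z" and ?F12.0="\<lambda>z. e \<bullet> pd2 (pd1 f) z"
      and ?F21.0="\<lambda>z. e \<bullet> pd1 (pd2 f) z" and ?F22.0="\<lambda>z. e \<bullet> pd2 (pd2 f) z"
      and A="\<lambda>z. N z * ?G z" and B="\<lambda>z. - (N z * ?F z)"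
      and C="\<lambda>z. N z * ?E z"
      and ?c1.0="?c1"
      and ?c2.0="?c2"])
    fix z assume z: "z \<in> cball q r"
    then have zW: "z \<in> W" and zV: "z \<in> V" using W sub by auto
    show "((\<lambda>z. e \<bullet> f z) has_derivative (\<lambda>h. fst h * (e \<bullet> pd1 f z) + snd h * (e \<bullet> pd2 f z))) (at z)"
      "((\<lambda>z. e \<bullet> pd1 f z) has_derivative (\<lambda>h. fst h * (e \<bullet> pd1 (pd1 f) z) + snd h * (e \<bullet> pd2 (pd1 f) z))) (at z)"
      "((\<lambda>z. e \<bullet> pd2 f z) has_derivative (\<lambda>h. fst h * (e \<bullet> pd1 (pd2 f) z) + snd h * (e \<bullet> pd2 (pd2 f) z))) (at z)"
      using chart_differentiable[OF ch zW] Dg by blast+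
    note gp = gram_pos[OF chart_cross_nonzero[OF ch zV], folded N_def]
    have "(N z * ?G z) * (N z * ?E z) - (- (N z * ?F z))\<^sup>2 = N z * N z * N z"
      by (subst (6) N_def) (simp add: algebra_simps power2_eq_square)
    then show "N z * ?G z > 0 \<and> (N z * ?G z) * (N z * ?E z) - (- (N z * ?F z))\<^sup>2 > 0"
      using gp by simp
    have t0: "tension f z \<bullet> cross3 (pd1 f z) (pd2 f z) = 0"
      using min ch zV unfolding tension_inner_normal minimal_surface_def by blast
    have "N z * (e \<bullet> tension f z) =
        ?c1 z * (e \<bullet> pd1 f z)
      + ?c2 z * (e \<bullet> pd2 f z)"
      using arg_cong[OF cross3_frame_expansion[of "pd1 f z" "pd2 f z" "tension f z"], of "\<lambda>x. e \<bullet> x"] t0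
      unfolding lagrange_identity N_def by (simp add: inner_add_right)
    moreover have "N z * (e \<bullet> tension f z) = (N z * ?G z) * (e \<bullet> pd1 (pd1 f) z)
       + - (N z * ?F z) * (e \<bullet> pd2 (pd1 f) z + e \<bullet> pd1 (pd2 f) z)
       + (N z * ?E z) * (e \<bullet> pd2 (pd2 f) z)"
      unfolding C2_on_pd_symmetric[OF C2 W(1) zW, symmetric]
      by (simp add: tension_def inner_add_right inner_diff_right algebra_simps)
    ultimately show "(N z * ?G z) * (e \<bullet> pd1 (pd1 f) z)
       + - (N z * ?F z) * (e \<bullet> pd2 (pd1 f) z + e \<bullet> pd1 (pd2 f) z)
       + (N z * ?E z) * (e \<bullet> pd2 (pd2 f) z) =
        ?c1 z * (e \<bullet> pd1 f z)
      + ?c2 z * (e \<bullet> pd2 f z)"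
      by simp
  qed (use less in \<open>auto simp: N_def tension_def intro!: continuous_intros c\<close>)
qed

text \<open>A point \<open>q\<close> with a smaller value has a nearest maximum point
  \<open>x1\<close>. A ball touching the maximum set only there makes Hopf's derivative strictly
  negative, although the gradient vanishes at an interior maximum.\<close>

lemma strong_max_interior:
  assumes min: "minimal_surface S" and le: "\<And>x. x \<in> S \<Longrightarrow> e \<bullet> x \<le> m"
    and ch: "surface_chart S f W V" and a: "a \<in> V" "snd a > 0" "e \<bullet> f a = m"
  shows "\<exists>d>0. ball a d \<subseteq> V \<and> (\<forall>z\<in>ball a d. e \<bullet> f z = m)"
proof -
  have VW: "V \<subseteq> W" and VS: "f ` V \<subseteq> S" using ch unfolding surface_chart_def by auto
  have cf: "continuous_on V f" using chart_continuous_on[OF ch] VW continuous_on_subset by blast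
  obtain d where d: "d > 0" "cball a d \<subseteq> V \<inter> {z. snd z > 0}"
    using chart_interior_open[OF ch] a unfolding open_contains_cball by blast
  have eq: "e \<bullet> f q = m" if q: "q \<in> ball a (d/2)" for q
  proof (rule ccontr)
    assume neq: "e \<bullet> f q \<noteq> m"
    define A where "A = {z \<in> cball a d. e \<bullet> f z = m}"
    have "closed A" unfolding A_def
      by (intro continuous_closed_preimage_constant continuous_intros continuous_on_subset[OF cf]) (use d in auto)
    moreover have "a \<in> A" using a d by (auto simp: A_def)
    ultimately obtain x1 where x1: "x1 \<in> A" "\<And>y. y \<in> A \<Longrightarrow> dist q x1 \<le> dist q y"
      using distance_attains_inf[of A q] by blast
    define r where "r = dist q x1"
    have rd: "r < d / 2" using x1(2)[OF \<open>a \<in> A\<close>] q by (auto simp: r_def dist_commute)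
    have r0: "r > 0" using x1(1) neq by (auto simp: r_def A_def)
    \<comment> \<open>The ball around \<open>q\<close> through \<open>x1\<close> could touch the
      maximum set elsewhere too. The ball with the segment from \<open>q\<close> to
      \<open>x1\<close> as diameter meets that sphere at \<open>x1\<close> only, by the median
      identity used in \<open>near\<close>.\<close>
    define c where "c = midpoint q x1"
    have cd: "dist x1 c = r / 2" by (simp add: c_def r_def dist_midpoint)
    have near: "dist z q < r" if z: "z \<in> cball c (r/2)" "z \<noteq> x1" for z
    proof -
      have "(norm (z - q))\<^sup>2 + (norm (z - x1))\<^sup>2 = 2 * (norm (z - c))\<^sup>2 + (norm (q - x1))\<^sup>2 / 2"
        unfolding c_def midpoint_def power2_norm_eq_inner
        by (simp add: inner_diff_left inner_diff_right inner_add_left inner_add_right inner_commute field_simps)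
      moreover have "(norm (z - c))\<^sup>2 \<le> (r/2)\<^sup>2"
        using z by (intro power_mono) (auto simp: dist_norm norm_minus_commute)
      moreover have "(norm (z - x1))\<^sup>2 > 0" using z by simp
      moreover have "(norm (q - x1))\<^sup>2 = r\<^sup>2" "(r/2)\<^sup>2 = r\<^sup>2 / 4"
        by (simp_all add: r_def dist_norm power_divide)
      ultimately have "(norm (z - q))\<^sup>2 < r\<^sup>2" by linarith
      then show ?thesis using r0 by (simp add: dist_norm power2_less_imp_less)
    qed
    have sub: "cball c (r/2) \<subseteq> cball a d"
    proof
      fix z assume z: "z \<in> cball c (r/2)"
      have "dist z q \<le> r" using near[OF z] by (cases "z = x1") (auto simp: r_def dist_commute)
      then show "z \<in> cball a d" using dist_triangle[of z a q] q rd by (auto simp: dist_commute)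
    qed
    have x1V: "x1 \<in> V" "snd x1 > 0" using x1(1) d(2) by (auto simp: A_def)
    have "(e \<bullet> pd1 f x1) * (fst c - fst x1) + (e \<bullet> pd2 f x1) * (snd c - snd x1) < 0"
    proof (rule chart_hopf[OF min ch _ cd])
      fix z assume z: "z \<in> cball c (r/2)" "z \<noteq> x1"
      then have "z \<notin> A" using near[OF z] x1(2)[of z] by (auto simp: r_def dist_commute)
      then have "e \<bullet> f z \<noteq> m" using z sub by (auto simp: A_def)
      moreover have "f z \<in> S" using z sub d VS by blast
      ultimately show "e \<bullet> f z < e \<bullet> f x1" using le[of "f z"] x1(1) by (simp add: A_def)
    qed (use r0 sub d in auto)
    moreover have "e \<bullet> (fst h *\<^sub>R pd1 f x1 + snd h *\<^sub>R pd2 f x1) \<le> 0" for h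
    proof (rule tangent_dir_local_max)
      show "tangent_dir S (f x1) (fst h *\<^sub>R pd1 f x1 + snd h *\<^sub>R pd2 f x1)"
        by (rule chart_tangent_dir[OF ch x1V(1) chart_direction_eventually[OF ch x1V(1)]]) (use x1V in auto)
      show "local_max_on (\<lambda>x. e \<bullet> x) S (f x1)"
        unfolding local_max_on_def using le x1(1) x1V VS by (auto simp: A_def intro!: exI[of _ UNIV])
    qed (auto intro!: derivative_eq_intros)
    from this[of "(1,0)"] this[of "(-1,0)"] this[of "(0,1)"] this[of "(0,-1)"]
    have "e \<bullet> pd1 f x1 = 0" "e \<bullet> pd2 f x1 = 0" by auto
    ultimately show False by simp
  qed
  show ?thesis using d eq by (intro exI[of _ "d/2"]) auto
qed

text \<open>The maximum set is closed; for openness at a boundary point, the interior result makes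
  it empty or everything in a small half ball. If empty, Hopf's lemma in a ball touching the edge
  contradicts \<open>neu\<close>; if everything, continuity reaches the edge.\<close>

lemma strong_max_neumann:
  assumes min: "minimal_surface S" and con: "connected S" and le: "\<And>x. x \<in> S \<Longrightarrow> e \<bullet> x \<le> m"
    and p: "p \<in> S" "e \<bullet> p = m"
    and neu: "\<And>f W V s. surface_chart S f W V \<Longrightarrow> (s, 0) \<in> V \<Longrightarrow> e \<bullet> pd1 f (s, 0) = 0 \<Longrightarrow> e \<bullet> pd2 f (s, 0) = 0"
  shows "\<forall>x\<in>S. e \<bullet> x = m"
proof -
  define A where "A = {x \<in> S. e \<bullet> x = m}"
  have emb: "embedded_surface S" using min unfolding minimal_surface_def by blast
  have cl: "closedin (top_of_set S) A"
    unfolding A_def by (intro continuous_closedin_preimage_constant continuous_intros)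
  have "openin (top_of_set S) A"
  proof (subst openin_subopen, intro ballI)
    fix x assume x: "x \<in> A"
    then obtain f W V z where ch: "surface_chart S f W V" "z \<in> V" "x = f z"
      using emb unfolding embedded_surface_def A_def by blast
    have VW: "V \<subseteq> W" and VS: "f ` V \<subseteq> S" and oV: "openin (top_of_set S) (f ` V)"
      using ch unfolding surface_chart_def by auto
    have cf: "continuous_on V f" using chart_continuous_on[OF ch(1)] VW continuous_on_subset by blast
    obtain U where U: "open U" "V = halfplane \<inter> U"
      using ch(1) unfolding surface_chart_def openin_open by blast
    have emz: "e \<bullet> f z = m" using x ch by (simp add: A_def)
    have "\<exists>d>0. \<forall>w\<in>ball z d \<inter> V. e \<bullet> f w = m"
    proof (cases "snd z > 0")
      case True
      then show ?thesis using strong_max_interior[OF min le ch(1,2) True emz] by blast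
    next
      case False
      then have z0: "z = (fst z, 0)" using ch(2) U by (auto simp: halfplane_def prod_eq_iff)
      define s where "s = fst z"
      have zs: "z = (s, 0)" using z0 by (simp add: s_def)
      obtain d where d: "d > 0" "ball z d \<subseteq> U" using U ch(2) by (meson IntD2 openE)
      define H where "H = ball z d \<inter> {w. snd w > 0}"
      have HV: "H \<subseteq> V" using d U by (auto simp: H_def halfplane_def)
      have oH: "open H" unfolding H_def by (intro open_Int open_ball open_Collect_less continuous_intros)
      have "convex {w::real\<times>real. snd w > 0}"
        using convex_halfspace_gt[of 0 "(0, 1) :: real \<times> real"] by (simp add: inner_prod_def)
      then have coH: "connected H" unfolding H_def by (intro convex_connected convex_Int convex_ball)
      define B where "B = {w \<in> H. e \<bullet> f w = m}"
      have "open B"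
        unfolding open_contains_ball
      proof
        fix w assume w: "w \<in> B"
        then have "w \<in> V" "snd w > 0" "e \<bullet> f w = m" using HV by (auto simp: B_def H_def)
        then obtain r where r: "r > 0" "\<forall>z\<in>ball w r. e \<bullet> f z = m"
          using strong_max_interior[OF min le ch(1)] by blast
        obtain r' where "r' > 0" "ball w r' \<subseteq> H" using oH w by (auto simp: B_def elim: openE)
        with r show "\<exists>e>0. ball w e \<subseteq> B" by (intro exI[of _ "min r r'"]) (auto simp: B_def)
      qed
      then have "openin (top_of_set H) B" unfolding B_def by (auto simp: openin_open)
      moreover have "closedin (top_of_set H) B"
        unfolding B_def by (intro continuous_closedin_preimage_constant continuous_intros continuous_on_subset[OF cf HV])
      ultimately consider "B = {}" | "B = H" using coH unfolding connected_clopen by blast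
      then show ?thesis
      proof cases
        case 1
        \<comment> \<open>The ball of radius \<open>r\<close> tangent to the edge at
          \<open>z\<close> stays within distance \<open>2 * r\<close> of \<open>z\<close>, well
          inside the half ball of radius \<open>d\<close>.\<close>
        define r where "r = d / 4"
        have r: "r > 0" using d by (simp add: r_def)
        have dz: "dist z (s, r) = r" using r by (simp add: zs dist_Pair_Pair dist_real_def)
        have pos: "snd w > 0 \<and> w \<in> ball z d" if w: "w \<in> cball (s, r) r" "w \<noteq> z" for w
        proof -
          obtain w1 w2 where ww: "w = (w1, w2)" by fastforce
          have "(dist (s, r) w)\<^sup>2 \<le> r\<^sup>2" using w by (intro power_mono) auto
          then have "(s - w1)\<^sup>2 + (r - w2)\<^sup>2 \<le> r\<^sup>2" by (simp add: ww dist_Pair_Pair dist_real_def)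
          then have i: "(s - w1)\<^sup>2 + w2\<^sup>2 \<le> 2 * r * w2" by (simp add: power2_eq_square algebra_simps)
          have "(s - w1)\<^sup>2 + w2\<^sup>2 > 0" using w(2) by (auto simp: ww zs sum_power2_gt_zero_iff)
          then have "2 * r * w2 > 0" using i by linarith
          then have "w2 > 0" using r by (simp add: zero_less_mult_iff)
          moreover have "dist z w \<le> 2 * r" using dist_triangle[of z w "(s, r)"] w dz by (auto simp: dist_commute)
          ultimately show ?thesis using d by (simp add: ww r_def)
        qed
        have "(e \<bullet> pd1 f z) * (fst (s, r) - fst z) + (e \<bullet> pd2 f z) * (snd (s, r) - snd z) < 0"
        proof (rule chart_hopf[OF min ch(1) r dz])
          show "cball (s, r) r \<subseteq> V"
          proof
            fix w assume "w \<in> cball (s, r) r"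
            then show "w \<in> V" using pos[of w] ch(2) HV by (cases "w = z") (auto simp: H_def)
          qed
          fix w assume w: "w \<in> cball (s, r) r" "w \<noteq> z"
          then have "w \<in> H" using pos by (auto simp: H_def)
          then have "e \<bullet> f w \<noteq> m" using 1 unfolding B_def by blast
          moreover have "f w \<in> S" using \<open>w \<in> H\<close> HV VS by blast
          ultimately show "e \<bullet> f w < e \<bullet> f z" using le[of "f w"] emz by simp
        qed
        moreover have "e \<bullet> pd2 f z = 0"
        proof -
          note td = boundary_chart_tangent_dirs[OF ch(1) ch(2)[unfolded zs], folded zs]
          have lm: "local_max_on (\<lambda>x. e \<bullet> x) S (f z)"
            unfolding local_max_on_def using le emz VS ch(2) by (auto intro!: exI[of _ UNIV])
          have D: "((\<lambda>x. e \<bullet> x) has_derivative (\<lambda>v. e \<bullet> v)) (at (f z))" by (auto intro!: derivative_eq_intros)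
          have "e \<bullet> pd1 f z = 0"
            using tangent_dir_local_max[OF td(1) lm D] tangent_dir_local_max[OF td(2) lm D] by simp
          then show ?thesis using neu[OF ch(1) ch(2)[unfolded zs]] zs by simp
        qed
        ultimately show ?thesis by (simp add: zs)
      next
        case 2
        have "e \<bullet> f w = m" if w: "w \<in> ball z d \<inter> V" for w
        proof -
          have "((\<lambda>t. w + t *\<^sub>R (0, 1)) \<longlongrightarrow> w + 0 *\<^sub>R (0, 1)) (at_right (0::real))" by (intro tendsto_intros)
          then have l: "((\<lambda>t. w + t *\<^sub>R (0, 1)) \<longlongrightarrow> w) (at_right (0::real))" by (simp add: zero_prod_def[symmetric])
          have evV: "\<forall>\<^sub>F t in at_right 0. w + t *\<^sub>R (0, 1) \<in> V"
            by (rule chart_direction_eventually[OF ch(1)]) (use w in auto)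
          have "\<forall>\<^sub>F t in at_right 0. w + t *\<^sub>R (0, 1) \<in> ball z d"
            using topological_tendstoD[OF l, of "ball z d"] w by auto
          moreover have "\<forall>\<^sub>F t in at_right (0::real). t > 0" by (simp add: eventually_at_right_less)
          ultimately have ev: "\<forall>\<^sub>F t in at_right 0. e \<bullet> f (w + t *\<^sub>R (0, 1)) = m"
          proof eventually_elim
            case (elim t)
            have "snd w \<ge> 0" using w U by (auto simp: halfplane_def)
            then have "w + t *\<^sub>R (0, 1) \<in> H" using elim by (auto simp: H_def)
            then show ?case using 2 by (auto simp: B_def)
          qed
          have "((\<lambda>t. e \<bullet> f (w + t *\<^sub>R (0, 1))) \<longlongrightarrow> e \<bullet> f w) (at_right 0)"
            by (intro tendsto_intros continuous_on_tendsto_compose[OF cf l _ evV]) (use w in auto)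
          then have "((\<lambda>t::real. m) \<longlongrightarrow> e \<bullet> f w) (at_right 0)"
            by (rule Lim_transform_eventually) (use ev in auto)
          then show ?thesis by (simp add: tendsto_const_iff)
        qed
        then show ?thesis using d by blast
      qed
    qed
    then obtain d where d: "d > 0" "\<And>w. w \<in> ball z d \<inter> V \<Longrightarrow> e \<bullet> f w = m" by blast
    obtain k where k: "homeomorphism V (f ` V) f k" using ch(1) unfolding surface_chart_def by blast
    have "openin (top_of_set V) (V \<inter> ball z d)" by (auto simp: openin_open)
    then have "openin (top_of_set (f ` V)) (f ` (V \<inter> ball z d))"
      using homeomorphism_imp_open_map[OF k] by simp
    then have "openin (top_of_set S) (f ` (V \<inter> ball z d))" using oV openin_trans by blast
    moreover have "x \<in> f ` (V \<inter> ball z d)" using ch d by auto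
    moreover have "f ` (V \<inter> ball z d) \<subseteq> A" using d(2) VS by (auto simp: A_def)
    ultimately show "\<exists>T. openin (top_of_set S) T \<and> x \<in> T \<and> T \<subseteq> A" by blast
  qed
  with cl con have "A = {} \<or> A = S" unfolding connected_clopen by blast
  then show ?thesis using p unfolding A_def by blast
qed

section \<open>The end of the surface\<close>

lemma hproj_rotated:
  "dist (hproj (a + x * cos th - y * sin th, b + x * sin th + y * cos th, w)) (a, b) = sqrt (x\<^sup>2 + y\<^sup>2)"
proof -
  have "(x * cos th - y * sin th)\<^sup>2 + (x * sin th + y * cos th)\<^sup>2 = (x\<^sup>2 + y\<^sup>2) * ((sin th)\<^sup>2 + (cos th)\<^sup>2)"
    by algebra
  then show ?thesis by (simp add: dist_Pair_Pair dist_real_def add.assoc)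
qed

lemma norm_hproj_le: "norm (hproj X) \<le> norm X"
  by (cases X) (simp add: norm_prod_def)

lemma norm_R3_le: "norm X \<le> norm (hproj X) + \<bar>zc X\<bar>"
proof -
  obtain a b c where X: "X = (a, b, c)" using prod_cases3 by blast
  have "norm X = sqrt ((sqrt (a\<^sup>2 + b\<^sup>2))\<^sup>2 + (\<bar>c\<bar>)\<^sup>2)" by (simp add: X norm_prod_def)
  also have "\<dots> \<le> sqrt (a\<^sup>2 + b\<^sup>2) + \<bar>c\<bar>" by (rule sqrt_sum_squares_le_sum) auto
  finally show ?thesis by (simp add: X norm_prod_def)
qed

lemma regular_parallel_end_expansion:
  assumes "regular_parallel_end S \<alpha>"
  obtains \<kappa> l o' where "\<kappa> = \<alpha> \<or> \<kappa> = - \<alpha>"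
    "\<And>e. e > 0 \<Longrightarrow> \<exists>R>0. \<forall>X\<in>S. rad o' X \<ge> R \<longrightarrow> \<bar>zc X - \<kappa> * ln (rad o' X) - l\<bar> < e"
    "\<And>R. \<exists>X\<in>S. rad o' X \<ge> R"
proof -
  obtain a b th sg c0 \<beta> \<gamma>1 \<gamma>2 D u M R where H: "bounded D \<and> (sg = 1 \<or> sg = -1) \<and> R > 0 \<and>
       ((\<lambda>(x, y). (a + x * cos th - y * sin th, b + x * sin th + y * cos th, c0 + sg * u (x, y))) ` (UNIV - D) \<subseteq> S
        \<and> bounded (S - (\<lambda>(x, y). (a + x * cos th - y * sin th, b + x * sin th + y * cos th, c0 + sg * u (x, y))) ` (UNIV - D))) \<and>
       (\<forall>x y. x\<^sup>2 + y\<^sup>2 \<ge> R\<^sup>2 \<longrightarrow> (x, y) \<notin> D \<and>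
          \<bar>u (x, y) - (\<alpha> * ln (sqrt (x\<^sup>2 + y\<^sup>2)) + \<beta> + (\<gamma>1 * x + \<gamma>2 * y) / (x\<^sup>2 + y\<^sup>2))\<bar>
            \<le> M / (x\<^sup>2 + y\<^sup>2))"
    using assms unfolding regular_parallel_end_def Let_def by (elim exE) (rule that)
  note sg = H[THEN conjunct2, THEN conjunct1] and R = H[THEN conjunct2, THEN conjunct2, THEN conjunct1]
    and G = H[THEN conjunct2, THEN conjunct2, THEN conjunct2, THEN conjunct1, THEN conjunct1]
    and bd = H[THEN conjunct2, THEN conjunct2, THEN conjunct2, THEN conjunct1, THEN conjunct2]
    and u = H[THEN conjunct2, THEN conjunct2, THEN conjunct2, THEN conjunct2, rule_format]
  let ?P = "\<lambda>(x, y). (a + x * cos th - y * sin th, b + x * sin th + y * cos th, c0 + sg * u (x, y))"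
  obtain B where B: "\<And>X. X \<in> S - ?P ` (UNIV - D) \<Longrightarrow> norm X \<le> B"
    using bd unfolding bounded_iff by blast
  \<comment> \<open>Beyond this radius a point is too far out to lie in the bounded remainder of
    \<open>S\<close>, so it lies on the graph, and the expansion of \<open>u\<close> applies; the
    bound \<open>1\<close> lets \<open>1 / r^2\<close> be estimated by \<open>1 / r\<close>.\<close>
  define R0 where "R0 = max (max R 1) (B + norm (a, b) + 1)"
  define C where "C = \<bar>\<gamma>1\<bar> + \<bar>\<gamma>2\<bar> + \<bar>M\<bar>"
  have main: "\<bar>zc X - (sg * \<alpha>) * ln (dist (hproj X) (a, b)) - (c0 + sg * \<beta>)\<bar> \<le> C / dist (hproj X) (a, b)"
    if X: "X \<in> S" "dist (hproj X) (a, b) \<ge> R0" for X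
  proof -
    have "norm X > B"
    proof -
      have "dist (hproj X) (a, b) \<le> norm (hproj X) + norm (a, b)"
        unfolding dist_norm by (rule norm_triangle_ineq4)
      then show ?thesis using X(2) norm_hproj_le[of X] by (simp add: R0_def)
    qed
    then have "X \<in> ?P ` (UNIV - D)" using B[of X] X(1) by force
    then obtain x y where xy: "X = ?P (x, y)" by auto
    define r where "r = sqrt (x\<^sup>2 + y\<^sup>2)"
    have dr: "dist (hproj X) (a, b) = r" unfolding r_def xy by (simp only: prod.case hproj_rotated)
    have r1: "r \<ge> R" "r \<ge> 1" using X(2) unfolding dr by (auto simp: R0_def)
    have r2: "x\<^sup>2 + y\<^sup>2 = r\<^sup>2" by (simp add: r_def)
    have "x\<^sup>2 + y\<^sup>2 \<ge> R\<^sup>2" unfolding r2 using r1 R by (intro power_mono) auto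
    from u[OF this] have ub: "\<bar>u (x, y) - (\<alpha> * ln r + \<beta> + (\<gamma>1 * x + \<gamma>2 * y) / r\<^sup>2)\<bar> \<le> M / r\<^sup>2"
      unfolding r_def[symmetric] unfolding r2 by blast
    have xr: "\<bar>x\<bar> \<le> r" "\<bar>y\<bar> \<le> r" by (simp_all add: r_def real_le_rsqrt)
    have "\<bar>\<gamma>1 * x + \<gamma>2 * y\<bar> \<le> \<bar>\<gamma>1\<bar> * \<bar>x\<bar> + \<bar>\<gamma>2\<bar> * \<bar>y\<bar>"
      using abs_triangle_ineq[of "\<gamma>1 * x" "\<gamma>2 * y"] by (simp add: abs_mult)
    also have "\<dots> \<le> \<bar>\<gamma>1\<bar> * r + \<bar>\<gamma>2\<bar> * r" using xr by (intro add_mono mult_left_mono) auto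
    finally have "\<bar>(\<gamma>1 * x + \<gamma>2 * y) / r\<^sup>2\<bar> \<le> (\<bar>\<gamma>1\<bar> * r + \<bar>\<gamma>2\<bar> * r) / r\<^sup>2"
      by (simp add: divide_right_mono)
    also have "\<dots> = (\<bar>\<gamma>1\<bar> + \<bar>\<gamma>2\<bar>) / r" using r1 by (simp add: power2_eq_square field_simps)
    finally have 1: "\<bar>(\<gamma>1 * x + \<gamma>2 * y) / r\<^sup>2\<bar> \<le> (\<bar>\<gamma>1\<bar> + \<bar>\<gamma>2\<bar>) / r" .
    have "M / r\<^sup>2 \<le> \<bar>M\<bar> / r\<^sup>2" by (simp add: divide_right_mono)
    also have "\<dots> \<le> \<bar>M\<bar> / r" using r1 by (intro divide_left_mono) (auto simp: power2_eq_square)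
    finally have 2: "M / r\<^sup>2 \<le> \<bar>M\<bar> / r" .
    have "\<bar>zc X - (sg * \<alpha>) * ln r - (c0 + sg * \<beta>)\<bar> = \<bar>sg * (u (x, y) - \<alpha> * ln r - \<beta>)\<bar>"
      by (simp add: xy algebra_simps)
    also have "\<dots> = \<bar>u (x, y) - \<alpha> * ln r - \<beta>\<bar>" using sg by (auto simp: abs_mult)
    also have "\<dots> \<le> (\<bar>\<gamma>1\<bar> + \<bar>\<gamma>2\<bar>) / r + \<bar>M\<bar> / r" using ub 1 2 by linarith
    also have "\<dots> = C / r" by (simp add: C_def add_divide_distrib)
    finally show ?thesis unfolding dr .
  qed
  have C0: "C \<ge> 0" by (simp add: C_def)
  show thesis
  proof (rule that[of "sg * \<alpha>" "(a, b)" "c0 + sg * \<beta>"])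
    show "sg * \<alpha> = \<alpha> \<or> sg * \<alpha> = - \<alpha>" using sg by auto
    fix e :: real assume e: "e > 0"
    define R' where "R' = max R0 (C / e + 1)"
    have "\<bar>zc X - (sg * \<alpha>) * ln (dist (hproj X) (a, b)) - (c0 + sg * \<beta>)\<bar> < e"
      if X: "X \<in> S" "dist (hproj X) (a, b) \<ge> R'" for X
    proof -
      have d: "dist (hproj X) (a, b) > C / e" "dist (hproj X) (a, b) \<ge> R0" using X by (auto simp: R'_def)
      have "dist (hproj X) (a, b) > 0" using d(1) C0 e by (meson divide_nonneg_pos le_less_trans)
      then have "C / dist (hproj X) (a, b) < e" using d(1) e by (simp add: field_simps)
      with main[OF X(1) d(2)] show ?thesis by linarith
    qed
    moreover have "R' > 0" by (simp add: R'_def R0_def)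
    ultimately show "\<exists>R>0. \<forall>X\<in>S. dist (hproj X) (a, b) \<ge> R \<longrightarrow> \<bar>zc X - (sg * \<alpha>) * ln (dist (hproj X) (a, b)) - (c0 + sg * \<beta>)\<bar> < e"
      by blast
  next
    fix R1 :: real
    define x where "x = max R R1"
    have "x\<^sup>2 + 0\<^sup>2 \<ge> R\<^sup>2" using R by (simp add: x_def)
    then have "(x, 0) \<notin> D" using u by blast
    then have "?P (x, 0) \<in> S" using G by blast
    moreover have "dist (hproj (?P (x, 0))) (a, b) = \<bar>x\<bar>" by (simp only: prod.case hproj_rotated) simp
    then have "dist (hproj (?P (x, 0))) (a, b) \<ge> R1" by (simp add: x_def)
    ultimately show "\<exists>X\<in>S. dist (hproj X) (a, b) \<ge> R1" by blast
  qed
qed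

lemma continuous_on_hproj [continuous_intros]: "continuous_on A f \<Longrightarrow> continuous_on A (\<lambda>x. hproj (f x))"
  by (rule bounded_linear.continuous_on[OF hproj_bounded_linear])

lemma continuous_on_zc [continuous_intros]: "continuous_on A f \<Longrightarrow> continuous_on A (\<lambda>x. zc (f x))"
  by (rule bounded_linear.continuous_on[OF zc_bounded_linear])

text \<open>The expansion of the end controls heights only at large radius. A point of large height
  inside the cylinder is ruled out by a maximum of \<open>r^2 - (z - z1)^2 / 2\<close>: it lies far
  from \<open>surf_boundary S\<close> and off the lateral surface, hence is an interior maximum,
  although the Hessian has positive trace on every plane.\<close>

lemma cylinder_bounded:
  assumes cap: "capillary_surface S g gam"
    and R1: "R1 > 0" "\<And>X. X \<in> S \<Longrightarrow> rad c X = R1 \<Longrightarrow> \<bar>zc X\<bar> \<le> Z0"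
  shows "\<exists>Z. \<forall>X\<in>S. rad c X \<le> R1 \<longrightarrow> \<bar>zc X\<bar> \<le> Z"
proof -
  note capD = capillary_surfaceD[OF cap]
  obtain B where B: "\<And>X. X \<in> surf_boundary S \<Longrightarrow> norm X \<le> B"
    using compact_imp_bounded[OF capD(7)] unfolding bounded_iff by blast
  have zn: "\<bar>zc X\<bar> \<le> norm X" for X by (cases X) (auto simp: norm_prod_def intro!: real_le_rsqrt)
  define Z where "Z = max \<bar>Z0\<bar> \<bar>B\<bar>"
  have "\<bar>zc X1\<bar> \<le> Z + 2 * R1 + 1" if X1: "X1 \<in> S" "rad c X1 \<le> R1" for X1
  proof (rule ccontr)
    assume far: "\<not> \<bar>zc X1\<bar> \<le> Z + 2 * R1 + 1"
    define z1 where "z1 = zc X1"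
    define K where "K = S \<inter> {X. rad c X \<le> R1 \<and> \<bar>zc X - z1\<bar> \<le> 2 * R1}"
    have "closed K" unfolding K_def
      by (intro closed_Int capD(3) closed_Collect_conj closed_Collect_le continuous_intros)
    moreover have "bounded K"
      unfolding bounded_iff
    proof (intro exI[of _ "norm c + R1 + \<bar>z1\<bar> + 2 * R1"] ballI)
      fix X assume X: "X \<in> K"
      have "norm (hproj X) \<le> norm c + rad c X" by (metis dist_norm norm_triangle_sub add.commute norm_minus_commute)
      then show "norm X \<le> norm c + R1 + \<bar>z1\<bar> + 2 * R1" using X norm_R3_le[of X] unfolding K_def by auto
    qed
    ultimately have cK: "compact K" using compact_eq_bounded_closed by blast
    \<comment> \<open>The factor one half serves twice: the trace is \<open>1 + 3 * m\<close>, and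
      nonnegativity at the maximum confines it to
      \<open>\<bar>z - z1\<bar> \<le> sqrt 2 * R1\<close>, inside the chosen slab.\<close>
    let ?\<phi> = "\<lambda>X. 1 * ((rad c X)\<^sup>2 - (zc X - z1)\<^sup>2 / 2)"
    have X1K: "X1 \<in> K" using X1 R1 by (simp add: K_def z1_def)
    have "continuous_on K ?\<phi>" by (intro continuous_intros) auto
    then obtain X0 where X0: "X0 \<in> K" "\<And>X. X \<in> K \<Longrightarrow> ?\<phi> X \<le> ?\<phi> X0"
      using continuous_attains_sup[OF cK, of ?\<phi>] X1K by blast
    have "?\<phi> X1 \<ge> 0" by (simp add: z1_def)
    then have "(zc X0 - z1)\<^sup>2 \<le> 2 * (rad c X0)\<^sup>2" using X0(2)[OF X1K] by simp
    also have "\<dots> \<le> 2 * R1\<^sup>2" using X0(1) by (simp add: K_def power_mono)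
    also have "\<dots> < (2 * R1)\<^sup>2" using R1(1) by (simp add: power2_eq_square)
    finally have zz: "\<bar>zc X0 - z1\<bar> < 2 * R1"
      using R1(1) by (metis abs_of_pos mult_pos_pos power2_less_imp_less power2_abs zero_less_numeral abs_ge_zero less_imp_le)
    then have zX0: "\<bar>zc X0\<bar> > Z" using far by (simp add: z1_def)
    have X0S: "X0 \<in> S" using X0 by (simp add: K_def)
    have "rad c X0 \<noteq> R1" using R1(2)[OF X0S] zX0 by (auto simp: Z_def)
    then have dd: "rad c X0 < R1" using X0(1) by (simp add: K_def)
    have "local_max_on ?\<phi> S X0"
      unfolding local_max_on_def
    proof (intro conjI X0S exI[of _ "{X. rad c X < R1 \<and> \<bar>zc X - z1\<bar> < 2 * R1}"] ballI)
      show "open {X. rad c X < R1 \<and> \<bar>zc X - z1\<bar> < 2 * R1}"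
        by (intro open_Collect_conj open_Collect_less continuous_intros)
      fix X assume "X \<in> S \<inter> {X. rad c X < R1 \<and> \<bar>zc X - z1\<bar> < 2 * R1}"
      then show "?\<phi> X \<le> ?\<phi> X0" by (intro X0(2)) (auto simp: K_def)
    qed (use dd zz in auto)
    moreover have "X0 \<in> surf_interior S"
      using surface_interior_or_boundary[OF capD(2) X0S] B[of X0] zn[of X0] zX0 by (auto simp: Z_def)
    moreover have "((\<lambda>t. (t - z1)\<^sup>2 / 2) has_real_derivative t - z1) (at t)" for t
      by (auto intro!: derivative_eq_intros)
    moreover have "((\<lambda>t. t - z1) has_real_derivative 1) (at (zc X0))"
      by (auto intro!: derivative_eq_intros)
    ultimately obtain m where "0 \<le> m" "m \<le> 1" "1 * (2 * (1 + m) - 1 * (1 - m)) \<le> (0::real)"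
      using interior_max_rotational[OF capD(1), of X0 "\<lambda>t. (t - z1)\<^sup>2 / 2" "\<lambda>t. t - z1" 1 1 c] by blast
    then show False by simp
  qed
  then show ?thesis by blast
qed

lemma ln_diff_bound:
  fixes x y :: real assumes "x > 0" "y > 0" shows "ln x - ln y \<le> (x - y) / y"
  using ln_le_minus_one[of "x / y"] assms by (simp add: ln_div diff_divide_distrib)

text \<open>Moving the centre changes the radius by a bounded amount and its logarithm by a quantity
  tending to zero, so \<open>\<kappa>\<close> and \<open>l\<close> do not depend on
  \<open>c\<close>. This freedom allows barriers around any vertical axis.\<close>

lemma end_asymptotics:
  assumes cap: "capillary_surface S g gam" and reg: "regular_parallel_end S \<alpha>"
  obtains \<kappa> l where "\<kappa> = \<alpha> \<or> \<kappa> = - \<alpha>"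
    "\<And>c R. compact (S \<inter> {X. rad c X \<le> R})"
    "\<And>c e. e > 0 \<Longrightarrow> \<exists>R>0. \<forall>X\<in>S. rad c X \<ge> R \<longrightarrow> \<bar>zc X - \<kappa> * ln (rad c X) - l\<bar> < e"
    "\<And>c R. \<exists>X\<in>S. rad c X \<ge> R"
proof -
  obtain \<kappa> l o' where k: "\<kappa> = \<alpha> \<or> \<kappa> = - \<alpha>"
    and lim: "\<And>e. e > 0 \<Longrightarrow> \<exists>R>0. \<forall>X\<in>S. rad o' X \<ge> R \<longrightarrow> \<bar>zc X - \<kappa> * ln (rad o' X) - l\<bar> < e"
    and unb: "\<And>R. \<exists>X\<in>S. rad o' X \<ge> R"
    using regular_parallel_end_expansion[OF reg] by metis
  show thesis
  proof (rule that[OF k])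
    fix c R
    obtain R0 where R0: "R0 > 0" "\<And>X. X \<in> S \<Longrightarrow> rad o' X \<ge> R0 \<Longrightarrow> \<bar>zc X - \<kappa> * ln (rad o' X) - l\<bar> < 1"
      using lim[of 1] by auto
    define R1 where "R1 = max R0 (R + dist c o')"
    have R1: "R1 > 0" using R0 by (simp add: R1_def)
    have "\<bar>zc X\<bar> \<le> \<bar>\<kappa> * ln R1\<bar> + \<bar>l\<bar> + 1" if "X \<in> S" "rad o' X = R1" for X
      using R0(2)[of X] that by (simp add: R1_def)
    from cylinder_bounded[OF cap R1 this]
    obtain Z where Z: "\<And>X. X \<in> S \<Longrightarrow> rad o' X \<le> R1 \<Longrightarrow> \<bar>zc X\<bar> \<le> Z" by blast
    have "closed (S \<inter> {X. rad c X \<le> R})"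
      by (intro closed_Int capillary_surfaceD(3)[OF cap] closed_Collect_le continuous_intros)
    moreover have "bounded (S \<inter> {X. rad c X \<le> R})"
      unfolding bounded_iff
    proof (intro exI[of _ "norm o' + R1 + Z"] ballI)
      fix X assume X: "X \<in> S \<inter> {X. rad c X \<le> R}"
      have d: "rad o' X \<le> R1" using dist_triangle[of "hproj X" o' c] X
        by (auto simp: R1_def le_max_iff_disj)
      have "norm (hproj X) \<le> norm o' + rad o' X" by (metis dist_norm norm_triangle_sub add.commute norm_minus_commute)
      then show "norm X \<le> norm o' + R1 + Z" using norm_R3_le[of X] Z[of X] d X by auto
    qed
    ultimately show "compact (S \<inter> {X. rad c X \<le> R})" using compact_eq_bounded_closed by blast
  next
    fix c and e :: real assume e: "e > 0"
    obtain R0 where R0: "R0 > 0" "\<And>X. X \<in> S \<Longrightarrow> rad o' X \<ge> R0 \<Longrightarrow> \<bar>zc X - \<kappa> * ln (rad o' X) - l\<bar> < e / 2"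
      using lim[of "e/2"] e by auto
    define D where "D = dist c o'"
    define R where "R = R0 + D + 2 * (\<bar>\<kappa>\<bar> * D) / e + 1"
    have D0: "D \<ge> 0" by (simp add: D_def)
    have R: "R > 0" using R0 D0 e by (simp add: R_def add_pos_nonneg)
    have "\<bar>zc X - \<kappa> * ln (rad c X) - l\<bar> < e" if X: "X \<in> S" "rad c X \<ge> R" for X
    proof -
      define x where "x = rad c X"
      define y where "y = rad o' X"
      have xy: "\<bar>x - y\<bar> \<le> D" unfolding x_def y_def D_def
        by (metis abs_dist_diff_le dist_commute)
      define q where "q = 2 * (\<bar>\<kappa>\<bar> * D) / e"
      have q0: "q \<ge> 0" using D0 e by (simp add: q_def)
      have Rq: "R = R0 + D + q + 1" by (simp add: R_def q_def)
      have x: "x \<ge> R0 + D + q + 1" using X Rq by (simp add: x_def)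
      then have y: "y \<ge> R0" "y > q" "x > q" "y > 0" "x > 0" using xy R0(1) q0 D0 by linarith+
      have b: "\<bar>\<kappa>\<bar> * (D / w) < e / 2" if w: "w > q" for w
      proof -
        have w0: "w > 0" using w q0 by linarith
        have "2 * (\<bar>\<kappa>\<bar> * D) < e * w" using w e by (simp add: q_def field_simps)
        then show ?thesis using w0 by (simp add: field_simps)
      qed
      have "\<bar>ln x - ln y\<bar> \<le> max (D / x) (D / y)"
      proof -
        have "ln x - ln y \<le> (x - y) / y" "ln y - ln x \<le> (y - x) / x" using ln_diff_bound y by auto
        moreover have "(x - y) / y \<le> D / y" "(y - x) / x \<le> D / x" using xy y by (auto intro!: divide_right_mono)
        ultimately show ?thesis by linarith
      qed
      then have "\<bar>\<kappa>\<bar> * \<bar>ln x - ln y\<bar> \<le> \<bar>\<kappa>\<bar> * max (D / x) (D / y)" by (intro mult_left_mono) auto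
      also have "\<dots> < e / 2" using b[OF y(2)] b[OF y(3)] by (auto simp: max_def)
      finally have "\<bar>\<kappa> * ln x - \<kappa> * ln y\<bar> < e / 2" by (simp add: abs_mult[symmetric] right_diff_distrib)
      moreover have "\<bar>zc X - \<kappa> * ln y - l\<bar> < e / 2" using R0(2)[OF X(1)] y(1) by (simp add: y_def)
      ultimately show ?thesis unfolding x_def[symmetric] by linarith
    qed
    with R show "\<exists>R>0. \<forall>X\<in>S. rad c X \<ge> R \<longrightarrow> \<bar>zc X - \<kappa> * ln (rad c X) - l\<bar> < e" by blast
  next
    fix c R
    obtain X where X: "X \<in> S" "rad o' X \<ge> R + dist c o'" using unb by blast
    have "rad c X \<ge> R" using X(2) dist_triangle[of "hproj X" o' c] by simp
    with X show "\<exists>X\<in>S. rad c X \<ge> R" by blast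
  qed
qed

lemma attains_max_of_decay:
  fixes \<psi> :: "R3 \<Rightarrow> real"
  assumes comp: "\<And>R. compact (S \<inter> {X. rad c X \<le> R})"
    and cont: "continuous_on S \<psi>" and X1: "X1 \<in> S"
    and dec: "\<And>X. X \<in> S \<Longrightarrow> rad c X > R \<Longrightarrow> \<psi> X \<le> \<psi> X1"
  shows "\<exists>X0\<in>S. \<forall>X\<in>S. \<psi> X \<le> \<psi> X0"
proof -
  let ?R = "max R (rad c X1)"
  let ?K = "S \<inter> {X. rad c X \<le> ?R}"
  have X1K: "X1 \<in> ?K" using X1 by simp
  obtain X0 where X0: "X0 \<in> ?K" "\<And>X. X \<in> ?K \<Longrightarrow> \<psi> X \<le> \<psi> X0"
    using continuous_attains_sup[OF comp[of ?R], of \<psi>] X1K cont continuous_on_subset[of S \<psi> ?K] by blast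
  have "\<psi> X \<le> \<psi> X0" if "X \<in> S" for X
  proof (cases "rad c X \<le> ?R")
    case True then show ?thesis using X0(2) that by blast
  next
    case False
    then have "\<psi> X \<le> \<psi> X1" using dec that by auto
    then show ?thesis using X0(2)[OF X1K] by simp
  qed
  with X0 show ?thesis by blast
qed

section \<open>Catenoidal barriers\<close>

definition cosh_profile :: "real \<Rightarrow> real \<Rightarrow> real \<Rightarrow> real \<Rightarrow> real \<Rightarrow> real" where
  "cosh_profile s b c h t = b\<^sup>2 * (cosh ((s * t - h) / c))\<^sup>2"

definition cosh_profile' :: "real \<Rightarrow> real \<Rightarrow> real \<Rightarrow> real \<Rightarrow> real \<Rightarrow> real" where
  "cosh_profile' s b c h t = 2 * s * b\<^sup>2 / c * cosh ((s * t - h) / c) * sinh ((s * t - h) / c)"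

lemma cosh_profile_deriv:
  assumes "c \<noteq> 0"
  shows "(cosh_profile s b c h has_real_derivative cosh_profile' s b c h t) (at t)"
    "(cosh_profile' s b c h has_real_derivative
        2 * s\<^sup>2 * b\<^sup>2 / c\<^sup>2 * ((cosh ((s * t - h) / c))\<^sup>2 + (sinh ((s * t - h) / c))\<^sup>2)) (at t)"
  unfolding cosh_profile_def [abs_def] cosh_profile'_def [abs_def]
  using assms by (auto intro!: derivative_eq_intros simp: field_simps power2_eq_square)

lemma rotational_boundary_max:
  assumes bc: "boundary_contact S g gam \<delta> p T \<eta>"
    and \<Psi>: "(\<Psi> has_real_derivative \<Psi>') (at (zc p))"
    and lm: "local_max_on (\<lambda>x. \<sigma> * ((rad q x)\<^sup>2 - \<Psi> (zc x))) S p"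
  shows "\<sigma> * (2 * ((hproj p - q) \<bullet> hproj T) - \<Psi>' * zc T) = 0"
    "\<sigma> * (2 * ((hproj p - q) \<bullet> hproj \<eta>) - \<Psi>' * zc \<eta>) \<le> 0"
proof -
  let ?G = "(\<sigma> * (2 * (fst (hproj p) - fst q)), \<sigma> * (2 * (snd (hproj p) - snd q)), \<sigma> * - \<Psi>') :: R3"
  have G: "?G \<bullet> v = \<sigma> * (2 * ((hproj p - q) \<bullet> hproj v) - \<Psi>' * zc v)" for v
    by (cases v; cases q; cases p) (simp add: inner_prod_def algebra_simps)
  have "?G \<bullet> T = 0 \<and> ?G \<bullet> \<eta> \<le> 0"
    using bc[unfolded boundary_contact_def] lm rotational_gradient[OF \<Psi>, of \<sigma> q] by blast
  then show "\<sigma> * (2 * ((hproj p - q) \<bullet> hproj T) - \<Psi>' * zc T) = 0"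
    "\<sigma> * (2 * ((hproj p - q) \<bullet> hproj \<eta>) - \<Psi>' * zc \<eta>) \<le> 0"
    unfolding G by auto
qed

text \<open>With \<open>k = (b / c)^2\<close> and \<open>H\<close> the squared sinh, the gradient
  gives \<open>m = k H / (1 + k H)\<close>, and the trace multiplied by \<open>1 + k H\<close>
  collapses to \<open>2 * (1 - k)\<close>. Thus the mean curvature of the zero set has one sign
  everywhere, and vanishes exactly for the catenoid \<open>b = c\<close>.\<close>

lemma cosh_barrier_interior:
  assumes min: "minimal_surface S" and p: "p \<in> surf_interior S"
    and lm: "local_max_on (\<lambda>x. \<sigma> * ((rad q x)\<^sup>2 - cosh_profile s b c h (zc x))) S p"
    and \<sigma>: "\<sigma> = 1 \<or> \<sigma> = -1" and s: "s = 1 \<or> s = -1" and bc: "b > 0" "c > 0"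
    and eq: "(rad q p)\<^sup>2 = cosh_profile s b c h (zc p)"
  shows "\<sigma> * (1 - (b / c)\<^sup>2) \<le> 0"
proof -
  let ?\<theta> = "(s * zc p - h) / c"
  define C where "C = cosh ?\<theta>"
  define H where "H = (sinh ?\<theta>)\<^sup>2"
  define k where "k = (b / c)\<^sup>2"
  have CH: "C\<^sup>2 = 1 + H" unfolding C_def H_def by (simp add: cosh_square_eq)
  have s2: "s\<^sup>2 = 1" using s by auto
  have c0: "c \<noteq> 0" using bc by simp
  obtain m where m: "0 \<le> m" "m \<le> 1"
    "m * (4 * (rad q p)\<^sup>2 + (cosh_profile' s b c h (zc p))\<^sup>2) = (cosh_profile' s b c h (zc p))\<^sup>2"
    "\<sigma> * (2 * (1 + m) - (2 * s\<^sup>2 * b\<^sup>2 / c\<^sup>2 * ((cosh ?\<theta>)\<^sup>2 + (sinh ?\<theta>)\<^sup>2)) * (1 - m)) \<le> 0"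
    using interior_max_rotational[OF min p cosh_profile_deriv(1)[OF c0] cosh_profile_deriv(2)[OF c0] lm \<sigma>] by blast
  have H0: "H \<ge> 0" and k0: "k > 0" and C0: "C > 0" using bc by (simp_all add: H_def k_def C_def)
  have P: "(cosh_profile' s b c h (zc p))\<^sup>2 = 4 * b\<^sup>2 * C\<^sup>2 * (k * H)"
    unfolding cosh_profile'_def C_def[symmetric] using s2
    by (simp add: H_def k_def power_mult_distrib power_divide power2_eq_square)
  have "m * (4 * b\<^sup>2 * C\<^sup>2 * (1 + k * H)) = 4 * b\<^sup>2 * C\<^sup>2 * (k * H)"
    using m(3) unfolding P eq cosh_profile_def C_def[symmetric] by (simp add: algebra_simps)
  then have mk: "m * (1 + k * H) = k * H" using bc C0 by simp
  have kH: "1 + k * H > 0" using k0 H0 by (simp add: add_pos_nonneg)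
  have i: "\<sigma> * (2 * (1 + m) - 2 * k * (1 + 2 * H) * (1 - m)) \<le> 0"
  proof -
    have "2 * s\<^sup>2 * b\<^sup>2 / c\<^sup>2 * ((cosh ?\<theta>)\<^sup>2 + (sinh ?\<theta>)\<^sup>2) = 2 * k * (1 + 2 * H)"
      unfolding C_def[symmetric] H_def[symmetric] CH using s2 by (simp add: k_def power_divide)
    then show ?thesis using m(4) by simp
  qed
  have "(2 * (1 + m) - 2 * k * (1 + 2 * H) * (1 - m)) * (1 + k * H) = 2 * (1 - k)"
    using mk by algebra
  then have "\<sigma> * (2 * (1 - k)) = (\<sigma> * (2 * (1 + m) - 2 * k * (1 + 2 * H) * (1 - m))) * (1 + k * H)" by simp
  also have "\<dots> \<le> 0" using i kH by (simp add: mult_le_0_iff)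
  finally show ?thesis by (auto simp: k_def mult_le_0_iff)
qed

lemma cosh_profile'_contact:
  assumes "b > 0" "c > 0" "r \<ge> b" "(s * z - h) / c = arcosh (r / b)"
  shows "cosh_profile' s b c h z = 2 / c * (s * (r * sqrt (r\<^sup>2 - b\<^sup>2)))" "cosh_profile s b c h z = r\<^sup>2"
proof -
  have rb: "r / b \<ge> 1" using assms by simp
  have "sqrt ((r / b)\<^sup>2 - 1) = sqrt ((r\<^sup>2 - b\<^sup>2) / b\<^sup>2)" using assms by (simp add: power_divide diff_divide_distrib)
  also have "\<dots> = sqrt (r\<^sup>2 - b\<^sup>2) / b" using assms by (simp add: real_sqrt_divide)
  finally have s: "sinh (arcosh (r / b)) = sqrt (r\<^sup>2 - b\<^sup>2) / b" using rb by (simp add: sinh_arcosh_real)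
  show "cosh_profile' s b c h z = 2 / c * (s * (r * sqrt (r\<^sup>2 - b\<^sup>2)))"
    unfolding cosh_profile'_def assms(4) s using rb assms by (simp add: power2_eq_square)
  show "cosh_profile s b c h z = r\<^sup>2"
    unfolding cosh_profile_def assms(4) using rb assms by (simp add: power_divide)
qed

text \<open>The graph form of the comparison, suited to growth at infinity. The contact lemmas
  translate it into the squared form, with \<open>h\<close> the value at the contact point so that
  the zero set passes through that point.\<close>

abbreviation barrier :: "real \<Rightarrow> real \<Rightarrow> real \<Rightarrow> real \<times> real \<Rightarrow> R3 \<Rightarrow> real" where
  "barrier s b c q X \<equiv> s * zc X - c * arcosh (rad q X / b)"

text \<open>Contact of \<^term>\<open>S\<close> from below with the graph of \<open>c arcosh (r/b)\<close>, which for \<open>c < b\<close> is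
  strictly mean concave: only boundary contact is possible.\<close>
lemma contact_from_below:
  assumes cap: "capillary_surface S g gam" and s: "s = 1 \<or> s = -1" and bc: "0 < c" "c < b"
    and X0: "X0 \<in> S" and O': "open O'" "X0 \<in> O'"
    and r': "\<forall>X\<in>S. rad q X > b"
    and max': "\<forall>X\<in>S \<inter> O'. barrier s b c q X \<le> barrier s b c q X0"
  shows "X0 \<in> surf_boundary S"
    and "boundary_contact S g gam \<delta> X0 T \<eta> \<Longrightarrow>
      c * ((hproj X0 - q) \<bullet> hproj T) = s * (rad q X0 * sqrt ((rad q X0)\<^sup>2 - b\<^sup>2)) * zc T"
    and "boundary_contact S g gam \<delta> X0 T \<eta> \<Longrightarrow>
      s * (rad q X0 * sqrt ((rad q X0)\<^sup>2 - b\<^sup>2)) * zc \<eta> \<le> c * ((hproj X0 - q) \<bullet> hproj \<eta>)"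
proof -
  note capD = capillary_surfaceD[OF cap]
  note r = r'[rule_format] and max = max'[rule_format]
  define h where "h = barrier s b c q X0"
  define r0 where "r0 = rad q X0"
  have b0: "b > 0" using bc by simp
  have r0b: "r0 > b" using r[OF X0] by (simp add: r0_def)
  have th: "(s * zc X0 - h) / c = arcosh (r0 / b)" using bc by (simp add: h_def r0_def)
  note ct = cosh_profile'_contact[OF b0 bc(1) less_imp_le[OF r0b] th]
  have "arcosh (r0 / b) > 0" using r0b b0 by (simp add: arcosh_real_gt_1_iff)
  \<comment> \<open>The contact lies strictly above the waist. Near it \<open>s * z - h\<close> is
    positive, where cosh is increasing, so an inequality between heights becomes one between
    radii.\<close>
  then have gt: "s * zc X0 > h" using bc unfolding th[symmetric] by (simp add: zero_less_divide_iff)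
  have lm: "local_max_on (\<lambda>x. (-1) * ((rad q x)\<^sup>2 - cosh_profile s b c h (zc x))) S X0"
    unfolding local_max_on_def
  proof (intro conjI X0 exI[of _ "O' \<inter> {X. s * zc X > h}"] ballI)
    show "open (O' \<inter> {X. s * zc X > h})"
      using O'(1) by (intro open_Int open_Collect_less continuous_intros) auto
    fix X assume X: "X \<in> S \<inter> (O' \<inter> {X. s * zc X > h})"
    let ?r = "rad q X"
    have rb: "?r / b \<ge> 1" using r[of X] X b0 by simp
    have "s * zc X - h \<le> c * arcosh (?r / b)" using max[of X] X by (simp add: h_def)
    then have "(s * zc X - h) / c \<le> arcosh (?r / b)" using bc by (simp add: field_simps)
    then have "cosh ((s * zc X - h) / c) \<le> cosh (arcosh (?r / b))"
      using X bc arcosh_nonneg_real[OF rb] by (subst cosh_real_nonneg_le_iff) auto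
    then have "b * cosh ((s * zc X - h) / c) \<le> ?r" using rb b0 by (simp add: field_simps)
    then have "(b * cosh ((s * zc X - h) / c))\<^sup>2 \<le> ?r\<^sup>2" using b0 by (intro power_mono) auto
    then show "(-1) * (?r\<^sup>2 - cosh_profile s b c h (zc X)) \<le> (-1) * ((rad q X0)\<^sup>2 - cosh_profile s b c h (zc X0))"
      unfolding ct(2) r0_def by (simp add: cosh_profile_def power_mult_distrib)
  qed (use O' gt in auto)
  have "X0 \<notin> surf_interior S"
  proof
    assume "X0 \<in> surf_interior S"
    from cosh_barrier_interior[OF capD(1) this lm _ s b0 bc(1)] ct(2)
    have "(-1) * (1 - (b / c)\<^sup>2) \<le> 0" by (simp add: r0_def)
    moreover have "(b / c)\<^sup>2 > 1" using bc by (simp add: one_less_power)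
    ultimately show False by simp
  qed
  then show "X0 \<in> surf_boundary S" using surface_interior_or_boundary[OF capD(2) X0] by blast
  have c0: "c \<noteq> 0" using bc by simp
  assume con: "boundary_contact S g gam \<delta> X0 T \<eta>"
  note bm = rotational_boundary_max[OF con cosh_profile_deriv(1)[OF c0] lm, unfolded ct(1)]
  show "c * ((hproj X0 - q) \<bullet> hproj T) = s * (rad q X0 * sqrt ((rad q X0)\<^sup>2 - b\<^sup>2)) * zc T"
    using bm(1) bc by (simp add: r0_def field_simps)
  show "s * (rad q X0 * sqrt ((rad q X0)\<^sup>2 - b\<^sup>2)) * zc \<eta> \<le> c * ((hproj X0 - q) \<bullet> hproj \<eta>)"
    using bm(2) bc by (simp add: r0_def field_simps)
qed

text \<open>For \<open>b < c\<close> the mean curvature of the barrier has the opposite sign. Points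
  of radius below \<open>b\<close> satisfy \<open>r \<le> b cosh\<close> automatically, so the
  comparison is only required where \<open>r \<ge> b\<close>; in particular \<open>b\<close> may
  exceed the distance of \<open>S\<close> from the axis.\<close>

lemma contact_from_above:
  assumes cap: "capillary_surface S g gam" and s: "s = 1 \<or> s = -1" and bc: "0 < b" "b < c"
    and X0: "X0 \<in> S" "rad q X0 \<ge> b" and O': "open O'" "X0 \<in> O'"
    and min': "\<forall>X\<in>S \<inter> O'. rad q X \<ge> b \<longrightarrow>
       barrier s b c q X \<ge> barrier s b c q X0"
  shows "X0 \<in> surf_boundary S"
    and "boundary_contact S g gam \<delta> X0 T \<eta> \<Longrightarrow>
      c * ((hproj X0 - q) \<bullet> hproj T) = s * (rad q X0 * sqrt ((rad q X0)\<^sup>2 - b\<^sup>2)) * zc T"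
    and "boundary_contact S g gam \<delta> X0 T \<eta> \<Longrightarrow>
      c * ((hproj X0 - q) \<bullet> hproj \<eta>) \<le> s * (rad q X0 * sqrt ((rad q X0)\<^sup>2 - b\<^sup>2)) * zc \<eta>"
proof -
  note capD = capillary_surfaceD[OF cap]
  note min = min'[rule_format]
  define h where "h = barrier s b c q X0"
  define r0 where "r0 = rad q X0"
  have c_pos: "c > 0" using bc by simp
  have r0b: "r0 \<ge> b" using X0 by (simp add: r0_def)
  have th: "(s * zc X0 - h) / c = arcosh (r0 / b)" using bc by (simp add: h_def r0_def)
  note ct = cosh_profile'_contact[OF bc(1) c_pos r0b th]
  have lm: "local_max_on (\<lambda>x. 1 * ((rad q x)\<^sup>2 - cosh_profile s b c h (zc x))) S X0"
    unfolding local_max_on_def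
  proof (intro conjI X0(1) exI[of _ O'] O' ballI)
    fix X assume X: "X \<in> S \<inter> O'"
    let ?r = "rad q X"
    have "?r \<le> b * cosh ((s * zc X - h) / c)"
    proof (cases "?r \<ge> b")
      case True
      then have rb: "?r / b \<ge> 1" using bc by simp
      have "s * zc X - h \<ge> c * arcosh (?r / b)" using min[OF X True] by (simp add: h_def)
      then have "(s * zc X - h) / c \<ge> arcosh (?r / b)" using c_pos by (simp add: field_simps)
      moreover have "arcosh (?r / b) \<ge> 0" using rb by simp
      ultimately have "cosh ((s * zc X - h) / c) \<ge> cosh (arcosh (?r / b))"
        by (subst cosh_real_nonneg_le_iff) auto
      then show ?thesis using rb bc by (simp add: field_simps)
    next
      case False
      moreover have "b * 1 \<le> b * cosh ((s * zc X - h) / c)"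
        using bc cosh_real_ge_1 by (intro mult_left_mono) auto
      ultimately show ?thesis by linarith
    qed
    then have "?r\<^sup>2 \<le> (b * cosh ((s * zc X - h) / c))\<^sup>2" by (intro power_mono) auto
    then show "1 * (?r\<^sup>2 - cosh_profile s b c h (zc X)) \<le> 1 * ((rad q X0)\<^sup>2 - cosh_profile s b c h (zc X0))"
      unfolding ct(2) r0_def by (simp add: cosh_profile_def power_mult_distrib)
  qed
  have "X0 \<notin> surf_interior S"
  proof
    assume "X0 \<in> surf_interior S"
    from cosh_barrier_interior[OF capD(1) this lm _ s bc(1) c_pos] ct(2)
    have "1 * (1 - (b / c)\<^sup>2) \<le> 0" by (simp add: r0_def)
    moreover have "(b / c)\<^sup>2 < 1" using bc by (simp add: power_less_one_iff)
    ultimately show False by simp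
  qed
  then show "X0 \<in> surf_boundary S" using surface_interior_or_boundary[OF capD(2) X0(1)] by blast
  have c0: "c \<noteq> 0" using bc by simp
  assume con: "boundary_contact S g gam \<delta> X0 T \<eta>"
  note bm = rotational_boundary_max[OF con cosh_profile_deriv(1)[OF c0] lm, unfolded ct(1)]
  show "c * ((hproj X0 - q) \<bullet> hproj T) = s * (rad q X0 * sqrt ((rad q X0)\<^sup>2 - b\<^sup>2)) * zc T"
    using bm(1) c_pos by (simp add: r0_def field_simps)
  show "c * ((hproj X0 - q) \<bullet> hproj \<eta>) \<le> s * (rad q X0 * sqrt ((rad q X0)\<^sup>2 - b\<^sup>2)) * zc \<eta>"
    using bm(2) c_pos by (simp add: r0_def field_simps)
qed

section \<open>Growth of the barriers and existence of extrema\<close>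

lemma arcosh_bounds:
  fixes x :: real assumes "x \<ge> 1" shows "ln x \<le> arcosh x" "arcosh x \<le> ln (2 * x)"
proof -
  have "sqrt (x\<^sup>2 - 1) \<le> sqrt (x\<^sup>2)" by (intro real_sqrt_le_mono) simp
  then have "sqrt (x\<^sup>2 - 1) \<le> x" using assms by simp
  moreover have "sqrt (x\<^sup>2 - 1) \<ge> 0" using assms by simp
  ultimately show "ln x \<le> arcosh x" "arcosh x \<le> ln (2 * x)"
    using assms by (simp_all add: arcosh_real_def add_pos_nonneg)
qed

lemma arcosh_asymp: "((\<lambda>x::real. arcosh x - ln (2 * x)) \<longlongrightarrow> 0) at_top"
proof -
  have "((\<lambda>x::real. ln (x + sqrt (x\<^sup>2 - 1)) - ln (2 * x)) \<longlongrightarrow> 0) at_top" by real_asymp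
  then show ?thesis
    by (rule Lim_transform_eventually)
      (use eventually_ge_at_top[of 1] in \<open>eventually_elim, simp add: arcosh_real_def\<close>)
qed

lemma ln_eventually_large:
  fixes k C :: real assumes "k > 0" shows "\<exists>R. \<forall>r\<ge>R. k * ln r > C"
proof -
  have "filterlim (\<lambda>r::real. k * ln r) at_top at_top"
    using assms by real_asymp
  then show ?thesis unfolding filterlim_at_top_dense eventually_at_top_linorder by blast
qed

lemma continuous_on_arcosh_radius:
  assumes "b > 0" "\<And>X. X \<in> A \<Longrightarrow> rad q X \<ge> b"
  shows "continuous_on A (\<lambda>X. arcosh (rad q X / b))"
proof (rule continuous_on_compose2[OF continuous_on_arcosh[of "{1..}"]])
  show "continuous_on A (\<lambda>X. rad q X / b)"
    using assms(1) by (intro continuous_intros) auto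
  show "(\<lambda>X. rad q X / b) ` A \<subseteq> {1..}"
    using assms by (simp add: image_subset_iff)
qed auto

text \<open>\<open>arcosh (r / b)\<close> is at least \<open>ln (r / b)\<close>, so the barrier
  function is bounded above by \<open>(s * \<kappa> - c) * ln r\<close> plus a constant and tends to
  minus infinity.\<close>

lemma barrier_max_attained:
  assumes comp: "\<And>R. compact (S \<inter> {X. rad q X \<le> R})" and ne: "S \<noteq> {}"
    and lim: "\<exists>R>0. \<forall>X\<in>S. rad q X \<ge> R \<longrightarrow> \<bar>zc X - \<kappa> * ln (rad q X) - l\<bar> < 1"
    and s: "s = 1 \<or> s = -1" and b: "b > 0" and c: "c > 0" "c > s * \<kappa>"
    and r: "\<And>X. X \<in> S \<Longrightarrow> rad q X \<ge> b"
  shows "\<exists>X0\<in>S. \<forall>X\<in>S. barrier s b c q X \<le> barrier s b c q X0"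
proof -
  obtain X1 where X1: "X1 \<in> S" using ne by blast
  obtain R where R: "R > 0" "\<And>X. X \<in> S \<Longrightarrow> rad q X \<ge> R \<Longrightarrow> \<bar>zc X - \<kappa> * ln (rad q X) - l\<bar> < 1"
    using lim by blast
  let ?v = "barrier s b c q X1"
  obtain R' where R': "\<And>r. r \<ge> R' \<Longrightarrow> (c - s * \<kappa>) * ln r > s * l + 1 + c * ln b - ?v"
    using ln_eventually_large[of "c - s * \<kappa>"] c by (metis diff_gt_0_iff_gt)
  show ?thesis
  proof (rule attains_max_of_decay[OF comp _ X1, of _ "max R R'"])
    show "continuous_on S (\<lambda>X. barrier s b c q X)"
      by (intro continuous_on_diff continuous_on_mult continuous_on_const continuous_on_zc continuous_on_id
          continuous_on_arcosh_radius b r)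
    fix X assume X: "X \<in> S" "rad q X > max R R'"
    define x where "x = rad q X"
    have x: "x \<ge> R" "x \<ge> R'" "x > 0" using X R by (auto simp: x_def)
    have xb: "x / b \<ge> 1" using r[OF X(1)] b by (simp add: x_def)
    have "s * (zc X - \<kappa> * ln x - l) \<le> \<bar>s * (zc X - \<kappa> * ln x - l)\<bar>" by simp
    also have "\<dots> < 1" using R(2)[OF X(1)] x s by (auto simp: x_def abs_mult)
    finally have "s * zc X \<le> s * \<kappa> * ln x + s * l + 1" by (simp add: algebra_simps)
    moreover have "c * (ln x - ln b) \<le> c * arcosh (x / b)"
      using arcosh_bounds(1)[OF xb] x b c by (intro mult_left_mono) (auto simp: ln_div)
    ultimately have "s * zc X - c * arcosh (x / b) \<le> s * \<kappa> * ln x + s * l + 1 - c * (ln x - ln b)" by linarith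
    also have "\<dots> \<le> ?v" using R'[OF x(2)] by (simp add: algebra_simps)
    finally show "barrier s b c q X \<le> ?v" by (simp add: x_def)
  qed
qed

text \<open>The opposite growth: for \<open>c < s * \<kappa>\<close> the barrier function tends to
  plus infinity, now by the upper bound \<open>ln (2 * r / b)\<close> for arcosh. Only radii with
  \<open>r \<ge> b\<close> enter, as in \<open>contact_from_above\<close>.\<close>

lemma barrier_min_attained:
  assumes comp: "\<And>R. compact (S \<inter> {X. rad q X \<le> R})" and unb: "\<exists>X\<in>S. rad q X \<ge> b"
    and lim: "\<exists>R>0. \<forall>X\<in>S. rad q X \<ge> R \<longrightarrow> \<bar>zc X - \<kappa> * ln (rad q X) - l\<bar> < 1"
    and s: "s = 1 \<or> s = -1" and b: "b > 0" and c: "c > 0" "c < s * \<kappa>"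
  shows "\<exists>X0\<in>S. rad q X0 \<ge> b \<and> (\<forall>X\<in>S. rad q X \<ge> b \<longrightarrow>
     barrier s b c q X \<ge> barrier s b c q X0)"
proof -
  define S' where "S' = S \<inter> {X. rad q X \<ge> b}"
  obtain X1 where X1: "X1 \<in> S'" using unb by (auto simp: S'_def)
  obtain R where R: "R > 0" "\<And>X. X \<in> S \<Longrightarrow> rad q X \<ge> R \<Longrightarrow> \<bar>zc X - \<kappa> * ln (rad q X) - l\<bar> < 1"
    using lim by blast
  let ?f = "\<lambda>X. c * arcosh (rad q X / b) - s * zc X"
  obtain R' where R': "\<And>r. r \<ge> R' \<Longrightarrow> (s * \<kappa> - c) * ln r > c * ln (2 / b) + 1 - s * l - ?f X1"
    using ln_eventually_large[of "s * \<kappa> - c"] c by (metis diff_gt_0_iff_gt)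
  have "\<exists>X0\<in>S'. \<forall>X\<in>S'. ?f X \<le> ?f X0"
  proof (rule attains_max_of_decay[OF _ _ X1, of q _ "max R R'"])
    fix R
    have "S' \<inter> {X. rad q X \<le> R} = (S \<inter> {X. rad q X \<le> R}) \<inter> {X. rad q X \<ge> b}"
      by (auto simp: S'_def)
    moreover have "closed {X. rad q X \<ge> b}" by (intro closed_Collect_le continuous_intros)
    ultimately show "compact (S' \<inter> {X. rad q X \<le> R})" using comp by auto
  next
    show "continuous_on S' ?f"
      by (intro continuous_on_diff continuous_on_mult continuous_on_const continuous_on_zc continuous_on_id
          continuous_on_arcosh_radius b) (simp add: S'_def)
    fix X assume X: "X \<in> S'" "rad q X > max R R'"
    define x where "x = rad q X"
    have x: "x \<ge> R" "x \<ge> R'" "x > 0" using X R by (auto simp: x_def)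
    have XS: "X \<in> S" and xb: "x / b \<ge> 1" using X b by (auto simp: S'_def x_def)
    have "- (s * (zc X - \<kappa> * ln x - l)) \<le> \<bar>s * (zc X - \<kappa> * ln x - l)\<bar>" by simp
    also have "\<dots> < 1" using R(2)[OF XS] x s by (auto simp: x_def abs_mult)
    finally have "- (s * zc X) \<le> - (s * \<kappa> * ln x) - s * l + 1" by (simp add: algebra_simps)
    moreover have "c * arcosh (x / b) \<le> c * (ln x + ln (2 / b))"
    proof -
      have "ln (2 * (x / b)) = ln x + ln (2 / b)" using x b by (simp add: ln_mult ln_div)
      then show ?thesis using arcosh_bounds(2)[OF xb] c by (intro mult_left_mono) auto
    qed
    ultimately have "c * arcosh (x / b) - s * zc X \<le> c * (ln x + ln (2 / b)) - s * \<kappa> * ln x - s * l + 1" by linarith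
    also have "\<dots> \<le> ?f X1" using R'[OF x(2)] by (simp add: algebra_simps)
    finally show "?f X \<le> ?f X1" by (simp add: x_def)
  qed
  then show ?thesis unfolding S'_def by force
qed

text \<open>The curve is homeomorphic to a circle, hence separates the plane, while its outside
  alone is connected. The point obtained is the centre of the barrier in
  \<open>planar_oblique_impossible\<close>.\<close>

lemma inside_curve_nonempty:
  assumes g: "regular_jordan g" shows "inside (curveC g) \<noteq> {}"
proof
  assume e: "inside (curveC g) = {}"
  have sp: "simple_path g"
    unfolding simple_path_def loop_free_def path_def
  proof (intro conjI ballI impI regular_jordan_continuous[OF g])
    fix x y :: real assume xy: "x \<in> {0..1}" "y \<in> {0..1}" "g x = g y"
    show "x = y \<or> x = 0 \<and> y = 1 \<or> x = 1 \<and> y = 0"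
    proof (cases "\<bar>x - y\<bar> < 1")
      case True then show ?thesis using regular_jordan_inj[OF g xy(3)] by simp
    next
      case False then show ?thesis using xy(1,2) by auto
    qed
  qed
  have loop: "pathfinish g = pathstart g"
    using regular_jordan_periodic[OF g, of 0 1] by (simp add: pathfinish_def pathstart_def)
  have im: "path_image g = curveC g" by (simp add: path_image_def curveC_def)
  have "curveC g homeomorphic sphere (0::complex) 1"
    using homeomorphic_simple_path_image_circle[OF sp loop, of 1 0] im by simp
  also have "sphere (0::complex) 1 homeomorphic sphere (0::real\<times>real) 1"
    by (rule homeomorphic_spheres_gen) auto
  finally have "\<not> connected (- curveC g)" by (rule Jordan_Brouwer_separation) simp
  moreover have "connected (outside (curveC g))"
    by (rule connected_outside) (use bounded_simple_path_image[OF sp] im in auto)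
  ultimately show False using inside_Un_outside[of "curveC g"] e by simp
qed

section \<open>Planar ends and right angles\<close>

text \<open>At a right angle \<open>boundary_frame\<close> makes the conormal horizontal. So where
  the height has vanishing tangential derivative, its derivative along \<open>pd2\<close> vanishes
  too, as \<open>strong_max_neumann\<close> requires; \<open>s\<close> treats maxima and minima
  together.\<close>

lemma neumann_max_constant:
  assumes g: "regular_jordan g" and cap: "capillary_surface S g gam" and gr: "boundary_graph_over S g"
    and cos0: "cos gam = 0" and X0: "X0 \<in> S" "\<And>X. X \<in> S \<Longrightarrow> s * zc X \<le> s * zc X0" and s: "s = 1 \<or> s = -1"
  shows "\<forall>X\<in>S. zc X = zc X0"
proof -
  let ?e = "(0, 0, s) :: R3"
  have e: "?e \<bullet> v = s * zc v" for v by (simp add: inner_R3)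
  note capD = capillary_surfaceD[OF cap]
  have "\<forall>X\<in>S. ?e \<bullet> X = s * zc X0"
  proof (rule strong_max_neumann[OF capD(1,4) _ X0(1)])
    fix f W V t assume ch: "surface_chart S f W V" "(t, 0) \<in> V" and h: "?e \<bullet> pd1 f (t, 0) = 0"
    have lin: "linear zc" by (rule bounded_linear.linear[OF zc_bounded_linear])
    have k: "conormal f (t, 0) \<noteq> 0" using boundary_frame(2)[OF g cap gr ch] by auto
    have "zc (conormal f (t, 0) /\<^sub>R norm (conormal f (t, 0))) = 0"
      using boundary_frame(4)[OF g cap gr ch] cos0 by simp
    then have "zc (conormal f (t, 0)) = 0" using k by (simp add: linear_cmul[OF lin])
    then have "(pd1 f (t, 0) \<bullet> pd1 f (t, 0)) * zc (pd2 f (t, 0)) = 0"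
      using h s by (auto simp: conormal_def linear_diff[OF lin] linear_cmul[OF lin] e)
    then show "?e \<bullet> pd2 f (t, 0) = 0"
      using gram_pos(1)[OF chart_cross_nonzero[OF ch]] unfolding e by auto
  qed (use X0 in \<open>auto simp: e\<close>)
  then show ?thesis unfolding e using s by auto
qed

text \<open>A height different from \<open>l\<close> lies on one definite side of the limit, so the
  supremum or infimum on that side is attained; the height is then constant, and the end forces the
  constant to be \<open>l\<close>.\<close>

lemma planar_right_angle:
  assumes g: "regular_jordan g" and cap: "capillary_surface S g gam" and gr: "boundary_graph_over S g"
    and cos0: "cos gam = 0"
    and comp: "\<And>R. compact (S \<inter> {X. rad c X \<le> R})"
    and lim: "\<And>e. e > 0 \<Longrightarrow> \<exists>R>0. \<forall>X\<in>S. rad c X \<ge> R \<longrightarrow> \<bar>zc X - l\<bar> < e"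
    and unb: "\<And>R. \<exists>X\<in>S. rad c X \<ge> R"
  shows "\<forall>X\<in>S. zc X = l"
proof (rule ccontr)
  assume "\<not> (\<forall>X\<in>S. zc X = l)"
  then obtain X1 where X1: "X1 \<in> S" "zc X1 \<noteq> l" by blast
  define s :: real where "s = (if zc X1 > l then 1 else -1)"
  have s: "s = 1 \<or> s = -1" by (simp add: s_def)
  define e where "e = \<bar>zc X1 - l\<bar> / 2"
  have e: "e > 0" using X1 by (simp add: e_def)
  have se: "s * zc X1 = s * l + 2 * e" using X1(2) by (auto simp: s_def e_def)
  obtain R where R: "R > 0" "\<And>X. X \<in> S \<Longrightarrow> rad c X \<ge> R \<Longrightarrow> \<bar>zc X - l\<bar> < e" using lim[OF e] by blast
  have "\<exists>X0\<in>S. \<forall>X\<in>S. s * zc X \<le> s * zc X0"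
  proof (rule attains_max_of_decay[OF comp _ X1(1), of _ R])
    show "continuous_on S (\<lambda>X. s * zc X)" by (intro continuous_intros)
    fix X assume "X \<in> S" "rad c X > R"
    then have "\<bar>zc X - l\<bar> < e" using R(2) by simp
    then show "s * zc X \<le> s * zc X1" unfolding se using s e by auto
  qed
  then obtain X0 where X0: "X0 \<in> S" "\<And>X. X \<in> S \<Longrightarrow> s * zc X \<le> s * zc X0" by blast
  have const: "\<forall>X\<in>S. zc X = zc X0" by (rule neumann_max_constant[OF g cap gr cos0 X0 s])
  obtain X where X: "X \<in> S" "rad c X \<ge> R" using unb by blast
  have "\<bar>zc X - l\<bar> < e" "zc X = zc X1" using R(2)[OF X] const X X1 by auto
  then show False using X1(2) by (simp add: e_def)
qed

text \<open>On a logarithmic end the height tends to infinity with one sign, so the opposite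
  extremum is attained and the height would be constant.\<close>

lemma catenoidal_not_right_angle:
  assumes g: "regular_jordan g" and cap: "capillary_surface S g gam" and gr: "boundary_graph_over S g"
    and k0: "\<kappa> \<noteq> 0"
    and comp: "\<And>R. compact (S \<inter> {X. rad c X \<le> R})"
    and lim: "\<exists>R>0. \<forall>X\<in>S. rad c X \<ge> R \<longrightarrow> \<bar>zc X - \<kappa> * ln (rad c X) - l\<bar> < 1"
    and unb: "\<And>R. \<exists>X\<in>S. rad c X \<ge> R"
  shows "cos gam \<noteq> 0"
proof
  assume cos0: "cos gam = 0"
  define s :: real where "s = (if \<kappa> > 0 then -1 else 1)"
  have s: "s = 1 \<or> s = -1" by (simp add: s_def)
  have sk: "s * \<kappa> = - \<bar>\<kappa>\<bar>" by (simp add: s_def)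
  obtain R where R: "R > 0" "\<And>X. X \<in> S \<Longrightarrow> rad c X \<ge> R \<Longrightarrow> \<bar>zc X - \<kappa> * ln (rad c X) - l\<bar> < 1"
    using lim by blast
  have decay: "\<exists>R'. \<forall>X\<in>S. rad c X \<ge> R' \<longrightarrow> s * zc X < B" for B
  proof -
    obtain R' where R': "\<And>r. r \<ge> R' \<Longrightarrow> \<bar>\<kappa>\<bar> * ln r > s * l + 1 - B"
      using ln_eventually_large[of "\<bar>\<kappa>\<bar>"] k0 by (metis zero_less_abs_iff)
    have "s * zc X < B" if X: "X \<in> S" "rad c X \<ge> max R R'" for X
    proof -
      have "s * (zc X - \<kappa> * ln (rad c X) - l) \<le> \<bar>s * (zc X - \<kappa> * ln (rad c X) - l)\<bar>" by simp
      also have "\<dots> < 1" using R(2)[OF X(1)] X s by (auto simp: abs_mult)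
      finally have "s * zc X < (s * \<kappa>) * ln (rad c X) + s * l + 1" by (simp add: algebra_simps)
      moreover have "\<bar>\<kappa>\<bar> * ln (rad c X) > s * l + 1 - B" using R' X by simp
      ultimately show ?thesis unfolding sk by simp
    qed
    then show ?thesis by blast
  qed
  obtain X1 where X1: "X1 \<in> S" using unb by blast
  obtain R1 where R1: "\<And>X. X \<in> S \<Longrightarrow> rad c X \<ge> R1 \<Longrightarrow> s * zc X < s * zc X1" using decay by blast
  have "\<exists>X0\<in>S. \<forall>X\<in>S. s * zc X \<le> s * zc X0"
    by (rule attains_max_of_decay[OF comp _ X1, of _ R1])
      (auto intro!: continuous_intros less_imp_le[OF R1])
  then obtain X0 where X0: "X0 \<in> S" "\<And>X. X \<in> S \<Longrightarrow> s * zc X \<le> s * zc X0" by blast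
  have const: "\<forall>X\<in>S. zc X = zc X0" by (rule neumann_max_constant[OF g cap gr cos0 X0 s])
  obtain X where X: "X \<in> S" "rad c X \<ge> R1" using unb by blast
  have "zc X = zc X1" using const X X1 by simp
  with R1[OF X] show False by simp
qed

lemma norm_hproj_zc: "(norm (hproj T))\<^sup>2 + (zc T)\<^sup>2 = (norm T)\<^sup>2"
  by (cases T) (simp add: norm_prod_def)

text \<open>Taking \<open>s = \<delta>\<close> makes the conormal rise in the direction of the
  barrier. At the contact the slope \<open>c / \<omega>\<close> of the barrier bounds both the rise
  of the conormal, hence the horizontal part \<open>t\<close> of \<open>T\<close>, and the slope of
  \<open>T\<close> itself; a unit vector cannot have both parts this small.\<close>

lemma planar_oblique_impossible:
  assumes g: "regular_jordan g" and cap: "capillary_surface S g gam" and gr: "boundary_graph_over S g"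
    and cos0: "cos gam \<noteq> 0"
    and comp: "\<And>c R. compact (S \<inter> {X. rad c X \<le> R})"
    and lim: "\<And>c e. e > 0 \<Longrightarrow> \<exists>R>0. \<forall>X\<in>S. rad c X \<ge> R \<longrightarrow> \<bar>zc X - l\<bar> < e"
  shows False
proof -
  note capD = capillary_surfaceD[OF cap]
  obtain \<delta> where d: "\<delta> = 1 \<or> \<delta> = -1" "\<And>p. p \<in> surf_boundary S \<Longrightarrow> \<exists>T \<eta>. boundary_contact S g gam \<delta> p T \<eta>"
    using boundary_contact_exists[OF g cap gr] by blast
  obtain q where q: "q \<in> inside (curveC g)" using inside_curve_nonempty[OF g] by blast
  have "closed (curveC g)" unfolding curveC_def
    by (intro compact_imp_closed compact_continuous_image regular_jordan_continuous[OF g]) auto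
  then obtain b0 where b0: "b0 > 0" "ball q b0 \<subseteq> inside (curveC g)"
    using open_inside q by (meson openE)
  define b where "b = b0 / 2"
  \<comment> \<open>All points of \<open>S\<close> have radius at least \<open>2 * b\<close>, so the
    barrier has slope at most \<open>c / b = \<bar>cos gam\<bar> / 4\<close>. This yields
    \<open>t \<le> 1/4\<close> from the conormal and \<open>\<bar>zc T\<bar> \<le> t\<close> from
    the tangent.\<close>
  define c where "c = b * \<bar>cos gam\<bar> / 4"
  have b: "b > 0" using b0 by (simp add: b_def)
  have cg: "0 < \<bar>cos gam\<bar>" "\<bar>cos gam\<bar> \<le> 1" using cos0 by auto
  have c: "c > 0" using b cg by (simp add: c_def)
  have "b * \<bar>cos gam\<bar> \<le> b * 1" using b cg by (intro mult_left_mono) auto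
  then have cb: "c < b" using b unfolding c_def by linarith
  have r: "rad q X \<ge> 2 * b" if "X \<in> S" for X
  proof (rule ccontr)
    assume "\<not> rad q X \<ge> 2 * b"
    then have "hproj X \<in> ball q b0" by (simp add: b_def dist_commute)
    then have "X \<in> K_int g" using b0(2) unfolding K_int_def by blast
    with capD(5) that show False by blast
  qed
  have rb: "\<forall>X\<in>S. rad q X > b" using r b by force
  have ne: "S \<noteq> {}" using capD(2) unfolding embedded_surface_def by blast
  have "\<exists>X0\<in>S. \<forall>X\<in>S. barrier \<delta> b c q X \<le> barrier \<delta> b c q X0"
    by (rule barrier_max_attained[OF comp ne, where \<kappa>=0 and l=l])
      (use lim[of 1 q] d(1) b c rb in \<open>auto intro: less_imp_le\<close>)
  then obtain p where p: "p \<in> S" "\<And>X. X \<in> S \<Longrightarrow> barrier \<delta> b c q X \<le> barrier \<delta> b c q p"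
    by blast
  have pmax: "\<forall>X\<in>S \<inter> UNIV. barrier \<delta> b c q X \<le> barrier \<delta> b c q p"
    using p(2) by simp
  note below = contact_from_below[OF cap d(1) c cb p(1) open_UNIV UNIV_I rb pmax]
  have pb: "p \<in> surf_boundary S" by (rule below(1))
  obtain T \<eta> where bc: "boundary_contact S g gam \<delta> p T \<eta>" using d(2)[OF pb] by blast
  define r0 where "r0 = rad q p"
  define \<omega> where "\<omega> = sqrt (r0\<^sup>2 - b\<^sup>2)"
  have i: "c * ((hproj p - q) \<bullet> hproj T) = \<delta> * (r0 * \<omega>) * zc T"
    unfolding r0_def \<omega>_def by (rule below(2)[OF bc])
  have ii: "\<delta> * (r0 * \<omega>) * zc \<eta> \<le> c * ((hproj p - q) \<bullet> hproj \<eta>)"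
    unfolding r0_def \<omega>_def by (rule below(3)[OF bc])
  have r0: "r0 \<ge> 2 * b" "r0 > 0" using r[OF p(1)] b by (auto simp: r0_def)
  have "(2 * b)\<^sup>2 \<le> r0\<^sup>2" using r0 b by (intro power_mono) auto
  then have "4 * b\<^sup>2 \<le> r0\<^sup>2" by (simp add: power_mult_distrib)
  then have "b\<^sup>2 \<le> r0\<^sup>2 - b\<^sup>2" using zero_le_power2[of b] by linarith
  then have \<omega>: "\<omega> \<ge> b" unfolding \<omega>_def using b by (metis abs_of_pos real_sqrt_abs real_sqrt_le_iff)
  have T1: "norm T = 1" and e1: "norm \<eta> = 1" and ze: "zc \<eta> = \<delta> * \<bar>cos gam\<bar> * norm (hproj T)"
    using bc unfolding boundary_contact_def by auto
  define t where "t = norm (hproj T)"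
  have "(hproj p - q) \<bullet> hproj \<eta> \<le> norm (hproj p - q) * norm (hproj \<eta>)" by (rule norm_cauchy_schwarz)
  also have "\<dots> \<le> r0 * 1" unfolding r0_def dist_norm using norm_hproj_le[of \<eta>] e1 by (intro mult_left_mono) auto
  finally have "c * ((hproj p - q) \<bullet> hproj \<eta>) \<le> c * r0" using c by simp
  moreover have "\<delta> * (r0 * \<omega>) * zc \<eta> = r0 * (\<omega> * \<bar>cos gam\<bar> * t)" using d(1) by (auto simp: ze t_def)
  ultimately have "r0 * (\<omega> * \<bar>cos gam\<bar> * t) \<le> r0 * c" using ii by (simp only: mult.commute[of r0 c])
  then have "\<omega> * \<bar>cos gam\<bar> * t \<le> c" using r0 by simp
  moreover have "b * \<bar>cos gam\<bar> * t \<le> \<omega> * \<bar>cos gam\<bar> * t" using \<omega> by (intro mult_right_mono) (auto simp: t_def)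
  ultimately have "(b * \<bar>cos gam\<bar>) * t \<le> (b * \<bar>cos gam\<bar>) * (1/4)" by (simp add: c_def)
  then have t4: "t \<le> 1/4" using b cg by (simp add: mult_le_cancel_left)
  have "r0 * (\<omega> * \<bar>zc T\<bar>) = \<bar>\<delta> * (r0 * \<omega>) * zc T\<bar>"
    using d(1) r0 \<omega> b by (auto simp: abs_mult)
  also have "\<dots> = c * \<bar>(hproj p - q) \<bullet> hproj T\<bar>" unfolding i[symmetric] using c by (simp add: abs_mult)
  also have "\<dots> \<le> c * (r0 * t)"
    unfolding r0_def t_def dist_norm using c Cauchy_Schwarz_ineq2 by (intro mult_left_mono) auto
  finally have "r0 * (\<omega> * \<bar>zc T\<bar>) \<le> r0 * (c * t)" by (simp only: mult.left_commute)
  then have "\<omega> * \<bar>zc T\<bar> \<le> c * t" using r0 by simp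
  moreover have "b * \<bar>zc T\<bar> \<le> \<omega> * \<bar>zc T\<bar>" using \<omega> by (intro mult_right_mono) auto
  moreover have "c * t \<le> b * t" using cb by (intro mult_right_mono) (auto simp: t_def)
  ultimately have "b * \<bar>zc T\<bar> \<le> b * t" by linarith
  then have "\<bar>zc T\<bar> \<le> t" using b by simp
  then have "(zc T)\<^sup>2 \<le> t\<^sup>2" by (metis abs_ge_zero power2_abs power_mono)
  moreover have "t\<^sup>2 \<le> (1/4)\<^sup>2" using t4 by (intro power_mono) (auto simp: t_def)
  moreover have "t\<^sup>2 + (zc T)\<^sup>2 = 1" unfolding t_def norm_hproj_zc T1 by simp
  ultimately show False by (simp add: power2_eq_square)
qed

section \<open>Contact with a circular cylinder\<close>

lemma outside_circle:
  assumes cap: "capillary_surface S g gam" and C: "curveC g = sphere c0 \<rho>" and X: "X \<in> S"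
  shows "rad c0 X \<ge> \<rho>"
proof (rule ccontr)
  assume "\<not> rad c0 X \<ge> \<rho>"
  then have "hproj X \<in> interior (cball c0 \<rho>)" by (simp add: dist_commute)
  then have "hproj X \<in> inside (curveC g)"
    using interior_inside_frontier[of "cball c0 \<rho>"] C by auto
  then show False using X capillary_surfaceD(5)[OF cap] unfolding K_int_def by blast
qed

text \<open>For a circle the radial vector is plus or minus \<open>\<rho>\<close> times the normal
  of the cylinder, so \<open>boundary_contact\<close> gives its inner product with
  \<open>\<eta>\<close> up to sign; the sign is positive because \<open>S\<close> stays
  outside.\<close>

lemma circle_contact:
  assumes g: "regular_jordan g" and cap: "capillary_surface S g gam"
    and C: "\<rho> > 0" "curveC g = sphere c0 \<rho>" and p: "p \<in> surf_boundary S"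
  shows "rad c0 p = \<rho>"
    and "boundary_contact S g gam \<delta> p T \<eta> \<Longrightarrow> (hproj p - c0) \<bullet> hproj T = 0"
    and "boundary_contact S g gam \<delta> p T \<eta> \<Longrightarrow> (hproj p - c0) \<bullet> hproj \<eta> = \<rho> * sin gam"
proof -
  note capD = capillary_surfaceD[OF cap]
  have "hproj p \<in> curveC g" using p capD(9) unfolding Sigma_cyl_def by blast
  then have "hproj p \<in> sphere c0 \<rho>" using C by simp
  then show dp: "rad c0 p = \<rho>" by (simp add: dist_commute)
  obtain t where t: "g t = hproj p" using \<open>hproj p \<in> curveC g\<close> unfolding curveC_def by auto
  assume bc: "boundary_contact S g gam \<delta> p T \<eta>"
  define v where "v = vector_derivative g (at t)"
  have gd: "(g has_vector_derivative v) (at t)" unfolding v_def by (rule regular_jordan_derivative(1)[OF g])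
  have on: "(g \<tau> - c0) \<bullet> (g \<tau> - c0) = \<rho>\<^sup>2" for \<tau>
  proof -
    have "g \<tau> = g (frac \<tau>)" using regular_jordan_periodic[OF g, of \<tau> "- \<lfloor>\<tau>\<rfloor>"] by (simp add: frac_def)
    then have "g \<tau> \<in> curveC g" unfolding curveC_def
      by (metis atLeastAtMost_iff frac_ge_0 frac_lt_1 image_eqI less_imp_le)
    then have "g \<tau> \<in> sphere c0 \<rho>" using C by simp
    then show ?thesis by (simp add: dist_norm norm_minus_commute power2_norm_eq_inner[symmetric])
  qed
  have "((\<lambda>\<tau>. (g \<tau> - c0) \<bullet> (g \<tau> - c0)) has_derivative (\<lambda>h. (g t - c0) \<bullet> (h *\<^sub>R v) + (h *\<^sub>R v) \<bullet> (g t - c0))) (at t)"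
    using gd unfolding has_vector_derivative_def by (auto intro!: derivative_eq_intros)
  moreover have "((\<lambda>\<tau>. (g \<tau> - c0) \<bullet> (g \<tau> - c0)) has_derivative (\<lambda>h. 0)) (at t)" unfolding on by simp
  ultimately have "(\<lambda>h. (g t - c0) \<bullet> (h *\<^sub>R v) + (h *\<^sub>R v) \<bullet> (g t - c0)) = (\<lambda>h. 0)" by (rule has_derivative_unique)
  from fun_cong[OF this, of 1] have wv: "(g t - c0) \<bullet> v = 0" by (simp add: inner_commute)
  obtain w1 w2 where w: "hproj p - c0 = (w1, w2)" by fastforce
  obtain v1 v2 where vv: "v = (v1, v2)" by fastforce
  have wv': "w1 * v1 + w2 * v2 = 0" using wv unfolding t w vv by simp
  define n where "n = norm v"
  have n0: "n > 0" using regular_jordan_derivative(2)[OF g, of t] by (simp add: n_def v_def)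
  have n2: "n\<^sup>2 = v1\<^sup>2 + v2\<^sup>2" by (simp add: n_def vv norm_prod_def)
  define N where "N = sigma_normal g t"
  have N: "N = (v2 / n, - v1 / n, 0)" unfolding N_def sigma_normal_def Let_def v_def[symmetric] n_def[symmetric] by (simp add: vv)
  define m where "m = (w1 * v2 - w2 * v1) / n"
  have wm: "(hproj p - c0) \<bullet> hproj u = m * (N \<bullet> u)" for u
  proof -
    obtain u1 u2 u3 where u: "u = (u1, u2, u3)" using prod_cases3 by blast
    have "n\<^sup>2 * (w1 * u1 + w2 * u2) = (w1 * v2 - w2 * v1) * (v2 * u1 - v1 * u2)"
      unfolding n2 using wv' by algebra
    then have "w1 * u1 + w2 * u2 = (w1 * v2 - w2 * v1) * (v2 * u1 - v1 * u2) / n\<^sup>2" using n0 by (simp add: field_simps)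
    also have "\<dots> = m * (v2 / n * u1 + - v1 / n * u2)" using n0 by (simp add: m_def power2_eq_square field_simps)
    finally show ?thesis by (simp add: w u N inner_prod_def)
  qed
  have m2: "m\<^sup>2 = \<rho>\<^sup>2"
  proof -
    have e: "w1\<^sup>2 + w2\<^sup>2 = \<rho>\<^sup>2" using on[of t] unfolding t w by (simp add: power2_eq_square)
    have "(w1 * v2 - w2 * v1)\<^sup>2 = (w1\<^sup>2 + w2\<^sup>2) * (v1\<^sup>2 + v2\<^sup>2)" using wv' by algebra
    then have "m\<^sup>2 = (w1\<^sup>2 + w2\<^sup>2) * n\<^sup>2 / n\<^sup>2" unfolding m_def power_divide n2 by simp
    then show ?thesis using n0 e by simp
  qed
  have NT: "N \<bullet> T = 0" and Ne: "(N \<bullet> \<eta>)\<^sup>2 = (sin gam)\<^sup>2" using bc t unfolding boundary_contact_def N_def by blast+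
  show "(hproj p - c0) \<bullet> hproj T = 0" unfolding wm NT by simp
  have sq: "((hproj p - c0) \<bullet> hproj \<eta>)\<^sup>2 = (\<rho> * sin gam)\<^sup>2"
    unfolding wm power_mult_distrib m2 Ne ..
  note out = outside_circle[OF cap C(2)]
  \<comment> \<open>The radius is smallest on the boundary. Applying the boundary condition to the
    radius alone (profile zero) excludes the negative sign.\<close>
  have "local_max_on (\<lambda>x. (-1) * ((rad c0 x)\<^sup>2 - 0)) S p"
    unfolding local_max_on_def
  proof (intro conjI exI[of _ UNIV] ballI)
    fix X assume "X \<in> S \<inter> UNIV"
    then have "\<rho>\<^sup>2 \<le> (rad c0 X)\<^sup>2" using out[of X] C by (intro power_mono) auto
    then show "(-1) * ((rad c0 X)\<^sup>2 - 0) \<le> (-1) * ((rad c0 p)\<^sup>2 - 0)" unfolding dp by simp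
  qed (use p surf_boundary_subset in auto)
  from rotational_boundary_max(2)[OF bc, where \<Psi>="\<lambda>_. 0" and \<sigma>="-1", OF DERIV_const this]
  have "(hproj p - c0) \<bullet> hproj \<eta> \<ge> 0" by simp
  moreover have "\<rho> * sin gam \<ge> 0" using C capD(10,11) sin_ge_zero by simp
  ultimately show "(hproj p - c0) \<bullet> hproj \<eta> = \<rho> * sin gam"
    using sq by (simp add: power2_eq_iff_nonneg)
qed

section \<open>Circular cylinders\<close>

text \<open>Uniform continuity on a compact box of parameters and radii. The truncation
  \<open>max 1\<close> keeps the argument of arcosh in its domain even where \<open>b\<close>
  exceeds \<open>r\<close>.\<close>

lemma arcosh_barrier_close:
  fixes a \<rho> R e :: real
  assumes a: "a > 0" and e: "e > 0"
  shows "\<exists>d>0. d \<le> a / 2 \<and> (\<forall>b c r. \<bar>b - a\<bar> < d \<longrightarrow> \<bar>c - a\<bar> < d \<longrightarrow> r \<in> {\<rho>..R} \<longrightarrow>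
     \<bar>c * arcosh (max 1 (r / b)) - a * arcosh (max 1 (r / a))\<bar> < e)"
proof -
  define K where "K = {a/2..2*a} \<times> {a/2..2*a} \<times> {\<rho>..R}"
  define F where "F = (\<lambda>x::R3. fst (snd x) * arcosh (max 1 (snd (snd x) / fst x)))"
  have "continuous_on K (\<lambda>x. arcosh (max 1 (snd (snd x) / fst x)))"
  proof (rule continuous_on_compose2[OF continuous_on_arcosh[of "{1..}"]])
    show "continuous_on K (\<lambda>x. max 1 (snd (snd x) / fst x))"
      by (intro continuous_intros) (use a in \<open>auto simp: K_def\<close>)
  qed auto
  then have "continuous_on K F" unfolding F_def by (intro continuous_intros)
  moreover have "compact K" unfolding K_def by (intro compact_Times compact_Icc)
  ultimately have "uniformly_continuous_on K F" by (rule compact_uniformly_continuous)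
  then obtain d where d: "d > 0" "\<And>x y. x \<in> K \<Longrightarrow> y \<in> K \<Longrightarrow> dist y x < d \<Longrightarrow> dist (F y) (F x) < e"
    using e unfolding uniformly_continuous_on_def by blast
  define d' where "d' = min (d / 2) (a / 2)"
  have "\<bar>c * arcosh (max 1 (r / b)) - a * arcosh (max 1 (r / a))\<bar> < e"
    if h: "\<bar>b - a\<bar> < d'" "\<bar>c - a\<bar> < d'" "r \<in> {\<rho>..R}" for b c r
  proof -
    have bc: "\<bar>b - a\<bar> < a / 2" "\<bar>c - a\<bar> < a / 2" "\<bar>b - a\<bar> + \<bar>c - a\<bar> < d" using h(1,2) by (auto simp: d'_def)
    have "b \<in> {a/2..2*a}" "c \<in> {a/2..2*a}" using bc(1,2) unfolding atLeastAtMost_iff by linarith+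
    then have "(b, c, r) \<in> K" "(a, a, r) \<in> K" using h(3) a unfolding K_def by auto
    moreover have "dist (b, c, r) (a, a, r) < d"
    proof -
      have "dist (b, c, r) (a, a, r) = sqrt (\<bar>b - a\<bar>\<^sup>2 + \<bar>c - a\<bar>\<^sup>2)" by (simp add: dist_Pair_Pair dist_real_def)
      also have "\<dots> \<le> \<bar>b - a\<bar> + \<bar>c - a\<bar>" by (rule sqrt_sum_squares_le_sum) auto
      finally show ?thesis using bc by linarith
    qed
    ultimately have "dist (F (b, c, r)) (F (a, a, r)) < e" by (intro d(2))
    then show ?thesis by (simp add: F_def dist_real_def)
  qed
  moreover have "d' > 0" "d' \<le> a / 2" using d a by (auto simp: d'_def)
  ultimately show ?thesis by blast
qed

text \<open>A vertical circular cylinder is not minimal: a locally constant radius would give a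
  local maximum of \<open>r^2\<close>, whose Hessian has positive trace \<open>2 * (1 + m)\<close>.
  Interior points are available in every relatively open piece of \<open>S\<close>.\<close>

lemma radius_not_locally_constant:
  assumes cap: "capillary_surface S g gam" and X: "X \<in> S" and O': "open O'" "X \<in> O'"
  shows "\<exists>Y\<in>S \<inter> O'. rad q Y \<noteq> \<rho>"
proof (rule ccontr)
  assume "\<not> (\<exists>Y\<in>S \<inter> O'. rad q Y \<noteq> \<rho>)"
  then have const: "\<And>Y. Y \<in> S \<Longrightarrow> Y \<in> O' \<Longrightarrow> rad q Y = \<rho>" by blast
  note capD = capillary_surfaceD[OF cap]
  obtain f W V z where ch: "surface_chart S f W V" "z \<in> V" "X = f z"
    using capD(2) X unfolding embedded_surface_def by blast
  have VW: "V \<subseteq> W" and fV: "f ` V \<subseteq> S" and V: "V \<subseteq> halfplane"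
    using ch(1) openin_imp_subset unfolding surface_chart_def by blast+
  have cf: "continuous_on V f" using chart_continuous_on[OF ch(1)] VW continuous_on_subset by blast
  have evV: "\<forall>\<^sub>F t in at_right 0. z + t *\<^sub>R (0, 1) \<in> V"
    by (rule chart_direction_eventually[OF ch(1,2)]) simp
  have "((\<lambda>t. z + t *\<^sub>R (0, 1)) \<longlongrightarrow> z + 0 *\<^sub>R (0, 1)) (at_right (0::real))" by (intro tendsto_intros)
  then have l: "((\<lambda>t. z + t *\<^sub>R (0, 1)) \<longlongrightarrow> z) (at_right (0::real))" by (simp add: zero_prod_def[symmetric])
  have "((\<lambda>t. f (z + t *\<^sub>R (0, 1))) \<longlongrightarrow> f z) (at_right 0)"
    by (rule continuous_on_tendsto_compose[OF cf l ch(2) evV])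
  then have "\<forall>\<^sub>F t in at_right 0. f (z + t *\<^sub>R (0, 1)) \<in> O'"
    using O' ch(3) by (metis topological_tendstoD)
  moreover have "\<forall>\<^sub>F t in at_right (0::real). t > 0" by (simp add: eventually_at_right_less)
  ultimately have "\<forall>\<^sub>F t in at_right 0. f (z + t *\<^sub>R (0, 1)) \<in> O' \<and> z + t *\<^sub>R (0, 1) \<in> V \<and> t > 0"
    using evV by eventually_elim auto
  then obtain t where t: "f (z + t *\<^sub>R (0, 1)) \<in> O'" "z + t *\<^sub>R (0, 1) \<in> V" "t > 0"
    using eventually_happens[of _ "at_right (0::real)"] by auto
  define Y where "Y = f (z + t *\<^sub>R (0, 1))"
  have "snd z \<ge> 0" using V ch(2) by (auto simp: halfplane_def)
  then have "snd (z + t *\<^sub>R (0, 1)) > 0" using t(3) by simp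
  then have Yi: "Y \<in> surf_interior S" unfolding surf_interior_def Y_def using ch(1) t(2) by blast
  have YS: "Y \<in> S" using fV t(2) by (auto simp: Y_def)
  have "local_max_on (\<lambda>x. 1 * ((rad q x)\<^sup>2 - 0)) S Y"
    unfolding local_max_on_def using YS O'(1) t(1) const by (intro conjI exI[of _ O']) (auto simp: Y_def)
  from interior_max_rotational[OF capD(1) Yi, of "\<lambda>_. 0" "\<lambda>_. 0" 0 1 q, OF DERIV_const DERIV_const this]
  show False by auto
qed

text \<open>Two numbers have to agree: the growth \<open>k\<close> of the end, and \<open>A\<close>,
  up to sign the waist radius of the catenoid meeting the cylinder at the angle \<open>gam\<close>.
  Barriers with \<open>b\<close>, \<open>c\<close> between them exclude both strict inequalities.
  Once \<open>A = k\<close>, barriers close to this catenoid are compared on bounded radii, where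
  the asymptotics decide.\<close>

lemma circular_catenoid:
  assumes g: "regular_jordan g" and cap: "capillary_surface S g gam" and gr: "boundary_graph_over S g"
    and C: "\<rho> > 0" "curveC g = sphere c0 \<rho>" and k0: "\<kappa> \<noteq> 0"
    and comp: "\<And>R. compact (S \<inter> {X. rad c0 X \<le> R})"
    and lim: "\<And>e. e > 0 \<Longrightarrow> \<exists>R>0. \<forall>X\<in>S. rad c0 X \<ge> R \<longrightarrow> \<bar>zc X - \<kappa> * ln (rad c0 X) - l\<bar> < e"
    and unb: "\<And>R. \<exists>X\<in>S. rad c0 X \<ge> R"
  shows "\<exists>a h. a > 0 \<and> S \<subseteq> {p. rad c0 p = a * cosh ((zc p - h) / a)}"
proof -
  note capD = capillary_surfaceD[OF cap]
  let ?r = "\<lambda>X. rad c0 X"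
  obtain \<delta> where d: "\<delta> = 1 \<or> \<delta> = -1" "\<And>p. p \<in> surf_boundary S \<Longrightarrow> \<exists>T \<eta>. boundary_contact S g gam \<delta> p T \<eta>"
    using boundary_contact_exists[OF g cap gr] by blast
  \<comment> \<open>Reflects the height if necessary so that the end goes up.\<close>
  define s :: real where "s = (if \<kappa> > 0 then 1 else -1)"
  have s: "s = 1 \<or> s = -1" by (simp add: s_def)
  define k where "k = s * \<kappa>"
  have k: "k > 0" using k0 by (auto simp: k_def s_def)
  \<comment> \<open>On \<open>r = a cosh (z / a)\<close> the upward conormal at radius
    \<open>\<rho>\<close> has vertical component \<open>a / \<rho>\<close>, so the contact angle
    selects \<open>a = \<rho> * \<bar>cos gam\<bar>\<close>. The sign is negative when the conormal
    of \<open>S\<close> points against the direction of the end.\<close>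
  define A where "A = \<rho> * (s * \<delta> * \<bar>cos gam\<bar>)"
  define \<Omega> where "\<Omega> = \<rho> * sin gam"
  have "(s * \<delta>)\<^sup>2 = 1" using s d(1) by auto
  then have A2: "A\<^sup>2 = \<rho>\<^sup>2 * (cos gam)\<^sup>2" by (simp add: A_def power_mult_distrib)
  have \<Omega>0: "\<Omega> \<ge> 0" using C capD(10,11) sin_ge_zero by (simp add: \<Omega>_def)
  have \<Omega>A: "\<Omega>\<^sup>2 = \<rho>\<^sup>2 - A\<^sup>2"
    unfolding A2 \<Omega>_def power_mult_distrib sin_squared_eq by (simp add: algebra_simps)
  have A\<rho>: "A \<le> \<rho>"
  proof -
    have "\<rho>\<^sup>2 - A\<^sup>2 \<ge> 0" unfolding \<Omega>A[symmetric] by simp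
    then have "A\<^sup>2 \<le> \<rho>\<^sup>2" by simp
    then show ?thesis by (rule power2_le_imp_le) (use C(1) in simp)
  qed
  have out: "?r X \<ge> \<rho>" if "X \<in> S" for X by (rule outside_circle[OF cap C(2) that])
  have contact: "zc \<eta> = \<delta> * \<bar>cos gam\<bar>" if "boundary_contact S g gam \<delta> p T \<eta>" "zc T = 0" for p T \<eta>
  proof -
    have "(norm (hproj T))\<^sup>2 = 1"
      using that norm_hproj_zc[of T] by (simp add: boundary_contact_def)
    then have "norm (hproj T) = 1" using power2_eq_iff_nonneg[of "norm (hproj T)" 1] by simp
    then show ?thesis using that unfolding boundary_contact_def by simp
  qed
  \<comment> \<open>At the boundary contact the conormal inequality reads
    \<open>\<omega> * A \<le> c * \<Omega>\<close>, whereas \<open>b < A\<close> gives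
    \<open>\<Omega> \<le> \<omega>\<close> and \<open>c < A\<close>.\<close>
  have below_false: False
    if bc: "0 < c" "c < b" "b < A" and X0: "X0 \<in> S" and O': "open O'" "X0 \<in> O'"
      and max: "\<forall>X\<in>S \<inter> O'. barrier s b c c0 X \<le> barrier s b c c0 X0"
    for b c X0 O'
  proof -
    have "\<forall>X\<in>S. ?r X > b" using out A\<rho> bc by force
    note below = contact_from_below[OF cap s bc(1,2) X0 O' this max]
    obtain T \<eta> where con: "boundary_contact S g gam \<delta> X0 T \<eta>" using d(2)[OF below(1)] by blast
    note cc = circle_contact[OF g cap C below(1)]
    define \<omega> where "\<omega> = sqrt (\<rho>\<^sup>2 - b\<^sup>2)"
    have "b\<^sup>2 < \<rho>\<^sup>2" using bc A\<rho> by (intro power_strict_mono) auto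
    then have \<omega>: "\<omega> > 0" by (simp add: \<omega>_def)
    have "s * (\<rho> * \<omega>) * zc T = 0"
      using below(2)[OF con] cc(2)[OF con] unfolding cc(1) \<omega>_def by simp
    then have "zc T = 0" using s \<omega> C(1) by auto
    note ze = contact[OF con this]
    have "s * (\<rho> * \<omega>) * (\<delta> * \<bar>cos gam\<bar>) \<le> c * \<Omega>"
      using below(3)[OF con] unfolding cc(3)[OF con] ze unfolding cc(1) \<omega>_def \<Omega>_def .
    then have i: "\<omega> * A \<le> c * \<Omega>" by (simp add: A_def mult_ac)
    have "b\<^sup>2 \<le> A\<^sup>2" using bc by (intro power_mono) auto
    then have "\<Omega>\<^sup>2 \<le> \<omega>\<^sup>2" unfolding \<Omega>A \<omega>_def using \<open>b\<^sup>2 < \<rho>\<^sup>2\<close> by simp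
    then have "\<Omega> \<le> \<omega>" by (rule power2_le_imp_le) (use \<omega> in simp)
    then have "c * \<Omega> \<le> c * \<omega>" using bc by simp
    also have "\<dots> < A * \<omega>" using bc \<omega> by simp
    finally show False using i by (simp add: mult.commute)
  qed
  \<comment> \<open>The reversed inequality \<open>c * \<Omega> \<le> \<omega> * A\<close> fails for
    positive \<open>A\<close> because \<open>A < b\<close> gives \<open>\<omega> < \<Omega>\<close>.
    For \<open>A \<le> 0\<close> the sign decides as soon as \<open>\<omega> > 0\<close>; the
    assumption on \<open>b\<close> excludes \<open>b = \<rho>\<close> there, where
    \<open>\<omega>\<close> vanishes.\<close>
  have above_false: False
    if bc: "0 < b" "b < c" "A < b" "b \<noteq> \<rho> \<or> A > 0" and X0: "X0 \<in> S" "?r X0 \<ge> b" and O': "open O'" "X0 \<in> O'"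
      and min: "\<forall>X\<in>S \<inter> O'. ?r X \<ge> b \<longrightarrow> barrier s b c c0 X \<ge> barrier s b c c0 X0"
    for b c X0 O'
  proof -
    note above = contact_from_above[OF cap s bc(1,2) X0 O' min]
    obtain T \<eta> where con: "boundary_contact S g gam \<delta> X0 T \<eta>" using d(2)[OF above(1)] by blast
    note cc = circle_contact[OF g cap C above(1)]
    define \<omega> where "\<omega> = sqrt (\<rho>\<^sup>2 - b\<^sup>2)"
    have b\<rho>: "b \<le> \<rho>" using X0(2) unfolding cc(1) .
    then have b2: "b\<^sup>2 \<le> \<rho>\<^sup>2" using bc by (intro power_mono) auto
    then have \<omega>: "\<omega> \<ge> 0" and \<omega>2: "\<omega>\<^sup>2 = \<rho>\<^sup>2 - b\<^sup>2" by (simp_all add: \<omega>_def)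
    have zT: "s * (\<rho> * \<omega>) * zc T = 0"
      using above(2)[OF con] cc(2)[OF con] unfolding cc(1) \<omega>_def by simp
    have ze: "c * \<Omega> \<le> s * (\<rho> * \<omega>) * zc \<eta>"
      using above(3)[OF con] unfolding cc(3)[OF con] unfolding cc(1) \<omega>_def \<Omega>_def .
    have i: "c * \<Omega> \<le> \<omega> * A"
    proof (cases "\<omega> = 0")
      case True then show ?thesis using ze by simp
    next
      case False
      then have "zc T = 0" using zT s C(1) by auto
      from contact[OF con this] ze show ?thesis by (simp add: A_def mult_ac)
    qed
    show False
    proof (cases "A > 0")
      case True
      have "A\<^sup>2 < b\<^sup>2" using True bc by (intro power_strict_mono) auto
      then have "\<omega>\<^sup>2 < \<Omega>\<^sup>2" unfolding \<omega>2 \<Omega>A by simp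
      then have w: "\<omega> < \<Omega>" by (rule power2_less_imp_less) (rule \<Omega>0)
      then have "\<omega> * A \<le> \<Omega> * A" using True by (intro mult_right_mono) auto
      also have "\<dots> < \<Omega> * c" using w \<omega> bc by (intro mult_strict_left_mono) auto
      finally show False using i by (simp add: mult.commute)
    next
      case False
      then have "b < \<rho>" using b\<rho> bc(4) by auto
      then have "b\<^sup>2 < \<rho>\<^sup>2" using bc by (intro power_strict_mono) auto
      then have wp: "\<omega> > 0" by (simp add: \<omega>_def)
      have "\<omega> * A \<le> 0" using wp False by (simp add: mult_le_0_iff)
      then have "c * \<Omega> \<le> 0" using i by linarith
      then have \<Omega>z: "\<Omega> = 0" using \<Omega>0 bc by (simp add: mult_le_0_iff)
      then have "\<omega> * A \<ge> 0" using i by simp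
      then have "A = 0" using wp False by (simp add: zero_le_mult_iff)
      then show False using \<Omega>A \<Omega>z C(1) by simp
    qed
  qed
  have lim1: "\<exists>R>0. \<forall>X\<in>S. ?r X \<ge> R \<longrightarrow> \<bar>zc X - \<kappa> * ln (?r X) - l\<bar> < 1" using lim[of 1] by simp
  have "A \<ge> k"
  proof (rule ccontr)
    assume "\<not> A \<ge> k"
    define m where "m = max A 0"
    have m: "m < k" "m \<ge> 0" "m \<ge> A" using \<open>\<not> A \<ge> k\<close> k by (auto simp: m_def)
    define c where "c = m + (k - m) / 2"
    \<comment> \<open>The order \<open>A < b < c < k\<close> makes the minimum exist
      (\<open>c < k\<close>) and its boundary contact contradictory. Two candidates are offered so
      that one of them differs from \<open>\<rho>\<close>, as \<open>above_false\<close> requires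
      when \<open>A\<close> is not positive.\<close>
    define b where "b = (if m + (k - m) / 3 = \<rho> then m + (k - m) / 4 else m + (k - m) / 3)"
    have bc: "b \<noteq> \<rho>" "m < b" "b < c" "c < k" using m by (auto simp: b_def c_def field_simps)
    have bc': "0 < b" "A < b" "0 < c" using bc m by auto
    obtain X0 where X0: "X0 \<in> S" "?r X0 \<ge> b"
      "\<forall>X\<in>S. ?r X \<ge> b \<longrightarrow> barrier s b c c0 X \<ge> barrier s b c c0 X0"
      using barrier_min_attained[OF comp unb lim1 s bc'(1,3)] bc(4) unfolding k_def by blast
    show False
      by (rule above_false[OF bc'(1) bc(3) bc'(2) _ X0(1,2) open_UNIV UNIV_I]) (use X0(3) bc in auto)
  qed
  moreover have "A \<le> k"
  proof (rule ccontr)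
    assume "\<not> A \<le> k"
    \<comment> \<open>Now \<open>k < c < b < A\<close>: the growth of the end is slower than that of
      the barrier, so a maximum exists, and \<open>below_false\<close> excludes it.\<close>
    define c where "c = k + (A - k) / 3"
    define b where "b = k + (A - k) / 2"
    have bc: "k < c" "c < b" "b < A" "0 < c" "0 < b" using \<open>\<not> A \<le> k\<close> k by (auto simp: b_def c_def field_simps)
    have ne: "S \<noteq> {}" using unb by blast
    have rb: "?r X \<ge> b" if "X \<in> S" for X using out[OF that] A\<rho> bc by linarith
    obtain X0 where X0: "X0 \<in> S" "\<forall>X\<in>S. barrier s b c c0 X \<le> barrier s b c c0 X0"
      using barrier_max_attained[OF comp ne lim1 s bc(5,4) _ rb] bc(1) unfolding k_def by blast
    show False
      by (rule below_false[OF bc(4,2,3) X0(1) open_UNIV UNIV_I]) (use X0(2) in auto)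
  qed
  ultimately have Ak: "A = k" by simp
  define a where "a = k"
  have a: "a > 0" "a \<le> \<rho>" "A = a" using k Ak A\<rho> by (auto simp: a_def)
  \<comment> \<open>The limit of \<open>\<psi>\<close> along the end, from
    \<open>arcosh x = ln (2 * x) + o(1)\<close>.\<close>
  define L where "L = s * l - a * ln (2 / a)"
  define \<psi> where "\<psi> X = s * zc X - a * arcosh (?r X / a)" for X
  have ra: "?r X / a \<ge> 1" if "X \<in> S" for X using out[OF that] a by simp
  have lim\<psi>: "\<exists>R>0. \<forall>X\<in>S. ?r X \<ge> R \<longrightarrow> \<bar>\<psi> X - L\<bar> < e" if e: "e > 0" for e
  proof -
    obtain R where R: "R > 0" "\<And>X. X \<in> S \<Longrightarrow> ?r X \<ge> R \<Longrightarrow> \<bar>zc X - \<kappa> * ln (?r X) - l\<bar> < e / 2"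
      using lim[of "e / 2"] e by auto
    have "\<forall>\<^sub>F x::real in at_top. dist (arcosh x - ln (2 * x)) 0 < e / (2 * a)"
      by (rule tendstoD[OF arcosh_asymp]) (use e a in simp)
    then obtain Q where Q: "\<And>x. x \<ge> Q \<Longrightarrow> \<bar>arcosh x - ln (2 * x)\<bar> < e / (2 * a)"
      unfolding eventually_at_top_linorder by auto
    have "\<bar>\<psi> X - L\<bar> < e" if X: "X \<in> S" "?r X \<ge> max R (a * Q)" for X
    proof -
      have rp: "?r X > 0" using X R by auto
      have "?r X / a \<ge> Q" using X a by (simp add: field_simps)
      from Q[OF this] have "a * \<bar>arcosh (?r X / a) - ln (2 * (?r X / a))\<bar> < a * (e / (2 * a))"
        using a by (intro mult_strict_left_mono) auto
      then have 1: "\<bar>a * (arcosh (?r X / a) - ln (2 * (?r X / a)))\<bar> < e / 2" using a by (simp add: abs_mult)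
      have 2: "\<bar>s * (zc X - \<kappa> * ln (?r X) - l)\<bar> < e / 2" using R(2)[OF X(1)] X s by (auto simp: abs_mult)
      have "ln (2 * (?r X / a)) = ln (?r X) + ln (2 / a)" using rp a by (simp add: ln_mult ln_div)
      moreover have "s * \<kappa> = a" by (simp add: a_def k_def)
      ultimately have "\<psi> X - L = s * (zc X - \<kappa> * ln (?r X) - l) - a * (arcosh (?r X / a) - ln (2 * (?r X / a)))"
        unfolding \<psi>_def L_def by (simp add: algebra_simps)
      with 1 2 show ?thesis by linarith
    qed
    moreover have "max R (a * Q) > 0" using R by simp
    ultimately show ?thesis by blast
  qed
  have upper: "\<psi> X1 \<le> L" if X1: "X1 \<in> S" for X1
  proof (rule ccontr)
    assume "\<not> \<psi> X1 \<le> L"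
    \<comment> \<open>The maximum is taken over \<open>r \<le> R\<close> only, since for
      \<open>c < a\<close> the barrier function is unbounded along the end. With a quarter of the
      gap, \<open>f X1\<close> exceeds \<open>L + 3 * e\<close> while \<open>f\<close> stays below
      \<open>L + 2 * e\<close> on \<open>r = R\<close>, so the maximum is not on the artificial
      boundary.\<close>
    define e where "e = (\<psi> X1 - L) / 4"
    have e: "e > 0" using \<open>\<not> \<psi> X1 \<le> L\<close> by (simp add: e_def)
    obtain R0 where R0: "R0 > 0" "\<And>X. X \<in> S \<Longrightarrow> ?r X \<ge> R0 \<Longrightarrow> \<bar>\<psi> X - L\<bar> < e" using lim\<psi>[OF e] by blast
    define R where "R = max R0 (?r X1)"
    obtain d where d: "d > 0" "d \<le> a / 2"
      "\<And>b c r. \<bar>b - a\<bar> < d \<Longrightarrow> \<bar>c - a\<bar> < d \<Longrightarrow> r \<in> {\<rho>..R} \<Longrightarrow> \<bar>c * arcosh (max 1 (r / b)) - a * arcosh (max 1 (r / a))\<bar> < e"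
      using arcosh_barrier_close[OF a(1) e, of \<rho> R] by blast
    define b where "b = a - d / 3"
    define c where "c = a - d / 2"
    have bc: "0 < c" "c < b" "b < A" "0 < b" "\<bar>b - a\<bar> < d" "\<bar>c - a\<bar> < d" using d a by (auto simp: b_def c_def)
    define f where "f X = barrier s b c c0 X" for X
    have close: "\<bar>f X - \<psi> X\<bar> < e" if X: "X \<in> S" "?r X \<le> R" for X
    proof -
      have "?r X / b \<ge> 1" using out[OF X(1)] a bc by simp
      then show ?thesis using d(3)[OF bc(5,6), of "?r X"] out[OF X(1)] X ra[OF X(1)]
        by (simp add: f_def \<psi>_def max_def split: if_splits)
    qed
    let ?K = "S \<inter> {X. ?r X \<le> R}"
    have "continuous_on ?K f" unfolding f_def
      by (intro continuous_on_diff continuous_on_mult continuous_on_const continuous_on_zc continuous_on_id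
          continuous_on_arcosh_radius bc) (use out a bc in force)
    moreover have X1K: "X1 \<in> ?K" using X1 by (simp add: R_def)
    ultimately obtain X0 where X0: "X0 \<in> ?K" "\<And>X. X \<in> ?K \<Longrightarrow> f X \<le> f X0"
      using continuous_attains_sup[OF comp[of R], of f] by blast
    have "?r X0 \<noteq> R"
    proof
      assume "?r X0 = R"
      then have "\<bar>\<psi> X0 - L\<bar> < e" using R0(2)[of X0] X0(1) by (simp add: R_def)
      moreover have "\<bar>f X0 - \<psi> X0\<bar> < e" "\<bar>f X1 - \<psi> X1\<bar> < e" using close X0(1) X1K by auto
      moreover have "f X1 \<le> f X0" using X0(2)[OF X1K] .
      moreover have "\<psi> X1 = L + 4 * e" by (simp add: e_def field_simps)
      ultimately show False by linarith
    qed
    then have "?r X0 < R" using X0(1) by simp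
    moreover have "\<forall>X\<in>S \<inter> {X. ?r X < R}. barrier s b c c0 X \<le> barrier s b c c0 X0"
    proof
      fix X assume "X \<in> S \<inter> {X. ?r X < R}"
      then have "f X \<le> f X0" by (intro X0(2)) auto
      then show "barrier s b c c0 X \<le> barrier s b c c0 X0" by (simp add: f_def)
    qed
    moreover have "open {X. ?r X < R}" by (intro open_Collect_less continuous_intros)
    ultimately show False
      using below_false[OF bc(1-3), of X0 "{X. ?r X < R}"] X0(1) by blast
  qed
  have lower: "\<psi> X1 \<ge> L" if X1: "X1 \<in> S" "?r X1 > \<rho>" for X1
  proof (rule ccontr)
    assume "\<not> \<psi> X1 \<ge> L"
    define e where "e = (L - \<psi> X1) / 4"
    have e: "e > 0" using \<open>\<not> \<psi> X1 \<ge> L\<close> by (simp add: e_def)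
    obtain R0 where R0: "R0 > 0" "\<And>X. X \<in> S \<Longrightarrow> ?r X \<ge> R0 \<Longrightarrow> \<bar>\<psi> X - L\<bar> < e" using lim\<psi>[OF e] by blast
    define R where "R = max R0 (?r X1)"
    obtain d where d: "d > 0" "d \<le> a / 2"
      "\<And>b c r. \<bar>b - a\<bar> < d \<Longrightarrow> \<bar>c - a\<bar> < d \<Longrightarrow> r \<in> {\<rho>..R} \<Longrightarrow> \<bar>c * arcosh (max 1 (r / b)) - a * arcosh (max 1 (r / a))\<bar> < e"
      using arcosh_barrier_close[OF a(1) e, of \<rho> R] by blast
    \<comment> \<open>Keeps \<open>b\<close> at most the radius of \<open>X1\<close>. For
      \<open>a = \<rho>\<close> the perturbed waist exceeds the radius of the cylinder, which is why
      \<open>lower\<close> speaks of points strictly outside it.\<close>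
    define d' where "d' = min d (?r X1 - \<rho>)"
    have d': "d' > 0" "d' \<le> d" "d' \<le> ?r X1 - \<rho>" using d X1 by (auto simp: d'_def)
    define b where "b = a + d' / 3"
    define c where "c = a + d' / 2"
    have bc: "0 < b" "b < c" "A < b" "\<bar>b - a\<bar> < d" "\<bar>c - a\<bar> < d" "b \<le> ?r X1" using d' a by (auto simp: b_def c_def)
    define f where "f X = c * arcosh (?r X / b) - s * zc X" for X
    have close: "\<bar>f X + \<psi> X\<bar> < e" if X: "X \<in> S" "?r X \<le> R" "?r X \<ge> b" for X
    proof -
      have "?r X / b \<ge> 1" using bc X by simp
      then show ?thesis using d(3)[OF bc(4,5), of "?r X"] out[OF X(1)] X ra[OF X(1)]
        by (simp add: f_def \<psi>_def max_def split: if_splits)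
    qed
    let ?K = "S \<inter> {X. ?r X \<le> R} \<inter> {X. ?r X \<ge> b}"
    have cK: "compact ?K"
      by (intro compact_Int_closed comp closed_Collect_le continuous_intros)
    have "continuous_on ?K f" unfolding f_def
      by (intro continuous_on_diff continuous_on_mult continuous_on_const continuous_on_zc continuous_on_id
          continuous_on_arcosh_radius bc) auto
    moreover have X1K: "X1 \<in> ?K" using X1 bc by (simp add: R_def)
    ultimately obtain X0 where X0: "X0 \<in> ?K" "\<And>X. X \<in> ?K \<Longrightarrow> f X \<le> f X0"
      using continuous_attains_sup[OF cK, of f] by blast
    have "?r X0 \<noteq> R"
    proof
      assume "?r X0 = R"
      then have "\<bar>\<psi> X0 - L\<bar> < e" using R0(2)[of X0] X0(1) by (simp add: R_def)
      moreover have "\<bar>f X0 + \<psi> X0\<bar> < e" "\<bar>f X1 + \<psi> X1\<bar> < e" using close X0(1) X1K by auto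
      moreover have "f X1 \<le> f X0" using X0(2)[OF X1K] .
      moreover have "\<psi> X1 = L - 4 * e" by (simp add: e_def field_simps)
      ultimately show False by linarith
    qed
    then have rR: "?r X0 < R" using X0(1) by simp
    have "\<forall>X\<in>S \<inter> {X. ?r X < R}. ?r X \<ge> b \<longrightarrow> barrier s b c c0 X \<ge> barrier s b c c0 X0"
    proof (intro ballI impI)
      fix X assume "X \<in> S \<inter> {X. ?r X < R}" "?r X \<ge> b"
      then have "f X \<le> f X0" by (intro X0(2)) auto
      then show "barrier s b c c0 X \<ge> barrier s b c c0 X0" by (simp add: f_def)
    qed
    moreover have "open {X. ?r X < R}" by (intro open_Collect_less continuous_intros)
    moreover have "b \<noteq> \<rho> \<or> A > 0" using a by simp
    ultimately show False
      using above_false[OF bc(1-3), of X0 "{X. ?r X < R}"] X0(1) rR by blast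
  qed
  \<comment> \<open>Only points on the cylinder remain. A strict inequality there would persist on a
    relatively open piece of \<open>S\<close>, which contains points off the cylinder.\<close>
  have eq: "\<psi> X = L" if X: "X \<in> S" for X
  proof (rule ccontr)
    assume "\<psi> X \<noteq> L"
    then have lt: "\<psi> X < L" using upper[OF X] by simp
    have "continuous_on S \<psi>" unfolding \<psi>_def
      by (intro continuous_on_diff continuous_on_mult continuous_on_const continuous_on_zc continuous_on_id
          continuous_on_arcosh_radius a) (use out a in force)
    then have "openin (top_of_set S) (S \<inter> \<psi> -` {..<L})" by (rule continuous_openin_preimage_gen) simp
    then obtain O' where O': "open O'" "S \<inter> \<psi> -` {..<L} = S \<inter> O'" unfolding openin_open by blast
    have "X \<in> O'" using O'(2) X lt by blast
    then obtain Y where Y: "Y \<in> S" "Y \<in> O'" "?r Y \<noteq> \<rho>"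
      using radius_not_locally_constant[OF cap X O'(1), of c0 \<rho>] by blast
    then have "\<psi> Y < L" using O'(2) by blast
    moreover have "?r Y > \<rho>" using Y out[OF Y(1)] by simp
    ultimately show False using lower[OF Y(1)] by simp
  qed
  have "?r X = a * cosh ((zc X - s * L) / a)" if X: "X \<in> S" for X
  proof -
    have "a * arcosh (?r X / a) = s * zc X - L" using eq[OF X] by (simp add: \<psi>_def)
    then have "arcosh (?r X / a) = (s * zc X - L) / a" using a by (simp add: field_simps)
    then have "cosh ((s * zc X - L) / a) = ?r X / a" using ra[OF X] by (metis cosh_arcosh_real)
    \<comment> \<open>Undoes the reflection by \<open>s\<close>; cosh is even, so the axis is
      unchanged and the waist lies at height \<open>s * L\<close>.\<close>
    moreover have "cosh ((s * zc X - L) / a) = cosh ((zc X - s * L) / a)"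
      using s
    proof
      assume "s = -1"
      then have "(s * zc X - L) / a = - ((zc X - s * L) / a)" by (simp add: diff_divide_distrib add_divide_distrib)
      then show ?thesis by (metis cosh_minus)
    qed simp
    ultimately show ?thesis using a by simp
  qed
  then show ?thesis using a(1) by blast
qed

theorem theorem3p2:
  fixes S :: "R3 set" and g :: "real \<Rightarrow> real \<times> real" and gam \<alpha> :: real
  assumes "regular_jordan g"
    and "capillary_surface S g gam"
    and "regular_parallel_end S \<alpha>"
    and "boundary_graph_over S g"
  shows "(\<alpha> = 0 \<longrightarrow> (\<exists>c. S \<subseteq> {p. zc p = c}))
       \<and> (\<alpha> \<noteq> 0 \<longrightarrow> gam \<noteq> pi / 2)
       \<and> (\<forall>c0 \<rho>. \<rho> > 0 \<and> curveC g = sphere c0 \<rho> \<and> \<alpha> \<noteq> 0 \<longrightarrow>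
            (\<exists>a h. a > 0 \<and> S \<subseteq> {p. dist (hproj p) c0 = a * cosh ((zc p - h) / a)}))"
proof -
  note g = assms(1) and cap = assms(2) and gr = assms(4)
  obtain \<kappa> l where k: "\<kappa> = \<alpha> \<or> \<kappa> = - \<alpha>"
    and comp: "\<And>c R. compact (S \<inter> {X. dist (hproj X) c \<le> R})"
    and lim: "\<And>c e. e > 0 \<Longrightarrow> \<exists>R>0. \<forall>X\<in>S. dist (hproj X) c \<ge> R \<longrightarrow> \<bar>zc X - \<kappa> * ln (dist (hproj X) c) - l\<bar> < e"
    and unb: "\<And>c R. \<exists>X\<in>S. dist (hproj X) c \<ge> R"
    using end_asymptotics[OF cap assms(3)] by metis
  have "\<exists>c. S \<subseteq> {p. zc p = c}" if "\<alpha> = 0"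
  proof -
    have "\<kappa> = 0" using k that by auto
    then have lim0: "\<And>c e. e > 0 \<Longrightarrow> \<exists>R>0. \<forall>X\<in>S. dist (hproj X) c \<ge> R \<longrightarrow> \<bar>zc X - l\<bar> < e"
      using lim by simp
    have "cos gam = 0" using planar_oblique_impossible[OF g cap gr _ comp lim0] by blast
    from planar_right_angle[OF g cap gr this comp lim0 unb] show ?thesis by blast
  qed
  moreover have "gam \<noteq> pi / 2" if "\<alpha> \<noteq> 0"
  proof -
    have "\<kappa> \<noteq> 0" using k that by auto
    from catenoidal_not_right_angle[OF g cap gr this comp lim[OF zero_less_one] unb]
    show ?thesis using cos_pi_half by blast
  qed
  moreover have "\<exists>a h. a > 0 \<and> S \<subseteq> {p. dist (hproj p) c0 = a * cosh ((zc p - h) / a)}"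
    if "\<rho> > 0 \<and> curveC g = sphere c0 \<rho> \<and> \<alpha> \<noteq> 0" for c0 \<rho>
    by (rule circular_catenoid[OF g cap gr _ _ _ comp lim unb]) (use that k in auto)
  ultimately show ?thesis by blast
qed

end
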